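(* Fix $\lambda>0$. Let $\sigma$ be a measure on $\mathbb{R}_+=(0,\infty)$ and let $\mu$ be a measure on $\mathbb{R}^2_{+,+}=(0,\infty)\times(0,\infty)$. The following conditions are equivalent: (1) The two-weight inequality holds, namely $$\|\mathsf{P}^{[\lambda]}_\sigma(f)\|_{L^2(\mathbb{R}^2_{+,+};\mu)}\le \mathcal{N}\,\|f\|_{L^2(\mathbb{R}_+;\sigma)}.$$ (2) The following testing conditions hold uniformly over all intervals $I\subset(0,\infty)$: $$\int_{\widehat{3I}} \mathsf{P}^{[\lambda]}_\sigma(1_I)(x,t)^2\,d\mu(x,t)\le \mathcal{F}^2\,\sigma(I),$$ $$\int_{3I}\mathsf{P}^{[\lambda],*}_\mu(t1_{\hat I})(y)^2\,d\sigma(y)\le \mathcal{B}^2\int_{\hat I}t^2\,d\mu(x,t).$$ Moreover, $\mathcal{N}\simeq\mathcal{F}+\mathcal{B}$, where $\mathcal{N},\mathcal{F},\mathcal{B}$ are the best constants in these inequalities.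
   Context: For $\lambda>0$ and $t,x,y>0$, the Poisson kernel of the Bessel operator $\Delta_\lambda=-\frac{d^2}{dx^2}-\frac{2\lambda}{x}\frac{d}{dx}$ on $\mathbb{R}_+$ (the kernel of $e^{-t\sqrt{\Delta_\lambda}}$ with respect to $y^{2\lambda}dy$) is $$\mathsf{P}^{[\lambda]}_t(x,y)=\frac{2\lambda t}{\pi}\int_0^\pi\frac{(\sin\theta)^{2\lambda-1}}{(x^2+y^2+t^2-2xy\cos\theta)^{\lambda+1}}\,d\theta .$$ For a function $f$ on $\mathbb{R}_+$ and a function $g$ on $\mathbb{R}^2_{+,+}$ define $$\mathsf{P}^{[\lambda]}_\sigma(f)(x,t)=\int_0^\infty \mathsf{P}^{[\lambda]}_t(x,y)f(y)\,d\sigma(y),\qquad (x,t)\in\mathbb{R}^2_{+,+},$$ $$\mathsf{P}^{[\lambda],*}_\mu(g)(y)=\int_{\mathbb{R}^2_{+,+}}\mathsf{P}^{[\lambda]}_t(x,y)g(x,t)\,d\mu(x,t),\qquad y\in\mathbb{R}_+.$$ In (1), $\mathcal{N}$ is a finite constant and the inequality is for all $f\in L^2(\mathbb{R}_+;\sigma)$; in (2), $\mathcal{F},\mathcal{B}$ are finite constants independent of $I$. In $\mathsf{P}^{[\lambda],*}_\mu(t1_{\hat I})$ the argument is the function $(x,t)\mapsto t\,1_{\hat I}(x,t)$. $|I|$ denotes the length of an interval $I$ and $1_I$ its indicator function. The interval with center $x$ and radius $r$ is $(x-r,x+r)\cap\mathbb{R}_+$; accordingly $3I$ is the interval with the same center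 as $I$ and length $3|I|$, intersected with $\mathbb{R}_+$. For any interval $J\subset\mathbb{R}_+$, $\hat J=J\times[0,|J|]$; thus $\hat I=I\times[0,|I|]$ and $\widehat{3I}=3I\times[0,|3I|]$, where $|3I|$ is the length of the (truncated) interval $3I$. $X\simeq Y$ means that $X\le CY$ and $Y\le CX$ for an absolute constant $C$ ($\lambda$ being fixed; in particular $C$ does not depend on $\sigma$ or $\mu$).
   Formalization: The measure σ is additionally assumed finite on compact subsets of (0,∞); for arbitrary measures the equivalence fails, e.g. σ = ∞·δ_1, μ = δ_(1,1), where (1) holds with constant 0 but the second testing condition fails for I = (1/2,3/2). *)

theory Defs
  imports "HOL-Analysis.Analysis"
begin

definition bessel_poisson_kernel :: "real \<Rightarrow> real \<Rightarrow> real \<Rightarrow> real \<Rightarrow> real" where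
  "bessel_poisson_kernel lam t x y =
     2 * lam * t / pi *
       (LINT \<theta>:{0..pi}|lborel.
          sin \<theta> powr (2 * lam - 1) / (x\<^sup>2 + y\<^sup>2 + t\<^sup>2 - 2 * x * y * cos \<theta>) powr (lam + 1))"

abbreviation pos_half_line :: "real set" where
  "pos_half_line \<equiv> {0<..}"

abbreviation pos_quadrant :: "(real \<times> real) set" where
  "pos_quadrant \<equiv> {0<..} \<times> {0<..}"

definition borel_measure_on :: "'a::topological_space set \<Rightarrow> 'a measure \<Rightarrow> bool" where
  "borel_measure_on S M \<longleftrightarrow> sets M = sets (restrict_space borel S)"

definition finite_on_compacts :: "'a::topological_space measure \<Rightarrow> bool" where
  "finite_on_compacts M \<longleftrightarrow> (\<forall>K. compact K \<and> K \<subseteq> space M \<longrightarrow> emeasure M K < \<infinity>)"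

definition L2 :: "'a measure \<Rightarrow> ('a \<Rightarrow> real) set" where
  "L2 M = {f. f \<in> borel_measurable M \<and> integrable M (\<lambda>x. (f x)\<^sup>2)}"

definition L2_norm :: "'a measure \<Rightarrow> ('a \<Rightarrow> real) \<Rightarrow> real" where
  "L2_norm M f = sqrt (LINT x|M. (f x)\<^sup>2)"

text \<open>The operator occurs in two forms. For signed functions it is a Bochner integral; since a
  divergent Bochner integral has the value 0, convergence is demanded separately below. For
  nonnegative functions, as in the testing conditions, it is an integral with values in
  \<open>[0, \<infinity>]\<close>, so that divergence counts as \<open>\<infinity>\<close>.\<close>

definition poisson_op ::
    "real \<Rightarrow> real measure \<Rightarrow> (real \<Rightarrow> real) \<Rightarrow> real \<times> real \<Rightarrow> real" where
  "poisson_op lam \<sigma> f = (\<lambda>(x, t). LINT y|\<sigma>. bessel_poisson_kernel lam t x y * f y)"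

definition nn_poisson_op ::
    "real \<Rightarrow> real measure \<Rightarrow> (real \<Rightarrow> ennreal) \<Rightarrow> real \<times> real \<Rightarrow> ennreal" where
  "nn_poisson_op lam \<sigma> f =
     (\<lambda>(x, t). \<integral>\<^sup>+ y. ennreal (bessel_poisson_kernel lam t x y) * f y \<partial>\<sigma>)"

definition nn_poisson_adj ::
    "real \<Rightarrow> (real \<times> real) measure \<Rightarrow> (real \<times> real \<Rightarrow> ennreal) \<Rightarrow> real \<Rightarrow> ennreal" where
  "nn_poisson_adj lam \<mu> g =
     (\<lambda>y. \<integral>\<^sup>+ (x, t). ennreal (bessel_poisson_kernel lam t x y) * g (x, t) \<partial>\<mu>)"

definition two_weight_ineq ::
    "real \<Rightarrow> real measure \<Rightarrow> (real \<times> real) measure \<Rightarrow> real \<Rightarrow> bool" where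
  "two_weight_ineq lam \<sigma> \<mu> N \<longleftrightarrow>
     (\<forall>f \<in> L2 \<sigma>.
        (AE (x, t) in \<mu>. integrable \<sigma> (\<lambda>y. bessel_poisson_kernel lam t x y * f y)) \<and>
        poisson_op lam \<sigma> f \<in> L2 \<mu> \<and>
        L2_norm \<mu> (poisson_op lam \<sigma> f) \<le> N * L2_norm \<sigma> f)"

definition pos_interval :: "real set \<Rightarrow> bool" where
  "pos_interval I \<longleftrightarrow> is_interval I \<and> bounded I \<and> I \<noteq> {} \<and> I \<subseteq> pos_half_line"

definition interval_length :: "real set \<Rightarrow> real" where
  "interval_length I = Sup I - Inf I"

definition interval_center :: "real set \<Rightarrow> real" where
  "interval_center I = (Inf I + Sup I) / 2"

definition triple :: "real set \<Rightarrow> real set" where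
  "triple I =
     {interval_center I - 3 * interval_length I / 2 <..<
      interval_center I + 3 * interval_length I / 2} \<inter> pos_half_line"

text \<open>The bottom edge \<open>t = 0\<close> lies outside the quadrant carrying \<open>\<mu>\<close> and does not
  contribute to integrals against \<open>\<mu>\<close>.\<close>

definition tent :: "real set \<Rightarrow> (real \<times> real) set" where
  "tent J = J \<times> {0..interval_length J}"

definition forward_testing ::
    "real \<Rightarrow> real measure \<Rightarrow> (real \<times> real) measure \<Rightarrow> real \<Rightarrow> bool" where
  "forward_testing lam \<sigma> \<mu> F \<longleftrightarrow>
     (\<forall>I. pos_interval I \<longrightarrow>
        (\<integral>\<^sup>+ p \<in> tent (triple I). (nn_poisson_op lam \<sigma> (indicator I) p)\<^sup>2 \<partial>\<mu>)
          \<le> ennreal (F\<^sup>2) * emeasure \<sigma> I)"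

definition backward_testing ::
    "real \<Rightarrow> real measure \<Rightarrow> (real \<times> real) measure \<Rightarrow> real \<Rightarrow> bool" where
  "backward_testing lam \<sigma> \<mu> B \<longleftrightarrow>
     (\<forall>I. pos_interval I \<longrightarrow>
        (\<integral>\<^sup>+ y \<in> triple I.
            (nn_poisson_adj lam \<mu> (\<lambda>(x, t). ennreal t * indicator (tent I) (x, t)) y)\<^sup>2 \<partial>\<sigma>)
          \<le> ennreal (B\<^sup>2) * (\<integral>\<^sup>+ p \<in> tent I. ennreal ((snd p)\<^sup>2) \<partial>\<mu>))"

text \<open>The value is \<open>\<infinity>\<close> if no finite constant is admissible.\<close>

definition best_constant :: "(real \<Rightarrow> bool) \<Rightarrow> ennreal" where
  "best_constant P = Inf (ennreal ` {K. 0 \<le> K \<and> P K})"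

end

theory Submission imports Defs begin

text \<open>Up to constants, the Poisson kernel divided by \<open>t\<close> equals
  \<open>1 / (((x - y)\<^sup>2 + t\<^sup>2) (x\<^sup>2 + y\<^sup>2 + t\<^sup>2) powr \<lambda>)\<close>, and this is comparable to a sum
  \<open>\<Sum>Q. w Q * 1\<^sub>Q(y) * 1\<^sub>T\<^sub>(\<^sub>Q\<^sub>)(x, t)\<close> over the intervals \<open>Q\<close> of two dyadic grids on the half line, one
  of them shifted by a third, where \<open>T(Q)\<close> is the tent over \<open>Q\<close>. With \<open>d\<nu> = t\<^sup>2 d\<mu>\<close> the two-weight
  inequality becomes the boundedness of the positive dyadic form
  \<open>\<Sum>Q. w Q * \<integral>\<^sub>Q f d\<sigma> * \<integral>\<^sub>T\<^sub>(\<^sub>Q\<^sub>) g d\<nu>\<close>, and the given testing conditions imply the usual testing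
  conditions for this form. It is then bounded by Treil's argument: split the intervals according to
  which of \<open>\<langle>f\<rangle>\<^sup>2 \<sigma>(Q)\<close> and \<open>\<langle>g\<rangle>\<^sup>2 \<nu>(T(Q))\<close> is larger, and run a stopping-time argument on the
  function with the larger one. Conversely, the testing conditions follow by testing on indicators
  and by duality.\<close>

section \<open>Positive dyadic forms\<close>

text \<open>Neither measure is assumed doubling, so all estimates must come from the tree structure
  of the cells. Within one class of intervals a single stopping family suffices: the averages of the
  dominated function are paid for by those of the other one. All dyadic sums run over finite
  truncations of the grids, with constants independent of the truncation. Sums of squared stopping
  averages are then finite a priori and can be absorbed into the left side, and monotone convergence
  removes the truncation at the end. Two obstacles come from the generality of the measures.
  \<open>\<sigma>\<close> is finite only on compact subsets of the open half line, whereas cells may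
  touch the origin, and \<open>\<mu>\<close> is arbitrary; the forward testing condition itself
  supplies the missing finiteness unless one of the measures vanishes. In the converse direction
  \<open>\<mu>\<close> need not be sigma-finite, so Fubini is applied to a finite measure, namely
  \<open>\<mu>\<close> weighted by \<open>t^2\<close> on one tent.\<close>

definition avg :: "'a measure \<Rightarrow> ('a \<Rightarrow> real) \<Rightarrow> 'a set \<Rightarrow> real" where
  "avg M f E = (\<integral>x. indicator E x * f x \<partial>M) / measure M E"

text \<open>An injection of \<open>Z\<close> into the exponents \<open>m - z\<close> turns the sum
  into part of a geometric series. It serves twice: for the stopping averages at a point and for the
  lengths of the cells around a point.\<close>

lemma sum_distinct_powers_of_two_le:
  fixes Z :: "int set" and m :: int
  assumes "finite Z" and "\<And>z. z \<in> Z \<Longrightarrow> z \<le> m"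
  shows "(\<Sum>z\<in>Z. (2::real) powr z) \<le> 2 * 2 powr m"
proof -
  have inj: "inj_on (\<lambda>z. nat (m - z)) Z"
    using assms(2) by (intro inj_onI) (metis diff_ge_0_iff_ge diff_left_imp_eq eq_nat_nat_iff)
  have "(\<Sum>z\<in>Z. (2::real) powr z) = (\<Sum>z\<in>Z. 2 powr m * (1/2) ^ nat (m - z))"
  proof (rule sum.cong[OF refl])
    fix z assume "z \<in> Z"
    then have "z \<le> m" using assms by auto
    then have "(1/2::real) ^ nat (m - z) = 2 powr (z - m)"
      by (simp add: powr_realpow[symmetric] power_one_over powr_minus_divide[symmetric] divide_simps powr_add[symmetric])
    then show "(2::real) powr z = 2 powr m * (1/2) ^ nat (m - z)"
      by (simp add: powr_add[symmetric])
  qed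
  also have "\<dots> = 2 powr m * (\<Sum>i\<in>(\<lambda>z. nat (m - z)) ` Z. (1/2) ^ i)"
    by (simp add: sum.reindex[OF inj] sum_distrib_left)
  also have "\<dots> \<le> 2 powr m * (\<Sum>i. (1/2) ^ i)"
    using assms(1) by (intro mult_left_mono sum_le_suminf) (auto intro: summable_geometric)
  also have "\<dots> = 2 * 2 powr m"
    by (simp add: suminf_geometric)
  finally show ?thesis .
qed

text \<open>One index order governs both families: in the application an index is a cell
  \<open>Q\<close>, with \<open>A Q\<close> the cell itself and \<open>B Q\<close> the box over it.
  The symmetric formulation lets \<open>swap\<close> yield the dual estimates without a second
  proof. That the elements above a common one form a chain is an axiom of its own
  (\<open>tree\<close>), because \<open>A q\<close> and \<open>B q\<close> may be empty and
  disjointness then says nothing.\<close>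

locale laminar_pair =
  fixes S :: "'a measure" and V :: "'b measure"
    and A :: "'i::order \<Rightarrow> 'a set" and B :: "'i \<Rightarrow> 'b set"
    and D :: "'i set" and w :: "'i \<Rightarrow> real"
  assumes fin: "finite D"
    and A_sets [measurable]: "\<And>q. q \<in> D \<Longrightarrow> A q \<in> sets S"
    and B_sets [measurable]: "\<And>q. q \<in> D \<Longrightarrow> B q \<in> sets V"
    and A_fin: "\<And>q. q \<in> D \<Longrightarrow> emeasure S (A q) < \<infinity>"
    and B_fin: "\<And>q. q \<in> D \<Longrightarrow> emeasure V (B q) < \<infinity>"
    and A_mono: "\<And>q r. q \<in> D \<Longrightarrow> r \<in> D \<Longrightarrow> q \<le> r \<Longrightarrow> A q \<subseteq> A r"
    and B_mono: "\<And>q r. q \<in> D \<Longrightarrow> r \<in> D \<Longrightarrow> q \<le> r \<Longrightarrow> B q \<subseteq> B r"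
    and A_disj: "\<And>q r. q \<in> D \<Longrightarrow> r \<in> D \<Longrightarrow> \<not> q \<le> r \<Longrightarrow> \<not> r \<le> q \<Longrightarrow> A q \<inter> A r = {}"
    and B_disj: "\<And>q r. q \<in> D \<Longrightarrow> r \<in> D \<Longrightarrow> \<not> q \<le> r \<Longrightarrow> \<not> r \<le> q \<Longrightarrow> B q \<inter> B r = {}"
    and tree: "\<And>q r s. q \<in> D \<Longrightarrow> r \<in> D \<Longrightarrow> s \<in> D \<Longrightarrow> q \<le> r \<Longrightarrow> q \<le> s \<Longrightarrow> r \<le> s \<or> s \<le> r"
    and w_nonneg: "\<And>q. q \<in> D \<Longrightarrow> 0 \<le> w q"
begin

lemma swap: "laminar_pair V S B A D w"
proof
  fix q r s assume "q \<in> D" "r \<in> D" "s \<in> D" "q \<le> r" "q \<le> s"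
  then show "r \<le> s \<or> s \<le> r" by (rule tree)
qed (simp_all add: fin A_sets B_sets A_fin B_fin A_mono B_mono A_disj B_disj w_nonneg
  del: infinity_ennreal_def)

lemma subfamily:
  assumes "D' \<subseteq> D"
  shows "laminar_pair S V A B D' w"
proof
  note sub = subsetD[OF assms]
  show "finite D'" using assms fin by (rule finite_subset)
  fix q r s assume "q \<in> D'" "r \<in> D'" "s \<in> D'" "q \<le> r" "q \<le> s"
  then show "r \<le> s \<or> s \<le> r" by (intro tree[of q r s] sub)
qed (simp_all add: subsetD[OF assms] A_sets B_sets A_fin B_fin A_mono B_mono A_disj B_disj w_nonneg
  del: infinity_ennreal_def)

section \<open>Records along chains: the principal (stopping) elements\<close>

definition records :: "('i \<Rightarrow> int) \<Rightarrow> 'i set" where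
  "records k = {q\<in>D. \<forall>r\<in>D. q < r \<longrightarrow> k r < k q}"

lemma finite_records: "finite (records k)"
  using fin by (simp add: records_def)

lemma records_subset: "records k \<subseteq> D"
  by (auto simp: records_def)

text \<open>Later \<open>k\<close> is the binary order of magnitude of an average, so a record has a
  larger order than everything above it. If \<open>q\<close> is no record, the induction passes to a
  minimal \<open>r\<close> above \<open>q\<close> with \<open>k q \<le> k r\<close>. No record fits
  between \<open>q\<close> and \<open>r\<close>: its value would exceed \<open>k r\<close>,
  contradicting minimality. Hence the least record above \<open>r\<close> is also the least one
  above \<open>q\<close>.\<close>

lemma least_record_above:
  assumes "q \<in> D"
  shows "\<exists>F\<in>records k. q \<le> F \<and> k q \<le> k F \<and> (\<forall>G\<in>records k. q \<le> G \<longrightarrow> F \<le> G)"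
  using assms
proof (induction "card {r\<in>D. q < r}" arbitrary: q rule: less_induct)
  case less
  show ?case
  proof (cases "q \<in> records k")
    case False
    let ?X = "{r\<in>D. q < r \<and> k q \<le> k r}"
    have "finite ?X" "?X \<noteq> {}"
      using False less.prems fin by (auto simp: records_def not_less)
    from finite_has_minimal[OF this] obtain r
      where r: "r \<in> ?X" and r_min: "\<forall>s\<in>?X. s \<le> r \<longrightarrow> r = s" by blast
    have "{s\<in>D. r < s} \<subset> {s\<in>D. q < s}"
      using r by (auto simp: psubset_eq)
    then have "card {s\<in>D. r < s} < card {s\<in>D. q < s}"
      using fin by (intro psubset_card_mono) auto
    from less.hyps[OF this] r obtain F where
      F: "F \<in> records k" "r \<le> F" "k r \<le> k F" "\<And>G. G \<in> records k \<Longrightarrow> r \<le> G \<Longrightarrow> F \<le> G"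
      by auto
    have "F \<le> G" if G: "G \<in> records k" "q \<le> G" for G
    proof (cases "r \<le> G")
      case False
      have "G \<in> D" using G records_subset by auto
      then have "G < r"
        using tree[of q r G] r G False less.prems by (auto simp: less_le)
      moreover have "q < G" using G \<open>q \<notin> records k\<close> by (auto simp: less_le)
      moreover have "k r < k G" using G(1) r \<open>G < r\<close> by (auto simp: records_def)
      ultimately have "G \<in> ?X" using r \<open>G \<in> D\<close> by auto
      then show ?thesis using r_min \<open>G < r\<close> by (auto simp: less_le)
    qed (use F G in auto)
    moreover have "q \<le> F" using r F(2) by auto
    moreover have "k q \<le> k F" using r F(3) by auto
    ultimately show ?thesis using F(1) by blast
  qed auto
qed

definition children :: "('i \<Rightarrow> int) \<Rightarrow> 'i \<Rightarrow> 'i set" where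
  "children k F = {G\<in>records k. G < F \<and> (\<forall>G'\<in>records k. G < G' \<longrightarrow> \<not> G' < F)}"

lemma child_above:
  assumes "q \<in> records k" "q < F"
  shows "\<exists>G\<in>children k F. q \<le> G"
proof -
  let ?X = "{G\<in>records k. q \<le> G \<and> G < F}"
  have "finite ?X" "q \<in> ?X" using assms finite_records by auto
  then obtain G where G: "G \<in> ?X" "\<forall>b\<in>?X. G \<le> b \<longrightarrow> G = b"
    using finite_has_maximal[of ?X] by blast
  then have "G \<in> children k F"
    unfolding children_def by auto
  then show ?thesis using G by auto
qed

lemma children_subset: "children k F \<subseteq> records k"
  by (auto simp: children_def)

lemma child_unique_parent:
  assumes "F \<in> records k" "F' \<in> records k" "G \<in> children k F" "G \<in> children k F'"
  shows "F = F'"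
proof (rule ccontr)
  assume "F \<noteq> F'"
  have "G \<in> D" "F \<in> D" "F' \<in> D" using assms records_subset children_subset by blast+
  moreover have "G \<le> F" "G \<le> F'" using assms by (auto simp: children_def)
  ultimately have "F < F' \<or> F' < F"
    using tree[of G F F'] \<open>F \<noteq> F'\<close> by (auto simp: less_le)
  then show False
    using assms unfolding children_def by blast
qed

lemma children_disjoint:
  assumes "G \<in> children k F" "G' \<in> children k F" "G \<noteq> G'"
  shows "B G \<inter> B G' = {}"
proof (rule B_disj)
  show "G \<in> D" "G' \<in> D" using assms records_subset children_subset by blast+
  show "\<not> G \<le> G'" "\<not> G' \<le> G" using assms by (auto simp: children_def less_le)
qed

text \<open>The part of \<open>B F\<close> where no later stopping occurs. These parts are pairwise
  disjoint over all records, which keeps the square integral of \<open>g\<close> from being counted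
  more than once.\<close>

definition exclusive_part :: "('i \<Rightarrow> int) \<Rightarrow> 'i \<Rightarrow> 'b set" where
  "exclusive_part k F = B F - (\<Union>G\<in>children k F. B G)"

lemma exclusive_part_disjoint:
  assumes "F \<in> records k" "F' \<in> records k" "F \<noteq> F'"
  shows "exclusive_part k F \<inter> exclusive_part k F' = {}"
proof -
  have *: "exclusive_part k F \<inter> exclusive_part k F' = {}"
    if h: "F \<in> records k" "F' \<in> records k" "F < F'" for F F'
  proof -
    obtain G where G: "G \<in> children k F'" "F \<le> G" using child_above[of F k F'] h by blast
    then have "B F \<subseteq> B G"
      using h records_subset children_subset by (intro B_mono) blast+
    then show ?thesis using G by (auto simp: exclusive_part_def)
  qed
  show ?thesis
  proof (cases "F \<le> F' \<or> F' \<le> F")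
    case True
    then have "F < F' \<or> F' < F" using assms(3) by auto
    then show ?thesis using *[of F F'] *[of F' F] assms by (metis Int_commute)
  next
    case False
    then have "B F \<inter> B F' = {}" using B_disj assms records_subset by blast
    then show ?thesis by (auto simp: exclusive_part_def)
  qed
qed

lemma indicator_partition:
  assumes "F \<in> records k" "p \<in> B F"
  shows "(1::real) = indicator (exclusive_part k F) p + (\<Sum>G\<in>children k F. indicator (B G) p)"
proof -
  have finc: "finite (children k F)"
    using finite_records children_subset by (rule finite_subset[rotated])
  show ?thesis
  proof (cases "p \<in> exclusive_part k F")
    case True
    then have "(\<Sum>G\<in>children k F. indicator (B G) p :: real) = 0"
      by (intro sum.neutral) (auto simp: exclusive_part_def indicator_def)
    then show ?thesis using True by simp
  next
    case False
    then obtain G0 where G0: "G0 \<in> children k F" "p \<in> B G0"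
      using assms by (auto simp: exclusive_part_def)
    have "(\<Sum>G\<in>children k F. indicator (B G) p :: real) = (\<Sum>G\<in>children k F. if G = G0 then 1 else 0)"
      using children_disjoint[of _ k F G0] G0 by (intro sum.cong) (fastforce simp: indicator_def)+
    also have "\<dots> = 1" using G0 finc by simp
    finally show ?thesis using False by simp
  qed
qed

end

section \<open>Averages and elementary integrability\<close>

lemma integrable_indicator_mult_square_integrable:
  fixes f :: "'a \<Rightarrow> real"
  assumes "E \<in> sets M" "emeasure M E < \<infinity>" "f \<in> borel_measurable M" "integrable M (\<lambda>x. (f x)\<^sup>2)"
  shows "integrable M (\<lambda>x. indicator E x * f x)"
proof (rule Bochner_Integration.integrable_bound)
  show "integrable M (\<lambda>x. indicator E x + (f x)\<^sup>2)"
    using assms by (intro Bochner_Integration.integrable_add integrable_real_indicator) auto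
  have "\<bar>f x\<bar> \<le> 1 + (f x)\<^sup>2" for x
    using zero_le_power2[of "\<bar>f x\<bar> - 1"] by (auto simp: power2_eq_square algebra_simps abs_if split: if_splits)
  then show "AE x in M. norm (indicator E x * f x) \<le> norm (indicator E x + (f x)\<^sup>2)"
    by (intro AE_I2) (auto simp: indicator_def)
qed (use assms in measurable)

lemma integral_add_sum:
  fixes u :: "'a \<Rightarrow> real"
  assumes "integrable M u" "\<And>i. i \<in> I \<Longrightarrow> integrable M (v i)"
  shows "(\<integral>x. u x + (\<Sum>i\<in>I. v i x) \<partial>M) = (\<integral>x. u x \<partial>M) + (\<Sum>i\<in>I. \<integral>x. v i x \<partial>M)"
  using assms
  by (simp add: Bochner_Integration.integral_add Bochner_Integration.integral_sum
      Bochner_Integration.integrable_sum)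

text \<open>On a null set the quotient in \<open>avg\<close> is 0 by the convention on division, and
  the integral vanishes as well, so the identity survives there. Finiteness rules out the other
  degenerate case, in which \<open>measure\<close> is 0 for a set of infinite mass.\<close>

lemma avg_mult_measure:
  assumes "E \<in> sets M" "emeasure M E < \<infinity>"
  shows "avg M f E * measure M E = (\<integral>x. indicator E x * f x \<partial>M)"
proof (cases "measure M E = 0")
  case True
  then have "emeasure M E = 0"
    using assms by (simp add: emeasure_eq_ennreal_measure)
  then have "AE x in M. x \<notin> E"
    using assms by (intro AE_not_in) (auto simp: null_sets_def)
  then have "(\<integral>x. indicator E x * f x \<partial>M) = 0"
    by (intro integral_eq_zero_AE) (auto simp: indicator_def)
  then show ?thesis using True by simp
qed (simp add: avg_def)

lemma avg_nonneg: "(\<And>x. 0 \<le> f x) \<Longrightarrow> 0 \<le> avg M f E"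
  by (simp add: avg_def)

section \<open>Carleson embedding and the bound for the form\<close>

context laminar_pair
begin

lemma integral_indicator_A: "q \<in> D \<Longrightarrow> (\<integral>x. indicator (A q) x * c \<partial>S) = measure S (A q) * (c::real)"
  using A_sets[of q] A_fin[of q] by (cases "c = 0") simp_all

lemma integral_indicator_B: "q \<in> D \<Longrightarrow> (\<integral>x. indicator (B q) x * c \<partial>V) = measure V (B q) * (c::real)"
  using B_sets[of q] B_fin[of q] by (cases "c = 0") simp_all

lemma integrable_indicator_A: "q \<in> D \<Longrightarrow> integrable S (\<lambda>x. indicator (A q) x * (c::real))"
  using A_sets[of q] A_fin[of q] by (intro integrable_mult_left) (auto intro: integrable_real_indicator)

lemma integrable_indicator_B: "q \<in> D \<Longrightarrow> integrable V (\<lambda>x. indicator (B q) x * (c::real))"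
  using B_sets[of q] B_fin[of q] by (intro integrable_mult_left) (auto intro: integrable_real_indicator)

lemma integrable_square_sum_indicator_B:
  fixes d :: "'i \<Rightarrow> real"
  assumes "X \<subseteq> D"
  shows "integrable V (\<lambda>p. (\<Sum>q\<in>X. d q * indicator (B q) p)\<^sup>2)"
proof -
  have "(\<lambda>p. (\<Sum>q\<in>X. d q * indicator (B q) p)\<^sup>2)
    = (\<lambda>p. \<Sum>q\<in>X. \<Sum>r\<in>X. d q * d r * (indicator (B r) p * (indicator (B q) p * 1)))"
    by (simp add: power2_eq_square sum_product mult_ac)
  moreover have "integrable V (\<lambda>p. indicator (B r) p * (indicator (B q) p * (1::real)))"
    if "q \<in> D" "r \<in> D" for q r
    using integrable_real_mult_indicator[OF B_sets[OF that(2)] integrable_indicator_B[OF that(1), of 1]]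
    by (simp add: mult_ac)
  ultimately show ?thesis
    using assms by (auto intro!: Bochner_Integration.integrable_sum integrable_mult_right)
qed

text \<open>Along a chain the values at the records grow geometrically, so at each point their sum
  is controlled by the largest of them; this replaces the maximal theorem.\<close>

lemma records_sum_pointwise:
  assumes k: "\<And>q. q \<in> D \<Longrightarrow> 2 powr k q \<le> a q \<and> a q \<le> 2 * 2 powr k q"
  shows "(\<Sum>F\<in>records k. indicator (A F) x * a F)\<^sup>2
          \<le> 16 * (\<Sum>F\<in>records k. indicator (A F) x * (a F)\<^sup>2 :: real)"
proof -
  define Z where "Z = {F\<in>records k. x \<in> A F}"
  have finZ: "finite Z" and ZD: "Z \<subseteq> D" and ZR: "Z \<subseteq> records k"
    using finite_records records_subset by (auto simp: Z_def)
  have eq: "(\<Sum>F\<in>records k. indicator (A F) x * h F) = (\<Sum>F\<in>Z. h F :: real)" for h :: "'i \<Rightarrow> real"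
    unfolding Z_def
    by (subst sum.inter_filter[OF finite_records], intro sum.cong) (auto simp: indicator_def)
  have a_nonneg: "0 \<le> a q" if "q \<in> D" for q
    using k[OF that] powr_ge_zero[of 2 "k q"] by linarith
  show ?thesis
  proof (cases "Z = {}")
    case False
    have inj: "inj_on k Z"
    proof (rule inj_onI, rule ccontr)
      fix F G assume *: "F \<in> Z" "G \<in> Z" "k F = k G" "F \<noteq> G"
      then have "F \<le> G \<or> G \<le> F" using A_disj[of F G] ZD by (auto simp: Z_def)
      then have "F < G \<or> G < F" using * by auto
      then show False using * by (auto simp: Z_def records_def)
    qed
    have "Max (k ` Z) \<in> k ` Z" using False finZ by (intro Max_in) auto
    then obtain F0 where F0: "F0 \<in> Z" "k F0 = Max (k ` Z)" by auto
    have "(\<Sum>F\<in>Z. a F) \<le> (\<Sum>F\<in>Z. 2 * 2 powr k F)"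
      using k ZD by (intro sum_mono) auto
    also have "\<dots> = 2 * (\<Sum>z\<in>k ` Z. 2 powr z)"
      by (simp add: sum.reindex[OF inj] sum_distrib_left)
    also have "\<dots> \<le> 2 * (2 * 2 powr k F0)"
      using finZ F0 by (intro mult_left_mono sum_distinct_powers_of_two_le) auto
    also have "\<dots> \<le> 4 * a F0" using k[of F0] F0 ZD by auto
    finally have "(\<Sum>F\<in>Z. a F)\<^sup>2 \<le> (4 * a F0)\<^sup>2"
      using a_nonneg ZD by (intro power_mono sum_nonneg) auto
    also have "\<dots> \<le> 16 * (\<Sum>F\<in>Z. (a F)\<^sup>2)"
      using member_le_sum[OF F0(1), of "\<lambda>F. (a F)\<^sup>2"] finZ by (simp add: power_mult_distrib)
    finally show ?thesis unfolding eq .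
  qed (unfold eq, simp)
qed

text \<open>Carleson embedding for the principal elements. The left side \<open>T\<close> is the
  integral of \<open>?phi * f\<close>. Young's inequality and the pointwise bound for
  \<open>?phi\<close> estimate it by 8 times the square integral of \<open>f\<close> plus
  \<open>T / 2\<close>, and since \<open>T\<close> is finite, half of it can be absorbed.\<close>

lemma records_square_sum_le:
  assumes f [measurable]: "f \<in> borel_measurable S" and f0: "\<And>x. 0 \<le> f x"
    and f2: "integrable S (\<lambda>x. (f x)\<^sup>2)"
    and k: "\<And>q. q \<in> D \<Longrightarrow> 2 powr k q \<le> avg S f (A q) \<and> avg S f (A q) \<le> 2 * 2 powr k q"
  shows "(\<Sum>F\<in>records k. (avg S f (A F))\<^sup>2 * measure S (A F)) \<le> 16 * (\<integral>x. (f x)\<^sup>2 \<partial>S)"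
proof -
  define a where "a F = avg S f (A F)" for F
  define T where "T = (\<Sum>F\<in>records k. (a F)\<^sup>2 * measure S (A F))"
  let ?phi = "\<lambda>x. \<Sum>F\<in>records k. indicator (A F) x * a F"
  let ?psi = "\<lambda>x. \<Sum>F\<in>records k. indicator (A F) x * (a F)\<^sup>2"
  note RD = subsetD[OF records_subset]
  have int1: "integrable S (\<lambda>x. indicator (A F) x * f x)" if "F \<in> records k" for F
    using A_sets A_fin RD that f f2 by (intro integrable_indicator_mult_square_integrable) auto
  have "T = (\<Sum>F\<in>records k. \<integral>x. a F * (indicator (A F) x * f x) \<partial>S)"
    unfolding T_def a_def
    by (intro sum.cong refl) (simp add: power2_eq_square avg_mult_measure[OF A_sets A_fin] RD mult.assoc del: infinity_ennreal_def)
  also have "\<dots> = (\<integral>x. (\<Sum>F\<in>records k. a F * (indicator (A F) x * f x)) \<partial>S)"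
    by (subst Bochner_Integration.integral_sum) (auto intro: int1)
  also have "\<dots> \<le> (\<integral>x. 8 * (f x)\<^sup>2 + ?psi x / 2 \<partial>S)"
  proof (rule integral_mono)
    show "integrable S (\<lambda>x. \<Sum>F\<in>records k. a F * (indicator (A F) x * f x))"
      by (intro Bochner_Integration.integrable_sum integrable_mult_right int1)
    show "integrable S (\<lambda>x. 8 * (f x)\<^sup>2 + ?psi x / 2)"
      using f2 integrable_indicator_A[OF RD]
      by (intro Bochner_Integration.integrable_add integrable_mult_right integrable_divide Bochner_Integration.integrable_sum) auto
    fix x
    have "(\<Sum>F\<in>records k. a F * (indicator (A F) x * f x)) = ?phi x * f x"
      by (simp add: sum_distrib_left mult_ac)
    \<comment> \<open>The weights 8 and 1/32 are chosen so that the factor 16 of the pointwise bound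
      becomes 1/2.\<close>
    also have "\<dots> \<le> 8 * (f x)\<^sup>2 + (?phi x)\<^sup>2 / 32"
      using zero_le_power2[of "16 * f x - ?phi x"] by (simp add: power2_eq_square algebra_simps)
    also have "(?phi x)\<^sup>2 \<le> 16 * ?psi x"
      using k unfolding a_def by (rule records_sum_pointwise)
    finally show "(\<Sum>F\<in>records k. a F * (indicator (A F) x * f x)) \<le> 8 * (f x)\<^sup>2 + ?psi x / 2"
      by simp
  qed
  also have "\<dots> = 8 * (\<integral>x. (f x)\<^sup>2 \<partial>S) + (\<integral>x. ?psi x \<partial>S) / 2"
    using f2 integrable_indicator_A[OF RD]
    by (subst Bochner_Integration.integral_add) (auto intro!: Bochner_Integration.integrable_sum)
  also have "(\<integral>x. ?psi x \<partial>S) = T"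
  proof -
    have "(\<integral>x. ?psi x \<partial>S) = (\<Sum>F\<in>records k. \<integral>x. indicator (A F) x * (a F)\<^sup>2 \<partial>S)"
      by (rule Bochner_Integration.integral_sum[OF integrable_indicator_A[OF RD]])
    also have "\<dots> = T"
      unfolding T_def by (intro sum.cong refl) (simp only: integral_indicator_A[OF RD] mult.commute)
    finally show ?thesis .
  qed
  finally show ?thesis by (simp add: T_def a_def)
qed


lemma finite_children: "finite (children k F)"
  using finite_records children_subset by (rule finite_subset[rotated])

lemma exclusive_part_sets [measurable]: "F \<in> records k \<Longrightarrow> exclusive_part k F \<in> sets V"
  unfolding exclusive_part_def
  using records_subset children_subset finite_children
  by (intro sets.Diff sets.finite_UN B_sets) blast+

text \<open>Treil's argument: on the children of a principal element \<open>F\<close> the operator localised at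
  \<open>F\<close> is constant, so \<open>g\<close> may be replaced there by its averages, and these are dominated by the
  averages of \<open>f\<close>.\<close>

lemma form_bound_on_dominated_class:
  assumes f [measurable]: "f \<in> borel_measurable S" and f0: "\<And>x. 0 \<le> f x"
    and f2: "integrable S (\<lambda>x. (f x)\<^sup>2)"
    and g [measurable]: "g \<in> borel_measurable V" and g0: "\<And>p. 0 \<le> g p"
    and g2: "integrable V (\<lambda>p. (g p)\<^sup>2)"
    and H: "0 < H"
    and testing: "\<And>F. F \<in> D \<Longrightarrow>
      (\<integral>p. (\<Sum>q\<in>{q\<in>D. q \<le> F}. w q * measure S (A q) * indicator (B q) p)\<^sup>2 \<partial>V)
        \<le> H\<^sup>2 * measure S (A F)"
    and pos: "\<And>q. q \<in> D \<Longrightarrow> 0 < avg S f (A q)"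
    and dom: "\<And>q. q \<in> D \<Longrightarrow>
      (avg V g (B q))\<^sup>2 * measure V (B q) \<le> (avg S f (A q))\<^sup>2 * measure S (A q)"
  shows "(\<Sum>q\<in>D. w q * (\<integral>x. indicator (A q) x * f x \<partial>S) * (\<integral>p. indicator (B q) p * g p \<partial>V))
          \<le> H * (32 * (\<integral>x. (f x)\<^sup>2 \<partial>S) + (\<integral>p. (g p)\<^sup>2 \<partial>V))"
proof -
  define a where "a q = avg S f (A q)" for q
  define b where "b q = avg V g (B q)" for q
  define s where "s q = measure S (A q)" for q
  define k where "k q = \<lfloor>log 2 (a q)\<rfloor>" for q
  define c where "c q = 2 powr k q" for q
  define y where "y q = (\<integral>p. indicator (B q) p * g p \<partial>V)" for q
  let ?R = "records k"
  let ?E = "exclusive_part k"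
  let ?ch = "children k"
  note RD = subsetD[OF records_subset]
  have chR: "G \<in> ?R" if "G \<in> ?ch F" for G F using that children_subset by blast
  have ka: "2 powr k q \<le> a q \<and> a q \<le> 2 * 2 powr k q" if "q \<in> D" for q
  proof -
    have eq: "a q = 2 powr (log 2 (a q))" using pos[OF that] by (simp add: a_def)
    have "2 powr k q \<le> 2 powr (log 2 (a q))"
      unfolding k_def by (intro powr_mono) auto
    moreover have "2 powr (log 2 (a q)) \<le> 2 powr (k q + 1)"
      unfolding k_def by (intro powr_mono) linarith+
    ultimately show ?thesis using eq by (simp add: powr_add)
  qed
  \<comment> \<open>Here \<open>pi\<close> is the map sending \<open>q\<close> to the least record
    above it, not the number.\<close>
  obtain pi where pi: "\<And>q. q \<in> D \<Longrightarrow> pi q \<in> ?R" "\<And>q. q \<in> D \<Longrightarrow> q \<le> pi q"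
    "\<And>q. q \<in> D \<Longrightarrow> k q \<le> k (pi q)" "\<And>q G. q \<in> D \<Longrightarrow> G \<in> ?R \<Longrightarrow> q \<le> G \<Longrightarrow> pi q \<le> G"
    using bchoice[of D "\<lambda>q F. F \<in> ?R \<and> q \<le> F \<and> k q \<le> k F \<and> (\<forall>G\<in>?R. q \<le> G \<longrightarrow> F \<le> G)"]
      least_record_above[of _ k] by blast
  \<comment> \<open>The square of \<open>h F\<close> involves \<open>g\<close> itself only on the
    exclusive part; on the children it involves averages, which \<open>dom\<close> bounds by those
    of \<open>f\<close>. \<open>tau F\<close> gathers those terms of the operator localised at
    \<open>F\<close> whose least record is \<open>F\<close>.\<close>
  define h where "h F p = indicator (?E F) p * g p + (\<Sum>G\<in>?ch F. indicator (B G) p * b G)" for F p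
  define tau where "tau F p = (\<Sum>q\<in>{q\<in>D. pi q = F}. w q * s q * indicator (B q) p)" for F p
  have Bg_int: "integrable V (\<lambda>p. indicator (B q) p * g p)" if "q \<in> D" for q
    using that B_sets B_fin g g2 by (intro integrable_indicator_mult_square_integrable) auto
  have bnu: "b q * measure V (B q) = y q" if "q \<in> D" for q
    unfolding b_def y_def using that B_sets B_fin by (intro avg_mult_measure) auto
  have asig: "a q * s q = (\<integral>x. indicator (A q) x * f x \<partial>S)" if "q \<in> D" for q
    unfolding a_def s_def using that A_sets A_fin by (intro avg_mult_measure) auto
  have y0: "0 \<le> y q" for q unfolding y_def using g0 by simp
  have s0: "0 \<le> s q" for q unfolding s_def by simp
  have c0: "0 \<le> c q" for q unfolding c_def by simp

  have h_sq: "(h F p)\<^sup>2 = indicator (?E F) p * (g p)\<^sup>2 + (\<Sum>G\<in>?ch F. indicator (B G) p * (b G)\<^sup>2)"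
    if "F \<in> ?R" for F p
  proof (cases "\<exists>G0\<in>?ch F. p \<in> B G0")
    case True
    then obtain G0 where G0: "G0 \<in> ?ch F" "p \<in> B G0" by blast
    have *: "(\<Sum>G\<in>?ch F. indicator (B G) p * d G) = d G0" for d :: "'i \<Rightarrow> real"
    proof -
      have "(\<Sum>G\<in>?ch F. indicator (B G) p * d G) = (\<Sum>G\<in>?ch F. if G = G0 then d G else 0)"
        using children_disjoint[of _ k F G0] G0 by (intro sum.cong) (fastforce simp: indicator_def)+
      then show ?thesis using G0 finite_children by simp
    qed
    have "p \<notin> ?E F" using G0 by (auto simp: exclusive_part_def)
    then show ?thesis unfolding h_def * by simp
  next
    case False
    then have *: "(\<Sum>G\<in>?ch F. indicator (B G) p * d G) = 0" for d :: "'i \<Rightarrow> real"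
      by (intro sum.neutral) (auto simp: indicator_def)
    show ?thesis unfolding h_def * by (simp add: indicator_def)
  qed
  have h_meas [measurable]: "h F \<in> borel_measurable V" if "F \<in> ?R" for F
    unfolding h_def using that RD chR
    by (intro borel_measurable_add borel_measurable_times borel_measurable_sum borel_measurable_indicator) auto
  have Eg_int: "integrable V (\<lambda>p. indicator (?E F) p * (g p)\<^sup>2)" if "F \<in> ?R" for F
    using g2 that by (intro integrable_real_mult_indicator[where 'a='b, simplified mult.commute[of _ "indicator _ _"]]) auto
  have chB_int: "integrable V (\<lambda>p. \<Sum>G\<in>?ch F. indicator (B G) p * d G)" for F and d :: "'i \<Rightarrow> real"
    using RD chR by (intro Bochner_Integration.integrable_sum integrable_indicator_B) auto
  have h2_int: "integrable V (\<lambda>p. (h F p)\<^sup>2)" if "F \<in> ?R" for F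
    unfolding h_sq[OF that] using that by (intro Bochner_Integration.integrable_add Eg_int chB_int)
  have Bh_int: "integrable V (\<lambda>p. indicator (B q) p * h F p)" if "q \<in> D" "F \<in> ?R" for q F
    using that B_sets B_fin h_meas h2_int by (intro integrable_indicator_mult_square_integrable) auto

  have y_eq: "y q = (\<integral>p. indicator (B q) p * h (pi q) p \<partial>V)" if q: "q \<in> D" for q
  proof -
    let ?F = "pi q"
    have FR: "?F \<in> ?R" using pi q by auto
    have BE_int: "integrable V (\<lambda>p. indicator (B q) p * (indicator (?E ?F) p * g p))"
      using integrable_real_mult_indicator[OF exclusive_part_sets[OF FR] Bg_int[OF q]]
      by (simp add: mult_ac)
    have BG_int: "integrable V (\<lambda>p. indicator (B q) p * (indicator (B G) p * g p))" if "G \<in> D" for G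
      using integrable_real_mult_indicator[OF B_sets[OF that] Bg_int[OF q]]
      by (simp add: mult_ac)
    have Bb_int: "integrable V (\<lambda>p. indicator (B q) p * (indicator (B G) p * b G))" if "G \<in> D" for G
      using integrable_real_mult_indicator[OF B_sets[OF that] integrable_indicator_B[OF q, of "b G"]]
      by (simp add: mult_ac)
    have swap_avg: "(\<integral>p. indicator (B q) p * (indicator (B G) p * g p) \<partial>V)
        = (\<integral>p. indicator (B q) p * (indicator (B G) p * b G) \<partial>V)" if G: "G \<in> ?ch ?F" for G
    proof -
      have GD: "G \<in> D" using G chR RD by blast
      \<comment> \<open>If \<open>q\<close> were below the child \<open>G\<close>, then
        \<open>G\<close> would be a record above \<open>q\<close> and strictly below the least one.
        So \<open>B G\<close> lies inside \<open>B q\<close> or misses it, and replacing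
        \<open>g\<close> by its average on \<open>B G\<close> leaves the integral over
        \<open>B q\<close> unchanged.\<close>
      have "\<not> q \<le> G" using pi(4)[OF q chR[OF G]] G by (auto simp: children_def)
      then consider "B G \<subseteq> B q" | "B q \<inter> B G = {}"
        using B_mono[of G q] B_disj[of q G] q GD by blast
      then show ?thesis
      proof cases
        case 1
        then have *: "indicator (B q) p * (indicator (B G) p * d) = indicator (B G) p * d" for p and d :: real
          by (auto simp: indicator_def)
        show ?thesis unfolding * using bnu[OF GD] integral_indicator_B[OF GD, of "b G"]
          by (simp add: y_def mult.commute)
      next
        case 2
        then have *: "indicator (B q) p * (indicator (B G) p * d) = 0" for p and d :: real
          by (auto simp: indicator_def)
        show ?thesis unfolding * by simp
      qed
    qed
    have "indicator (B q) p * g p = indicator (B q) p * (indicator (?E ?F) p * g p)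
        + (\<Sum>G\<in>?ch ?F. indicator (B q) p * (indicator (B G) p * g p))" for p
    proof (cases "p \<in> B q")
      case True
      then have "p \<in> B ?F" using B_mono[of q ?F] pi q RD by blast
      from indicator_partition[OF FR this]
      have "g p = (indicator (?E ?F) p + (\<Sum>G\<in>?ch ?F. indicator (B G) p)) * g p" by simp
      then show ?thesis using True by (simp add: algebra_simps sum_distrib_left)
    qed simp
    then have "y q = (\<integral>p. indicator (B q) p * (indicator (?E ?F) p * g p) \<partial>V)
        + (\<Sum>G\<in>?ch ?F. \<integral>p. indicator (B q) p * (indicator (B G) p * g p) \<partial>V)"
      unfolding y_def using integral_add_sum[OF BE_int, of "?ch ?F"] BG_int[OF RD[OF chR]] by simp
    also have "\<dots> = (\<integral>p. indicator (B q) p * (indicator (?E ?F) p * g p) \<partial>V)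
        + (\<Sum>G\<in>?ch ?F. \<integral>p. indicator (B q) p * (indicator (B G) p * b G) \<partial>V)"
      using swap_avg by simp
    also have "\<dots> = (\<integral>p. indicator (B q) p * (indicator (?E ?F) p * g p)
        + (\<Sum>G\<in>?ch ?F. indicator (B q) p * (indicator (B G) p * b G)) \<partial>V)"
      by (rule integral_add_sum[OF BE_int Bb_int[OF RD[OF chR]], symmetric])
    finally show ?thesis unfolding h_def by (simp add: algebra_simps sum_distrib_left)
  qed

  have tau_F: "2 * c F * (\<Sum>q\<in>{q\<in>D. pi q = F}. w q * s q * y q)
      \<le> H * (c F)\<^sup>2 * s F + H * (\<integral>p. (h F p)\<^sup>2 \<partial>V)" if F: "F \<in> ?R" for F
  proof -
    have tau_le: "0 \<le> tau F p \<and> tau F p \<le> (\<Sum>q\<in>{q\<in>D. q \<le> F}. w q * s q * indicator (B q) p)" for p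
      unfolding tau_def using pi fin w_nonneg s0
      by (intro conjI sum_nonneg sum_mono2) auto
    have t2: "(\<integral>p. (tau F p)\<^sup>2 \<partial>V) \<le> H\<^sup>2 * s F"
    proof -
      have "(\<integral>p. (tau F p)\<^sup>2 \<partial>V) \<le> (\<integral>p. (\<Sum>q\<in>{q\<in>D. q \<le> F}. w q * s q * indicator (B q) p)\<^sup>2 \<partial>V)"
        unfolding tau_def using tau_le[unfolded tau_def]
        by (intro integral_mono integrable_square_sum_indicator_B power_mono) auto
      also have "\<dots> \<le> H\<^sup>2 * s F" unfolding s_def using F RD by (intro testing) auto
      finally show ?thesis .
    qed
    have t2_int: "integrable V (\<lambda>p. (tau F p)\<^sup>2)" unfolding tau_def by (intro integrable_square_sum_indicator_B) auto
    have th: "(\<lambda>p. 2 * c F * (tau F p * h F p))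
        = (\<lambda>p. \<Sum>q\<in>{q\<in>D. pi q = F}. (2 * c F * w q * s q) * (indicator (B q) p * h F p))"
      unfolding tau_def by (simp add: sum_distrib_left sum_distrib_right mult_ac)
    have "2 * c F * (\<Sum>q\<in>{q\<in>D. pi q = F}. w q * s q * y q)
        = (\<Sum>q\<in>{q\<in>D. pi q = F}. (2 * c F * w q * s q) * (\<integral>p. indicator (B q) p * h F p \<partial>V))"
      using y_eq by (simp add: sum_distrib_left mult_ac)
    also have "\<dots> = (\<integral>p. 2 * c F * (tau F p * h F p) \<partial>V)"
      unfolding th using Bh_int F by (subst Bochner_Integration.integral_sum) auto
    \<comment> \<open>Young's inequality with parameter \<open>H\<close>: the testing bound for
      \<open>tau F\<close> carries the factor \<open>H^2\<close>, so that both resulting terms scale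
      like \<open>H\<close>.\<close>
    also have "\<dots> \<le> (\<integral>p. (c F)\<^sup>2 / H * (tau F p)\<^sup>2 + H * (h F p)\<^sup>2 \<partial>V)"
    proof (rule integral_mono)
      show "integrable V (\<lambda>p. 2 * c F * (tau F p * h F p))"
        unfolding th using Bh_int F
        by (intro Bochner_Integration.integrable_sum integrable_mult_right) auto
      show "integrable V (\<lambda>p. (c F)\<^sup>2 / H * (tau F p)\<^sup>2 + H * (h F p)\<^sup>2)"
        using t2_int h2_int F
        by (intro Bochner_Integration.integrable_add integrable_mult_right) auto
      fix p
      have "0 \<le> (c F * tau F p - H * h F p)\<^sup>2 / H" using H by simp
      also have "\<dots> = (c F)\<^sup>2 / H * (tau F p)\<^sup>2 + H * (h F p)\<^sup>2 - 2 * c F * (tau F p * h F p)"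
        using H by (simp add: power2_eq_square field_simps)
      finally show "2 * c F * (tau F p * h F p) \<le> (c F)\<^sup>2 / H * (tau F p)\<^sup>2 + H * (h F p)\<^sup>2" by simp
    qed
    also have "\<dots> = (c F)\<^sup>2 / H * (\<integral>p. (tau F p)\<^sup>2 \<partial>V) + H * (\<integral>p. (h F p)\<^sup>2 \<partial>V)"
      using t2_int h2_int F by (subst Bochner_Integration.integral_add) auto
    also have "(c F)\<^sup>2 / H * (\<integral>p. (tau F p)\<^sup>2 \<partial>V) \<le> (c F)\<^sup>2 / H * (H\<^sup>2 * s F)"
      using t2 H by (intro mult_left_mono) auto
    also have "\<dots> = H * (c F)\<^sup>2 * s F" using H by (simp add: power2_eq_square)
    finally show ?thesis by simp
  qed

  define T where "T = (\<Sum>F\<in>?R. (a F)\<^sup>2 * s F)"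
  have T: "T \<le> 16 * (\<integral>x. (f x)\<^sup>2 \<partial>S)"
    unfolding T_def a_def s_def using ka unfolding a_def
    by (intro records_square_sum_le f f0 f2)
  have c_sum: "(\<Sum>F\<in>?R. (c F)\<^sup>2 * s F) \<le> T"
    unfolding T_def using ka RD c0 s0
    by (intro sum_mono mult_right_mono power_mono) (auto simp: c_def)
  have E_sum: "(\<Sum>F\<in>?R. \<integral>p. indicator (?E F) p * (g p)\<^sup>2 \<partial>V) \<le> (\<integral>p. (g p)\<^sup>2 \<partial>V)"
  proof -
    have le1: "(\<Sum>F\<in>?R. indicator (?E F) p) \<le> (1::real)" for p
    proof (cases "\<exists>F0\<in>?R. p \<in> ?E F0")
      case True
      then obtain F0 where F0: "F0 \<in> ?R" "p \<in> ?E F0" by blast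
      have "(\<Sum>F\<in>?R. indicator (?E F) p) = (\<Sum>F\<in>?R. if F = F0 then 1 else (0::real))"
        using exclusive_part_disjoint[of _ k F0] F0 by (intro sum.cong) (fastforce simp: indicator_def)+
      then show ?thesis using F0 finite_records by simp
    next
      case False
      then have "(\<Sum>F\<in>?R. indicator (?E F) p) = (0::real)" by (intro sum.neutral) auto
      then show ?thesis by simp
    qed
    have "(\<Sum>F\<in>?R. \<integral>p. indicator (?E F) p * (g p)\<^sup>2 \<partial>V) = (\<integral>p. (\<Sum>F\<in>?R. indicator (?E F) p * (g p)\<^sup>2) \<partial>V)"
      using Eg_int by (subst Bochner_Integration.integral_sum) auto
    also have "\<dots> \<le> (\<integral>p. (g p)\<^sup>2 \<partial>V)"
      using Eg_int g2 mult_right_mono[OF le1]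
      by (intro integral_mono Bochner_Integration.integrable_sum) (auto simp: sum_distrib_right)
    finally show ?thesis .
  qed
  \<comment> \<open>Every record is a child of at most one record, so the double sum runs over
    distinct records; \<open>dom\<close> then replaces the averages of \<open>g\<close> by those of
    \<open>f\<close>.\<close>
  have ch_sum: "(\<Sum>F\<in>?R. \<Sum>G\<in>?ch F. measure V (B G) * (b G)\<^sup>2) \<le> T"
  proof -
    have "(\<Sum>F\<in>?R. \<Sum>G\<in>?ch F. measure V (B G) * (b G)\<^sup>2) = (\<Sum>G\<in>(\<Union>F\<in>?R. ?ch F). measure V (B G) * (b G)\<^sup>2)"
    proof (rule sum.UNION_disjoint[symmetric])
      show "\<forall>F\<in>?R. \<forall>F'\<in>?R. F \<noteq> F' \<longrightarrow> ?ch F \<inter> ?ch F' = {}"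
        using child_unique_parent by blast
    qed (auto intro: finite_records finite_children)
    also have "\<dots> \<le> (\<Sum>G\<in>?R. measure V (B G) * (b G)\<^sup>2)"
      using finite_records chR by (intro sum_mono2) auto
    also have "\<dots> \<le> T" unfolding T_def
      using dom RD by (intro sum_mono) (auto simp: a_def b_def s_def mult.commute)
    finally show ?thesis .
  qed
  have h_sum: "(\<Sum>F\<in>?R. \<integral>p. (h F p)\<^sup>2 \<partial>V) \<le> (\<integral>p. (g p)\<^sup>2 \<partial>V) + T"
  proof -
    have "(\<integral>p. (h F p)\<^sup>2 \<partial>V) = (\<integral>p. indicator (?E F) p * (g p)\<^sup>2 \<partial>V)
        + (\<Sum>G\<in>?ch F. measure V (B G) * (b G)\<^sup>2)" if "F \<in> ?R" for F
    proof -
      have "(\<integral>p. (h F p)\<^sup>2 \<partial>V) = (\<integral>p. indicator (?E F) p * (g p)\<^sup>2 \<partial>V)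
          + (\<Sum>G\<in>?ch F. \<integral>p. indicator (B G) p * (b G)\<^sup>2 \<partial>V)"
        unfolding h_sq[OF that]
        by (rule integral_add_sum[OF Eg_int[OF that] integrable_indicator_B[OF RD[OF chR]]])
      also have "(\<Sum>G\<in>?ch F. \<integral>p. indicator (B G) p * (b G)\<^sup>2 \<partial>V)
          = (\<Sum>G\<in>?ch F. measure V (B G) * (b G)\<^sup>2)"
        by (intro sum.cong refl) (rule integral_indicator_B[OF RD[OF chR]])
      finally show ?thesis .
    qed
    then have "(\<Sum>F\<in>?R. \<integral>p. (h F p)\<^sup>2 \<partial>V) = (\<Sum>F\<in>?R. \<integral>p. indicator (?E F) p * (g p)\<^sup>2 \<partial>V)
        + (\<Sum>F\<in>?R. \<Sum>G\<in>?ch F. measure V (B G) * (b G)\<^sup>2)"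
      by (simp add: sum.distrib)
    then show ?thesis using E_sum ch_sum by linarith
  qed

  have "(\<Sum>q\<in>D. w q * (\<integral>x. indicator (A q) x * f x \<partial>S) * (\<integral>p. indicator (B q) p * g p \<partial>V))
      = (\<Sum>q\<in>D. w q * (a q * s q) * y q)"
    using asig by (intro sum.cong) (auto simp: y_def)
  also have "\<dots> \<le> (\<Sum>q\<in>D. w q * (2 * c (pi q) * s q) * y q)"
  proof (intro sum_mono mult_right_mono mult_left_mono y0 w_nonneg s0)
    fix q assume q: "q \<in> D"
    have "2 powr k q \<le> (2::real) powr k (pi q)" using pi(3)[OF q] by (intro powr_mono) auto
    then show "a q \<le> 2 * c (pi q)" using ka[OF q] unfolding c_def by linarith
  qed
  also have "\<dots> = (\<Sum>F\<in>?R. \<Sum>q\<in>{q\<in>D. pi q = F}. w q * (2 * c (pi q) * s q) * y q)"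
    using pi fin finite_records by (intro sum.group[symmetric]) auto
  also have "\<dots> = (\<Sum>F\<in>?R. 2 * c F * (\<Sum>q\<in>{q\<in>D. pi q = F}. w q * s q * y q))"
    by (intro sum.cong refl) (simp add: sum_distrib_left mult_ac)
  also have "\<dots> \<le> (\<Sum>F\<in>?R. H * (c F)\<^sup>2 * s F + H * (\<integral>p. (h F p)\<^sup>2 \<partial>V))"
    by (intro sum_mono tau_F)
  also have "\<dots> = H * ((\<Sum>F\<in>?R. (c F)\<^sup>2 * s F) + (\<Sum>F\<in>?R. \<integral>p. (h F p)\<^sup>2 \<partial>V))"
    by (simp add: sum.distrib sum_distrib_left distrib_left mult_ac)
  \<comment> \<open>The sum of the \<open>c F\<close> and the sum over the children cost one
    \<open>T\<close> each, and \<open>T\<close> carries the constant 16.\<close>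
  also have "\<dots> \<le> H * (32 * (\<integral>x. (f x)\<^sup>2 \<partial>S) + (\<integral>p. (g p)\<^sup>2 \<partial>V))"
    using c_sum h_sum T H by (intro mult_left_mono) auto
  finally show ?thesis .
qed


text \<open>Each of the two classes is again a laminar family. As the weights are nonnegative,
  passing to a subfamily only lowers the localised operators, so both testing conditions are
  inherited. The second class is handled with the roles of the two families interchanged.\<close>

lemma form_bound:
  assumes f [measurable]: "f \<in> borel_measurable S" and f0: "\<And>x. 0 \<le> f x"
    and f2: "integrable S (\<lambda>x. (f x)\<^sup>2)"
    and g [measurable]: "g \<in> borel_measurable V" and g0: "\<And>p. 0 \<le> g p"
    and g2: "integrable V (\<lambda>p. (g p)\<^sup>2)"
    and F: "0 < F" and K: "0 < K"
    and forward: "\<And>r. r \<in> D \<Longrightarrow>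
      (\<integral>p. (\<Sum>q\<in>{q\<in>D. q \<le> r}. w q * measure S (A q) * indicator (B q) p)\<^sup>2 \<partial>V)
        \<le> F\<^sup>2 * measure S (A r)"
    and backward: "\<And>r. r \<in> D \<Longrightarrow>
      (\<integral>x. (\<Sum>q\<in>{q\<in>D. q \<le> r}. w q * measure V (B q) * indicator (A q) x)\<^sup>2 \<partial>S)
        \<le> K\<^sup>2 * measure V (B r)"
  shows "(\<Sum>q\<in>D. w q * (\<integral>x. indicator (A q) x * f x \<partial>S) * (\<integral>p. indicator (B q) p * g p \<partial>V))
          \<le> 32 * (F + K) * ((\<integral>x. (f x)\<^sup>2 \<partial>S) + (\<integral>p. (g p)\<^sup>2 \<partial>V))"
proof -
  interpret sw: laminar_pair V S B A D w by (rule swap)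
  define a where "a q = avg S f (A q)" for q
  define b where "b q = avg V g (B q)" for q
  define t where "t q = w q * (\<integral>x. indicator (A q) x * f x \<partial>S) * (\<integral>p. indicator (B q) p * g p \<partial>V)" for q
  define D1 where "D1 = {q\<in>D. 0 < a q \<and> (b q)\<^sup>2 * measure V (B q) \<le> (a q)\<^sup>2 * measure S (A q)}"
  define D2 where "D2 = {q\<in>D. 0 < b q \<and> (a q)\<^sup>2 * measure S (A q) < (b q)\<^sup>2 * measure V (B q)}"
  have D1: "D1 \<subseteq> D" and D2: "D2 \<subseteq> D" by (auto simp: D1_def D2_def)
  have a0: "0 \<le> a q" and b0: "0 \<le> b q" for q
    unfolding a_def b_def using f0 g0 by (auto intro: avg_nonneg)
  \<comment> \<open>If \<open>f\<close> has the larger quantity, exclusion from \<open>D1\<close>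
    forces \<open>a q = 0\<close>. Otherwise exclusion from \<open>D2\<close> forces
    \<open>b q = 0\<close>, and the strict inequality fails.\<close>
  have rest: "t q = 0" if "q \<in> D - D1 - D2" for q
  proof -
    have "a q = 0"
    proof (cases "(b q)\<^sup>2 * measure V (B q) \<le> (a q)\<^sup>2 * measure S (A q)")
      case True
      then show ?thesis using that a0[of q] by (auto simp: D1_def)
    next
      case False
      then have "b q = 0" using that b0[of q] by (auto simp: D2_def)
      then show ?thesis using False by (simp add: mult_less_0_iff)
    qed
    then have "(\<integral>x. indicator (A q) x * f x \<partial>S) = 0"
      using avg_mult_measure[of "A q" S f] A_sets A_fin that unfolding a_def by simp
    then show ?thesis by (simp add: t_def)
  qed
  have "(\<Sum>q\<in>D. t q) = (\<Sum>q\<in>D1 \<union> D2. t q)"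
    using fin D1 D2 rest by (intro sum.mono_neutral_right) auto
  also have "\<dots> = (\<Sum>q\<in>D1. t q) + (\<Sum>q\<in>D2. t q)"
    using finite_subset[OF D1 fin] finite_subset[OF D2 fin]
    by (intro sum.union_disjoint) (auto simp: D1_def D2_def)
  also have "(\<Sum>q\<in>D1. t q) \<le> F * (32 * (\<integral>x. (f x)\<^sup>2 \<partial>S) + (\<integral>p. (g p)\<^sup>2 \<partial>V))"
    unfolding t_def
  proof (rule laminar_pair.form_bound_on_dominated_class[OF subfamily[OF D1]])
    fix r assume r: "r \<in> D1"
    have "(\<integral>p. (\<Sum>q\<in>{q\<in>D1. q \<le> r}. w q * measure S (A q) * indicator (B q) p)\<^sup>2 \<partial>V)
      \<le> (\<integral>p. (\<Sum>q\<in>{q\<in>D. q \<le> r}. w q * measure S (A q) * indicator (B q) p)\<^sup>2 \<partial>V)"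
      using D1 fin w_nonneg
      by (intro integral_mono integrable_square_sum_indicator_B power_mono sum_mono2 sum_nonneg) auto
    then show "(\<integral>p. (\<Sum>q\<in>{q\<in>D1. q \<le> r}. w q * measure S (A q) * indicator (B q) p)\<^sup>2 \<partial>V)
      \<le> F\<^sup>2 * measure S (A r)" using forward[of r] r D1 by force
  qed (use f f0 f2 g g0 g2 F in \<open>auto simp: D1_def a_def b_def\<close>)
  also have "(\<Sum>q\<in>D2. t q) \<le> K * (32 * (\<integral>p. (g p)\<^sup>2 \<partial>V) + (\<integral>x. (f x)\<^sup>2 \<partial>S))"
  proof -
    have "(\<Sum>q\<in>D2. w q * (\<integral>p. indicator (B q) p * g p \<partial>V) * (\<integral>x. indicator (A q) x * f x \<partial>S))
      \<le> K * (32 * (\<integral>p. (g p)\<^sup>2 \<partial>V) + (\<integral>x. (f x)\<^sup>2 \<partial>S))"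
    proof (rule laminar_pair.form_bound_on_dominated_class[OF sw.subfamily[OF D2]])
      fix r assume r: "r \<in> D2"
      have "(\<integral>x. (\<Sum>q\<in>{q\<in>D2. q \<le> r}. w q * measure V (B q) * indicator (A q) x)\<^sup>2 \<partial>S)
        \<le> (\<integral>x. (\<Sum>q\<in>{q\<in>D. q \<le> r}. w q * measure V (B q) * indicator (A q) x)\<^sup>2 \<partial>S)"
        using D2 fin w_nonneg
        by (intro integral_mono sw.integrable_square_sum_indicator_B power_mono sum_mono2 sum_nonneg) auto
      then show "(\<integral>x. (\<Sum>q\<in>{q\<in>D2. q \<le> r}. w q * measure V (B q) * indicator (A q) x)\<^sup>2 \<partial>S)
        \<le> K\<^sup>2 * measure V (B r)" using backward[of r] r D2 by force
    qed (use f f0 f2 g g0 g2 K in \<open>auto simp: D2_def a_def b_def\<close>)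
    then show ?thesis by (simp add: t_def mult_ac)
  qed
  also have "F * (32 * (\<integral>x. (f x)\<^sup>2 \<partial>S) + (\<integral>p. (g p)\<^sup>2 \<partial>V))
      + K * (32 * (\<integral>p. (g p)\<^sup>2 \<partial>V) + (\<integral>x. (f x)\<^sup>2 \<partial>S))
      \<le> F * (32 * (\<integral>x. (f x)\<^sup>2 \<partial>S) + 32 * (\<integral>p. (g p)\<^sup>2 \<partial>V))
      + K * (32 * (\<integral>p. (g p)\<^sup>2 \<partial>V) + 32 * (\<integral>x. (f x)\<^sup>2 \<partial>S))"
    using F K by (intro add_mono mult_left_mono) auto
  finally show ?thesis by (simp add: t_def algebra_simps)
qed

text \<open>The form bound is used with \<open>g\<close> the image of \<open>f\<close> and with
  \<open>f\<close> rescaled by \<open>64 * (F + K)\<close>. At this scale the square integral of the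
  image appears on the right with half the factor it has on the left, and it is finite, so it can be
  absorbed.\<close>

lemma operator_bound:
  assumes f [measurable]: "f \<in> borel_measurable S" and f0: "\<And>x. 0 \<le> f x"
    and f2: "integrable S (\<lambda>x. (f x)\<^sup>2)"
    and F: "0 < F" and K: "0 < K"
    and forward: "\<And>r. r \<in> D \<Longrightarrow>
      (\<integral>p. (\<Sum>q\<in>{q\<in>D. q \<le> r}. w q * measure S (A q) * indicator (B q) p)\<^sup>2 \<partial>V)
        \<le> F\<^sup>2 * measure S (A r)"
    and backward: "\<And>r. r \<in> D \<Longrightarrow>
      (\<integral>x. (\<Sum>q\<in>{q\<in>D. q \<le> r}. w q * measure V (B q) * indicator (A q) x)\<^sup>2 \<partial>S)
        \<le> K\<^sup>2 * measure V (B r)"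
  shows "(\<integral>p. (\<Sum>q\<in>D. w q * (\<integral>x. indicator (A q) x * f x \<partial>S) * indicator (B q) p)\<^sup>2 \<partial>V)
          \<le> (64 * (F + K))\<^sup>2 * (\<integral>x. (f x)\<^sup>2 \<partial>S)"
proof -
  define x where "x q = (\<integral>x. indicator (A q) x * f x \<partial>S)" for q
  define T where "T p = (\<Sum>q\<in>D. w q * x q * indicator (B q) p)" for p
  define H where "H = F + K"
  have H: "0 < H" using F K by (simp add: H_def)
  have x0: "0 \<le> x q" for q unfolding x_def using f0 by simp
  have T_meas: "T \<in> borel_measurable V"
    unfolding T_def using B_sets
    by (intro borel_measurable_sum borel_measurable_times borel_measurable_indicator) auto
  have T0: "0 \<le> T p" for p unfolding T_def using w_nonneg x0 by (intro sum_nonneg) auto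
  have T2: "integrable V (\<lambda>p. (T p)\<^sup>2)"
    unfolding T_def by (intro integrable_square_sum_indicator_B) auto
  have BT: "integrable V (\<lambda>p. indicator (B q) p * T p)" if "q \<in> D" for q
    using that B_sets B_fin T_meas T2 by (intro integrable_indicator_mult_square_integrable) auto
  have "(\<integral>p. (T p)\<^sup>2 \<partial>V) = (\<integral>p. (\<Sum>q\<in>D. w q * x q * (indicator (B q) p * T p)) \<partial>V)"
    by (intro Bochner_Integration.integral_cong refl)
      (subst power2_eq_square, subst (1) T_def, simp add: sum_distrib_left mult_ac)
  also have "\<dots> = (\<Sum>q\<in>D. w q * x q * (\<integral>p. indicator (B q) p * T p \<partial>V))"
    using BT by (subst Bochner_Integration.integral_sum) auto
  finally have TT: "(\<integral>p. (T p)\<^sup>2 \<partial>V) = (\<Sum>q\<in>D. w q * x q * (\<integral>p. indicator (B q) p * T p \<partial>V))" .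
  have "(\<Sum>q\<in>D. w q * (\<integral>x. indicator (A q) x * (64 * H * f x) \<partial>S) * (\<integral>p. indicator (B q) p * T p \<partial>V))
      \<le> 32 * (F + K) * ((\<integral>x. (64 * H * f x)\<^sup>2 \<partial>S) + (\<integral>p. (T p)\<^sup>2 \<partial>V))"
    using f f0 f2 T_meas T0 T2 F K forward backward H
    by (intro form_bound) (auto simp: power_mult_distrib)
  moreover have "(\<Sum>q\<in>D. w q * (\<integral>x. indicator (A q) x * (64 * H * f x) \<partial>S) * (\<integral>p. indicator (B q) p * T p \<partial>V))
      = 64 * H * (\<integral>p. (T p)\<^sup>2 \<partial>V)"
  proof -
    have "(\<integral>x. indicator (A q) x * (64 * H * f x) \<partial>S) = 64 * H * x q" for q
      unfolding x_def by (subst integral_mult_right_zero[symmetric]) (simp add: mult_ac)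
    then show ?thesis unfolding TT by (simp only:) (simp add: sum_distrib_left mult_ac)
  qed
  moreover have "(\<integral>x. (64 * H * f x)\<^sup>2 \<partial>S) = (64 * H)\<^sup>2 * (\<integral>x. (f x)\<^sup>2 \<partial>S)"
    by (simp add: power_mult_distrib)
  ultimately have "32 * H * (\<integral>p. (T p)\<^sup>2 \<partial>V) \<le> 32 * H * ((64 * H)\<^sup>2 * (\<integral>x. (f x)\<^sup>2 \<partial>S))"
    by (simp add: H_def[symmetric] algebra_simps)
  then have "(\<integral>p. (T p)\<^sup>2 \<partial>V) \<le> (64 * H)\<^sup>2 * (\<integral>x. (f x)\<^sup>2 \<partial>S)"
    using H by (subst (asm) mult_le_cancel_left_pos) auto
  then show ?thesis by (simp add: T_def x_def H_def)
qed

end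

section \<open>Estimates for the kernel\<close>

text \<open>\<open>H\<close> is an explicit antiderivative. For small \<open>lam\<close> the
  integrand is unbounded at 0, so the fundamental theorem is applied on the open interval, with
  one-sided limits of \<open>H\<close> at the ends. Leaving the factor \<open>m powr lam\<close> out
  of \<open>H\<close> keeps \<open>m = 0\<close> admissible, and the second half of the range relies
  on that case.\<close>

lemma half_range_integral:
  fixes lam d m :: real
  assumes lam: "0 < lam" and d: "0 < d" and m: "0 \<le> m"
  defines "h \<equiv> \<lambda>\<theta>. sin \<theta> * (1 - cos \<theta>) powr (lam - 1) / (d + m * (1 - cos \<theta>)) powr (lam + 1)"
  shows "set_integrable lborel {0<..<pi/2} h"
    and "(LINT \<theta>:{0<..<pi/2}|lborel. h \<theta>) = 1 / (lam * d * (d + m) powr lam)"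
proof -
  define H where "H \<theta> = ((1 - cos \<theta>) / (d + m * (1 - cos \<theta>))) powr lam / (lam * d)" for \<theta> :: real
  have pos: "0 < 1 - cos \<theta>" "0 < sin \<theta>" "0 < d + m * (1 - cos \<theta>)" if "0 < \<theta>" "\<theta> < pi/2" for \<theta> :: real
  proof -
    show s: "0 < sin \<theta>" using that by (intro sin_gt_zero) auto
    have "cos \<theta> < cos 0" using that by (intro cos_monotone_0_pi) auto
    then show "0 < 1 - cos \<theta>" by simp
    then show "0 < d + m * (1 - cos \<theta>)" using d m by (intro add_pos_nonneg) auto
  qed
  have der: "DERIV H \<theta> :> h \<theta>" if "0 < \<theta>" "\<theta> < pi/2" for \<theta> :: real
  proof -
    define u where "u = 1 - cos \<theta>"
    define v where "v = d + m * u"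
    have u: "0 < u" and v: "0 < v" using pos[OF that] by (auto simp: u_def v_def)
    have "DERIV H \<theta> :> lam * (u / v) powr (lam - 1) * ((sin \<theta> * v - u * (m * sin \<theta>)) / (v * v)) / (lam * d)"
      unfolding H_def u_def v_def
      using pos[OF that] lam d
      by (auto intro!: derivative_eq_intros DERIV_powr simp: powr_diff divide_simps)
    moreover have "lam * (u / v) powr (lam - 1) * ((sin \<theta> * v - u * (m * sin \<theta>)) / (v * v)) / (lam * d) = h \<theta>"
    proof -
      have 1: "sin \<theta> * v - u * (m * sin \<theta>) = sin \<theta> * d" by (simp add: v_def algebra_simps)
      have 2: "(u / v) powr (lam - 1) = u powr (lam - 1) / v powr (lam - 1)"
        using u v by (simp add: powr_divide)
      have "v powr (lam + 1) = v powr ((lam - 1) + 2)" by (simp add: algebra_simps)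
      also have "\<dots> = v powr (lam - 1) * (v * v)"
        unfolding powr_add using v by (simp add: power2_eq_square)
      finally have 3: "v powr (lam + 1) = v powr (lam - 1) * (v * v)" .
      show ?thesis
        unfolding 1 2 h_def u_def[symmetric] v_def[symmetric] 3 using lam d u v by (simp add: field_simps)
    qed
    ultimately show ?thesis by simp
  qed
  have cont_h: "isCont h \<theta>" if "0 < \<theta>" "\<theta> < pi/2" for \<theta> :: real
    unfolding h_def using pos[OF that] by (intro continuous_intros) auto
  have cont_H: "isCont H \<theta>" if "\<theta> \<in> {0, pi/2}" for \<theta>
  proof -
    have "0 < d + m * (1 - cos \<theta>)" using d m by (intro add_pos_nonneg) auto
    then have "d + m * (1 - cos \<theta>) \<noteq> 0" by simp
    then have "isCont (\<lambda>\<theta>. (1 - cos \<theta>) / (d + m * (1 - cos \<theta>))) \<theta>"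
      by (intro continuous_intros)
    moreover have "\<forall>\<^sub>F x in nhds \<theta>. 0 \<le> (1 - cos x) / (d + m * (1 - cos x))"
      using d m by (intro always_eventually allI divide_nonneg_nonneg add_nonneg_nonneg mult_nonneg_nonneg) auto
    ultimately have "((\<lambda>x. ((1 - cos x) / (d + m * (1 - cos x))) powr lam) \<longlongrightarrow>
        ((1 - cos \<theta>) / (d + m * (1 - cos \<theta>))) powr lam) (at \<theta>)"
      using lam unfolding isCont_def
      by (intro tendsto_powr2) (auto simp: eventually_at_filter elim: eventually_mono)
    then show ?thesis unfolding H_def isCont_def by (intro tendsto_divide tendsto_const) (use lam d in auto)
  qed
  have limA: "((H \<circ> real_of_ereal) \<longlongrightarrow> 0) (at_right (ereal 0))"
    using cont_H[of 0] lam d unfolding isCont_def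
    by (auto simp: ereal_tendsto_simps H_def intro: filterlim_mono[OF _ order_refl at_le])
  have "H (pi/2) = 1 / (lam * d * (d + m) powr lam)"
    using d m by (simp add: H_def powr_divide)
  then have limB: "((H \<circ> real_of_ereal) \<longlongrightarrow> 1 / (lam * d * (d + m) powr lam)) (at_left (ereal (pi/2)))"
    using cont_H[of "pi/2"] unfolding isCont_def
    by (auto simp: ereal_tendsto_simps1 intro: filterlim_mono[OF _ order_refl at_le])
  have nn: "0 \<le> h \<theta>" if "0 < \<theta>" "\<theta> < pi/2" for \<theta>
    using pos[OF that] by (simp add: h_def)
  note FTC = interval_integral_FTC_nonneg[of "ereal 0" "ereal (pi/2)" H h, OF _ _ _ _ limA limB]
  have "set_integrable lborel (einterval (ereal 0) (ereal (pi/2))) h"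
    using der cont_h nn by (intro FTC(1)) auto
  then show "set_integrable lborel {0<..<pi/2} h" by simp
  have "(LBINT x=ereal 0..ereal (pi/2). h x) = 1 / (lam * d * (d + m) powr lam) - 0"
    using der cont_h nn by (intro FTC(2)) auto
  then show "(LINT \<theta>:{0<..<pi/2}|lborel. h \<theta>) = 1 / (lam * d * (d + m) powr lam)"
    by (simp add: interval_integral_Ioo)
qed

text \<open>Reflecting the angle at \<open>pi/2\<close> reduces this to the previous integral with
  \<open>d = 1\<close> and \<open>m = 0\<close>.\<close>

lemma half_range_integral_reflected:
  fixes lam :: real
  assumes lam: "0 < lam"
  defines "h \<equiv> \<lambda>\<theta>. sin \<theta> * (1 + cos \<theta>) powr (lam - 1)"
  shows "set_integrable lborel {pi/2<..<pi} h"
    and "(LINT \<theta>:{pi/2<..<pi}|lborel. h \<theta>) = 1 / lam"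
proof -
  let ?h0 = "\<lambda>\<theta>. sin \<theta> * (1 - cos \<theta>) powr (lam - 1) :: real"
  have i0: "set_integrable lborel {0<..<pi/2} ?h0" "(LINT \<theta>:{0<..<pi/2}|lborel. ?h0 \<theta>) = 1 / lam"
    using half_range_integral[OF lam, of 1 0] by simp_all
  let ?F = "\<lambda>\<theta>. indicator {pi/2<..<pi} \<theta> *\<^sub>R h \<theta>"
  have eq: "?F (pi + (-1) * x) = indicator {0<..<pi/2} x *\<^sub>R ?h0 x" for x
    by (auto simp: h_def indicator_def)
  have "integrable lborel (\<lambda>x. ?F (pi + (-1) * x))"
    unfolding eq using i0(1) by (simp add: set_integrable_def)
  then show "set_integrable lborel {pi/2<..<pi} h"
    unfolding set_integrable_def using lborel_integrable_real_affine_iff[of "-1" ?F pi] by simp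
  have "(LINT \<theta>:{pi/2<..<pi}|lborel. h \<theta>) = (\<integral>x. ?F (pi + (-1) * x) \<partial>lborel)"
    unfolding set_lebesgue_integral_def using lborel_integral_real_affine[of "-1" ?F pi] by simp
  then show "(LINT \<theta>:{pi/2<..<pi}|lborel. h \<theta>) = 1 / lam"
    unfolding eq using i0(2) by (simp add: set_lebesgue_integral_def)
qed

section \<open>Comparison of the Poisson kernel with the model kernel\<close>

definition model_kernel :: "real \<Rightarrow> real \<Rightarrow> real \<Rightarrow> real \<Rightarrow> real" where
  "model_kernel lam t x y = 1 / (((x - y)\<^sup>2 + t\<^sup>2) * (x\<^sup>2 + y\<^sup>2 + t\<^sup>2) powr lam)"

lemma powr_between_1_2:
  fixes u a :: real
  assumes "1 \<le> u" "u \<le> 2"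
  shows "min 1 (2 powr a) \<le> u powr a" and "u powr a \<le> max 1 (2 powr a)"
proof -
  have "min 1 (2 powr a) \<le> u powr a \<and> u powr a \<le> max 1 (2 powr a)"
  proof (cases "0 \<le> a")
    case True
    have "1 powr a \<le> u powr a" "u powr a \<le> 2 powr a"
      using assms True ge_one_powr_ge_zero[of u a] by (auto intro!: powr_mono2)
    then show ?thesis by auto
  next
    case False
    have "u powr a \<le> 1 powr a" "2 powr a \<le> u powr a"
      using assms False powr_mono2'[of a 1 u] powr_mono2'[of a u 2] by auto
    then show ?thesis by auto
  qed
  then show "min 1 (2 powr a) \<le> u powr a" "u powr a \<le> max 1 (2 powr a)" by auto
qed

text \<open>With \<open>d = (x - y)\<^sup>2 + t\<^sup>2\<close>, the substitution \<open>v = 2xy(1 - cos \<theta>)\<close> makes the integrand on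
  \<open>[0, \<pi>/2]\<close> comparable to the exact derivative of \<open>(v / (d + v)) powr lam\<close>; on
  \<open>[\<pi>/2, \<pi>]\<close> the denominator is comparable to a constant.\<close>

lemma kernel_integral_bounds:
  fixes lam t x y :: real
  assumes lam: "0 < lam" and t: "0 < t" and x: "0 \<le> x" and y: "0 \<le> y"
  defines "J \<equiv> LINT \<theta>:{0..pi}|lborel.
          sin \<theta> powr (2 * lam - 1) / (x\<^sup>2 + y\<^sup>2 + t\<^sup>2 - 2 * x * y * cos \<theta>) powr (lam + 1)"
  shows "min 1 (2 powr (lam - 1)) / lam * model_kernel lam t x y \<le> J"
    and "J \<le> 2 * max 1 (2 powr (lam - 1)) / lam * model_kernel lam t x y"
proof -
  define d where "d = (x - y)\<^sup>2 + t\<^sup>2"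
  define m where "m = 2 * x * y"
  define s where "s = x\<^sup>2 + y\<^sup>2 + t\<^sup>2"
  define j where "j \<theta> = sin \<theta> powr (2 * lam - 1) / (x\<^sup>2 + y\<^sup>2 + t\<^sup>2 - 2 * x * y * cos \<theta>) powr (lam + 1)" for \<theta>
  define k0 where "k0 = min 1 ((2::real) powr (lam - 1))"
  define k1 where "k1 = max 1 ((2::real) powr (lam - 1))"
  have d: "0 < d" unfolding d_def using t by (intro add_nonneg_pos) auto
  have m: "0 \<le> m" using x y by (simp add: m_def)
  have sdm: "s = d + m" by (simp add: s_def d_def m_def power2_eq_square algebra_simps)
  have s: "0 < s" using d m sdm by simp
  have k1: "1 \<le> k1" by (simp add: k1_def)
  have k0: "0 < k0" by (simp add: k0_def)
  have den: "x\<^sup>2 + y\<^sup>2 + t\<^sup>2 - 2 * x * y * cos \<theta> = d + m * (1 - cos \<theta>)" for \<theta>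
    by (simp add: d_def m_def power2_eq_square algebra_simps)
  have mk: "model_kernel lam t x y = 1 / (d * s powr lam)"
    by (simp add: model_kernel_def d_def s_def)
  define h1 where "h1 \<theta> = sin \<theta> * (1 - cos \<theta>) powr (lam - 1) / (d + m * (1 - cos \<theta>)) powr (lam + 1)" for \<theta>
  define h2 where "h2 \<theta> = sin \<theta> * (1 + cos \<theta>) powr (lam - 1)" for \<theta> :: real
  have h1: "integrable lborel (\<lambda>\<theta>. indicator {0<..<pi/2} \<theta> * h1 \<theta>)"
    "(\<integral>\<theta>. indicator {0<..<pi/2} \<theta> * h1 \<theta> \<partial>lborel) = 1 / (lam * d * s powr lam)"
    using half_range_integral[OF lam d m] unfolding h1_def set_integrable_def set_lebesgue_integral_def sdm by simp_all
  have h2: "integrable lborel (\<lambda>\<theta>. indicator {pi/2<..<pi} \<theta> * h2 \<theta>)"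
    "(\<integral>\<theta>. indicator {pi/2<..<pi} \<theta> * h2 \<theta> \<partial>lborel) = 1 / lam"
    using half_range_integral_reflected[OF lam] unfolding h2_def set_integrable_def set_lebesgue_integral_def by simp_all
  \<comment> \<open>Since the squared sine is
    \<open>(1 + cos \<theta>) * (1 - cos \<theta>)\<close>, its power splits into two: on each half
    of the range one factor has its base in \<open>[1, 2]\<close>, and the other, together with the
    sine, is integrated exactly.\<close>
  have sin_split: "sin \<theta> powr (2 * lam - 1) = (1 + cos \<theta>) powr (lam - 1) * (sin \<theta> * (1 - cos \<theta>) powr (lam - 1))"
    if "0 < sin \<theta>" for \<theta> :: real
  proof -
    have "sin \<theta> powr (2 * lam - 1) = sin \<theta> powr (1 + 2 * (lam - 1))" by (simp add: algebra_simps)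
    also have "\<dots> = sin \<theta> * (sin \<theta> powr 2) powr (lam - 1)"
      unfolding powr_add powr_powr using that by simp
    also have "sin \<theta> powr 2 = (1 + cos \<theta>) * (1 - cos \<theta>)"
      using that sin_squared_eq[of \<theta>] by (simp add: power2_eq_square algebra_simps)
    also have "((1 + cos \<theta>) * (1 - cos \<theta>)) powr (lam - 1) = (1 + cos \<theta>) powr (lam - 1) * (1 - cos \<theta>) powr (lam - 1)"
      by (rule powr_mult)
    finally show ?thesis by simp
  qed
  have first: "k0 * h1 \<theta> \<le> j \<theta> \<and> j \<theta> \<le> k1 * h1 \<theta>" if "0 < \<theta>" "\<theta> < pi/2" for \<theta>
  proof -
    have sp: "0 < sin \<theta>" using that by (intro sin_gt_zero) auto
    have cp: "0 \<le> cos \<theta>" using that by (intro cos_ge_zero) auto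
    have "j \<theta> = (1 + cos \<theta>) powr (lam - 1) * h1 \<theta>"
      unfolding j_def den sin_split[OF sp] h1_def by simp
    moreover have "0 \<le> h1 \<theta>" unfolding h1_def using sp by simp
    moreover have "k0 \<le> (1 + cos \<theta>) powr (lam - 1)" "(1 + cos \<theta>) powr (lam - 1) \<le> k1"
      using powr_between_1_2[of "1 + cos \<theta>" "lam - 1"] cp by (auto simp: k0_def k1_def)
    ultimately show ?thesis by (auto intro: mult_right_mono)
  qed
  have second: "j \<theta> \<le> k1 / s powr (lam + 1) * h2 \<theta>" if "pi/2 < \<theta>" "\<theta> < pi" for \<theta>
  proof -
    have sp: "0 < sin \<theta>" using that by (intro sin_gt_zero) auto
    have cp: "cos \<theta> \<le> 0" using that cos_monotone_0_pi_le[of "pi/2" \<theta>] by auto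
    have hn: "0 \<le> h2 \<theta>" using sp by (simp add: h2_def)
    have "s \<le> d + m * (1 - cos \<theta>)" unfolding sdm using m cp
      by (simp add: algebra_simps mult_nonneg_nonpos)
    then have pw: "s powr (lam + 1) \<le> (d + m * (1 - cos \<theta>)) powr (lam + 1)"
      using s lam by (intro powr_mono2) auto
    have "j \<theta> = (1 - cos \<theta>) powr (lam - 1) * h2 \<theta> / (d + m * (1 - cos \<theta>)) powr (lam + 1)"
      unfolding j_def den sin_split[OF sp] h2_def by simp
    also have "\<dots> \<le> k1 * h2 \<theta> / s powr (lam + 1)"
      using powr_between_1_2(2)[of "1 - cos \<theta>" "lam - 1"] cp hn pw s k1
      by (intro frac_le mult_right_mono mult_nonneg_nonneg) (auto simp: k1_def)
    finally show ?thesis by simp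
  qed
  have j0: "0 \<le> j \<theta>" for \<theta> by (simp add: j_def)
  define U where "U \<theta> = k1 * (indicator {0<..<pi/2} \<theta> * h1 \<theta>)
      + k1 / s powr (lam + 1) * (indicator {pi/2<..<pi} \<theta> * h2 \<theta>)" for \<theta>
  have U_int: "integrable lborel U" unfolding U_def
    using h1 h2 by (intro Bochner_Integration.integrable_add integrable_mult_right) auto
  \<comment> \<open>The two open halves omit \<open>pi/2\<close>, hence the exception. At 0 and
    \<open>pi\<close> the sine vanishes and \<open>0 powr a = 0\<close> for every real
    \<open>a\<close>, so the integrand is 0 there even when the exponent is negative.\<close>
  have jU: "indicator {0..pi} \<theta> * j \<theta> \<le> U \<theta>" if "\<theta> \<noteq> pi/2" for \<theta>
  proof (cases "0 < \<theta> \<and> \<theta> < pi")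
    case True
    then show ?thesis using that first[of \<theta>] second[of \<theta>] by (cases "\<theta> < pi/2") (auto simp: U_def)
  next
    case False
    have "sin \<theta> = 0" if "\<theta> \<in> {0..pi}" using that False by (cases "\<theta> = 0") auto
    then have "indicator {0..pi} \<theta> * j \<theta> = 0" by (auto simp: j_def indicator_def)
    moreover have "U \<theta> = 0" using False by (auto simp: U_def indicator_def)
    ultimately show ?thesis by (metis order_refl)
  qed
  have ae: "AE \<theta> in lborel. indicator {0..pi} \<theta> * j \<theta> \<le> U \<theta>"
    using AE_lborel_singleton[of "pi/2"] by eventually_elim (rule jU)
  have j_meas: "j \<in> borel_measurable lborel" unfolding j_def by measurable
  have j_int: "integrable lborel (\<lambda>\<theta>. indicator {0..pi} \<theta> * j \<theta>)"
    using ae j0 j_meas by (intro Bochner_Integration.integrable_bound[OF U_int]) (auto elim!: eventually_mono)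
  have J: "J = (\<integral>\<theta>. indicator {0..pi} \<theta> * j \<theta> \<partial>lborel)"
    unfolding J_def set_lebesgue_integral_def j_def by simp
  have "J \<le> (\<integral>\<theta>. U \<theta> \<partial>lborel)"
    unfolding J by (intro integral_mono_AE j_int U_int ae)
  also have "\<dots> = k1 * (1 / (lam * d * s powr lam)) + k1 / s powr (lam + 1) * (1 / lam)"
    unfolding U_def using h1 h2 by (subst Bochner_Integration.integral_add) auto
  \<comment> \<open>The bound for the second half is at most the one for the first, because
    \<open>d \<le> s\<close>. This is the factor 2 in the upper estimate.\<close>
  also have "\<dots> \<le> k1 * (1 / (lam * d * s powr lam)) + k1 * (1 / (lam * d * s powr lam))"
  proof -
    have "d * s powr lam \<le> s powr (lam + 1)"
      unfolding powr_add using s sdm m by (simp add: mult.commute)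
    then have "lam * d * s powr lam \<le> s powr (lam + 1) * lam"
      using lam by (simp add: mult.commute mult.left_commute)
    then have "k1 / (s powr (lam + 1) * lam) \<le> k1 / (lam * d * s powr lam)"
      using k1 lam d s by (intro divide_left_mono) auto
    moreover have "k1 / s powr (lam + 1) * (1 / lam) = k1 / (s powr (lam + 1) * lam)"
      "k1 * (1 / (lam * d * s powr lam)) = k1 / (lam * d * s powr lam)" by simp_all
    ultimately show ?thesis by linarith
  qed
  finally show "J \<le> 2 * max 1 (2 powr (lam - 1)) / lam * model_kernel lam t x y"
    unfolding mk k1_def[symmetric] by (simp add: field_simps)
  have "k0 * (1 / (lam * d * s powr lam)) = (\<integral>\<theta>. k0 * (indicator {0<..<pi/2} \<theta> * h1 \<theta>) \<partial>lborel)"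
    using h1 by simp
  also have "\<dots> \<le> J"
    unfolding J using h1 j_int first j0
    by (intro integral_mono) (auto simp: indicator_def)
  finally show "min 1 (2 powr (lam - 1)) / lam * model_kernel lam t x y \<le> J"
    unfolding mk k0_def[symmetric] by (simp add: field_simps)
qed

lemma kernel_comparable_model:
  fixes lam :: real
  assumes lam: "0 < lam"
  shows "\<exists>c0>0. \<exists>c1>0. \<forall>t>0. \<forall>x\<ge>0. \<forall>y\<ge>0.
    c0 * t * model_kernel lam t x y \<le> bessel_poisson_kernel lam t x y \<and>
    bessel_poisson_kernel lam t x y \<le> c1 * t * model_kernel lam t x y"
proof (intro exI conjI allI impI)
  show "0 < 2 / pi * min 1 (2 powr (lam - 1))" "0 < 4 / pi * max 1 (2 powr (lam - 1))"
    by (simp_all add: max_def)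
  fix t x y :: real assume t: "0 < t" and "0 \<le> x" "0 \<le> y"
  note b = kernel_integral_bounds[OF lam t \<open>0 \<le> x\<close> \<open>0 \<le> y\<close>]
  have p: "0 \<le> 2 * lam * t / pi" using lam t by simp
  show "2 / pi * min 1 (2 powr (lam - 1)) * t * model_kernel lam t x y \<le> bessel_poisson_kernel lam t x y"
    using mult_left_mono[OF b(1) p] lam unfolding bessel_poisson_kernel_def by (simp add: mult_ac)
  show "bessel_poisson_kernel lam t x y \<le> 4 / pi * max 1 (2 powr (lam - 1)) * t * model_kernel lam t x y"
    using mult_left_mono[OF b(2) p] lam unfolding bessel_poisson_kernel_def by (simp add: mult_ac)
qed

lemma kernel_measurable [measurable (raw)]:
  assumes [measurable]: "t \<in> borel_measurable M" "x \<in> borel_measurable M" "y \<in> borel_measurable M"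
  shows "(\<lambda>z. bessel_poisson_kernel lam (t z) (x z) (y z)) \<in> borel_measurable M"
  unfolding bessel_poisson_kernel_def set_lebesgue_integral_def by measurable

lemma kernel_nonneg: "0 < lam \<Longrightarrow> 0 \<le> t \<Longrightarrow> 0 \<le> bessel_poisson_kernel lam t x y"
  unfolding bessel_poisson_kernel_def set_lebesgue_integral_def
  by (intro mult_nonneg_nonneg divide_nonneg_nonneg integral_nonneg) auto

section \<open>Dyadic grids on the half line\<close>

text \<open>The sign of the shift alternates with the level, which keeps the shifted grid nested.\<close>

definition grid_shift :: "bool \<Rightarrow> int \<Rightarrow> real" where
  "grid_shift j n = (if j then (if even n then 1/3 else -1/3) else 0)"

definition grid_index :: "bool \<Rightarrow> int \<Rightarrow> real \<Rightarrow> int" where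
  "grid_index j n x = \<lfloor>x / 2 powr n - grid_shift j n\<rfloor>"

definition cell :: "bool \<Rightarrow> int \<Rightarrow> int \<Rightarrow> real set" where
  "cell j n k = {x. 0 < x \<and> grid_index j n x = k}"

text \<open>Finite truncations, which exhaust the grid as \<open>m\<close> grows. Members are sets
  and not index pairs: in the shifted grid cells cut off by the origin can coincide at consecutive
  levels, as in \<open>cell True 1 0 = cell True 2 (-1)\<close>, and are then counted once.
  Nonemptiness discards the indices to the left of the origin.\<close>

definition grid :: "bool \<Rightarrow> nat \<Rightarrow> real set set" where
  "grid j m = {Q. Q \<noteq> {} \<and> (\<exists>n k. \<bar>n\<bar> \<le> int m \<and> \<bar>k\<bar> \<le> int m \<and> Q = cell j n k)}"

lemma finite_grid: "finite (grid j m)"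
proof (rule finite_subset)
  show "grid j m \<subseteq> (\<lambda>(n, k). cell j n k) ` ({- int m..int m} \<times> {- int m..int m})"
    by (auto simp: grid_def abs_le_iff image_iff intro!: bexI)
qed auto

lemma grid_mono:
  assumes "m \<le> m'"
  shows "grid j m \<subseteq> grid j m'"
proof
  fix Q assume "Q \<in> grid j m"
  then obtain n k where "Q \<noteq> {}" "\<bar>n\<bar> \<le> int m" "\<bar>k\<bar> \<le> int m" "Q = cell j n k"
    by (auto simp: grid_def)
  moreover have "int m \<le> int m'" using assms by simp
  ultimately show "Q \<in> grid j m'" unfolding grid_def by (blast intro: order_trans)
qed

text \<open>Nestedness rests on \<open>2 * grid_shift j (n + 1) - grid_shift j n\<close> being an
  integer: in the shifted grid the alternating sign makes it 1 or -1. The coarser index is then a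
  function of the finer one.\<close>

lemma grid_index_Suc:
  "\<exists>e. \<forall>x. grid_index j (n + 1) x = (grid_index j n x - e) div 2"
proof -
  define e :: int where "e = (if j then (if even n then -1 else 1) else 0)"
  have e: "real_of_int e = 2 * grid_shift j (n + 1) - grid_shift j n"
    by (simp add: e_def grid_shift_def)
  have "grid_index j (n + 1) x = (grid_index j n x - e) div 2" for x
  proof -
    define v where "v = x / 2 powr (n + 1) - grid_shift j (n + 1)"
    have "x / 2 powr n = 2 * (x / 2 powr (n + 1))" by (simp add: powr_add)
    then have "x / 2 powr n - grid_shift j n = 2 * v + e"
      unfolding e v_def by simp
    then have "grid_index j n x - e = \<lfloor>2 * v\<rfloor>"
      unfolding grid_index_def by (metis add_diff_cancel_right' floor_add_int)
    moreover have "\<lfloor>2 * v\<rfloor> div 2 = \<lfloor>(2 * v) / real_of_int 2\<rfloor>"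
      by (rule floor_divide_real_eq_div[symmetric]) simp
    moreover have "grid_index j (n + 1) x = \<lfloor>v\<rfloor>" by (simp add: grid_index_def v_def)
    ultimately show ?thesis by simp
  qed
  then show ?thesis by blast
qed

lemma grid_index_eq_mono:
  assumes "n \<le> n'" "grid_index j n x = grid_index j n y"
  shows "grid_index j n' x = grid_index j n' y"
  using assms(1)
proof (induction n' rule: int_ge_induct)
  case (step i)
  obtain e where "\<forall>x. grid_index j (i + 1) x = (grid_index j i x - e) div 2"
    using grid_index_Suc by blast
  then show ?case using step by simp
qed (use assms in auto)

lemma cell_nested:
  assumes "n \<le> n'" "cell j n k \<inter> cell j n' k' \<noteq> {}"
  shows "cell j n k \<subseteq> cell j n' k'"
proof -
  obtain z where z: "grid_index j n z = k" "grid_index j n' z = k'"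
    using assms(2) by (auto simp: cell_def)
  show ?thesis
    using grid_index_eq_mono[OF assms(1), of j _ z] z by (auto simp: cell_def)
qed

lemma grid_laminar:
  assumes "Q \<in> grid j m" "R \<in> grid j m"
  shows "Q \<subseteq> R \<or> R \<subseteq> Q \<or> Q \<inter> R = {}"
proof -
  obtain n k n' k' where "Q = cell j n k" "R = cell j n' k'"
    using assms by (auto simp: grid_def)
  then show ?thesis using cell_nested[of n n' j k k'] cell_nested[of n' n j k' k]
    by (cases "n \<le> n'") (auto simp: Int_commute)
qed

section \<open>Geometry of intervals and cells\<close>

lemma Sup_Inf_between:
  fixes Q :: "real set"
  assumes "l < r" "{l<..<r} \<subseteq> Q" "Q \<subseteq> {l..r}"
  shows "Sup Q = r" "Inf Q = l"
proof -
  have ne: "{l<..<r} \<noteq> {}" using assms(1) by simp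
  then have neQ: "Q \<noteq> {}" using assms(2) by blast
  have bd: "bdd_above Q" "bdd_below Q" using assms(3) by (auto intro: bdd_above_mono bdd_below_mono)
  have "Sup {l<..<r} \<le> Sup Q" "Sup Q \<le> Sup {l..r}"
    using assms ne neQ bd by (intro cSup_subset_mono; simp)+
  then show "Sup Q = r" using assms(1) by simp
  have "Inf Q \<le> Inf {l<..<r}" "Inf {l..r} \<le> Inf Q"
    using assms ne neQ bd by (intro cInf_superset_mono; simp)+
  then show "Inf Q = l" using assms(1) by simp
qed

lemma pos_interval_between:
  assumes "pos_interval I"
  shows "{Inf I<..<Sup I} \<subseteq> I" "I \<subseteq> {Inf I..Sup I}" "0 \<le> Inf I" "Inf I \<le> Sup I"
proof -
  have I: "is_interval I" "bounded I" "I \<noteq> {}" "I \<subseteq> {0<..}" using assms by (auto simp: pos_interval_def)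
  have bd: "bdd_above I" "bdd_below I" using I(2) by (auto simp: bounded_imp_bdd_above bounded_imp_bdd_below)
  show s: "I \<subseteq> {Inf I..Sup I}" using bd by (auto intro: cInf_lower cSup_upper)
  obtain z where "z \<in> I" using I(3) by blast
  with s have "Inf I \<le> z" "z \<le> Sup I" by auto
  then show "Inf I \<le> Sup I" by linarith
  show "0 \<le> Inf I" using I(3,4) by (intro cInf_greatest) auto
  show "{Inf I<..<Sup I} \<subseteq> I"
  proof
    fix z assume z: "z \<in> {Inf I<..<Sup I}"
    obtain u where u: "u \<in> I" "u < z" using z I(3) bd by (auto simp: cInf_less_iff)
    obtain v where v: "v \<in> I" "z < v" using z I(3) bd by (auto simp: less_cSup_iff)
    show "z \<in> I" using I(1) u v unfolding is_interval_1 by (meson less_imp_le)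
  qed
qed

lemma cell_geometry:
  assumes "cell j n k \<noteq> {}"
  shows "pos_interval (cell j n k)"
    and "2 powr n / 3 \<le> interval_length (cell j n k)"
    and "interval_length (cell j n k) \<le> 2 powr n"
    and "cell j n k \<in> sets borel"
proof -
  define h :: real where "h = 2 powr n"
  define s where "s = grid_shift j n"
  have h: "0 < h" by (simp add: h_def)
  have mem: "x \<in> cell j n k \<longleftrightarrow> 0 < x \<and> h * (k + s) \<le> x \<and> x < h * (k + 1 + s)" for x
  proof -
    have "grid_index j n x = k \<longleftrightarrow> real_of_int k \<le> x / h - s \<and> x / h - s < k + 1"
      unfolding grid_index_def h_def s_def by (simp add: floor_eq_iff)
    also have "\<dots> \<longleftrightarrow> h * (k + s) \<le> x \<and> x < h * (k + 1 + s)"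
      using h by (simp add: field_simps)
    finally show ?thesis by (auto simp: cell_def)
  qed
  define l where "l = max 0 (h * (k + s))"
  define r where "r = h * (k + 1 + s)"
  obtain z where "z \<in> cell j n k" using assms by blast
  then have "0 < h * (k + 1 + s)" using mem[of z] by linarith
  then have r_pos: "0 < k + 1 + s" using h by (simp add: zero_less_mult_iff)
  \<comment> \<open>A cell cut off by the origin keeps at least a third of the full length: in units
    of \<open>h\<close> its right end is a positive number of the form integer plus 0, 1/3 or
    -1/3.\<close>
  have r3: "1/3 \<le> k + 1 + s"
  proof -
    have "s = 0 \<or> s = 1/3 \<or> s = -1/3" by (simp add: s_def grid_shift_def)
    then consider "s = 0" | "s = 1/3" | "s = -1/3" by blast
    then show ?thesis
    proof cases
      case 1 then have "0 < k + 1" using r_pos by linarith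
      then show ?thesis using 1 by linarith
    next
      case 2 then have "-1 < k + 1" using r_pos by linarith
      then have "0 \<le> real_of_int (k + 1)" by linarith
      then show ?thesis using 2 by linarith
    next
      case 3 then have "0 < k + 1" using r_pos by linarith
      then have "1 \<le> real_of_int (k + 1)" by linarith
      then show ?thesis using 3 by linarith
    qed
  qed
  have r3h: "h / 3 \<le> r" using mult_left_mono[OF r3, of h] h by (simp add: r_def)
  have lr: "l < r" using h r_pos by (auto simp: l_def r_def)
  have sub: "{l<..<r} \<subseteq> cell j n k" "cell j n k \<subseteq> {l..r}"
    by (auto simp: mem l_def r_def)
  have SI: "Sup (cell j n k) = r" "Inf (cell j n k) = l"
    using Sup_Inf_between[OF lr sub] by auto
  have len: "interval_length (cell j n k) = r - l" by (simp add: interval_length_def SI)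
  have rl: "r - h * (k + s) = h" by (simp add: r_def algebra_simps)
  show "interval_length (cell j n k) \<le> 2 powr n" unfolding len h_def[symmetric] using rl by (simp add: l_def)
  show "2 powr n / 3 \<le> interval_length (cell j n k)"
    unfolding len h_def[symmetric] using rl r3h h by (auto simp: l_def max_def)
  show "pos_interval (cell j n k)"
    unfolding pos_interval_def
  proof (intro conjI)
    show "is_interval (cell j n k)" unfolding is_interval_1 by (auto simp: mem)
    show "bounded (cell j n k)" using sub(2) by (rule bounded_subset[rotated]) auto
  qed (use assms in \<open>auto simp: cell_def\<close>)
  then have "is_interval (cell j n k)" by (simp add: pos_interval_def)
  then show "cell j n k \<in> sets borel" by (rule real_interval_borel_measurable)
qed

lemma grid_memD:
  assumes "Q \<in> grid j m"
  shows "pos_interval Q" "0 < interval_length Q" "Q \<in> sets borel"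
proof -
  obtain n k where Q: "Q = cell j n k" "Q \<noteq> {}" using assms by (auto simp: grid_def)
  show "pos_interval Q" "Q \<in> sets borel" using cell_geometry[of j n k] Q by auto
  have "(0::real) < 2 powr n / 3" by simp
  also have "\<dots> \<le> interval_length Q" using cell_geometry(2)[of j n k] Q by simp
  finally show "0 < interval_length Q" .
qed

section \<open>The dyadic kernel and its comparison with the model kernel\<close>

definition carleson_box :: "real set \<Rightarrow> (real \<times> real) set" where
  "carleson_box Q = Q \<times> {0<..interval_length Q}"

text \<open>The size of the model kernel when \<open>\<bar>x - y\<bar>\<close> and \<open>t\<close>
  are of the order of the length of \<open>Q\<close>; then \<open>x^2 + y^2 + t^2\<close> is of the
  order of \<open>(Sup Q)^2\<close>, also for cells touching the origin.\<close>

definition cell_weight :: "real \<Rightarrow> real set \<Rightarrow> real" where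
  "cell_weight lam Q = 1 / ((interval_length Q)\<^sup>2 * ((Sup Q)\<^sup>2) powr lam)"

definition dyadic_kernel :: "real \<Rightarrow> real set set \<Rightarrow> real \<times> real \<Rightarrow> real \<Rightarrow> real" where
  "dyadic_kernel lam D p y = (\<Sum>Q\<in>D. cell_weight lam Q * (indicator (carleson_box Q) p * indicator Q y))"

lemma cell_weight_nonneg: "0 \<le> cell_weight lam Q"
  by (simp add: cell_weight_def)

lemma interval_length_mono:
  assumes "pos_interval Q" "pos_interval R" "Q \<subseteq> R"
  shows "interval_length Q \<le> interval_length R"
proof -
  have "bdd_above R" "bdd_below R" "Q \<noteq> {}"
    using assms by (auto simp: pos_interval_def bounded_imp_bdd_above bounded_imp_bdd_below)
  then have "Sup Q \<le> Sup R" "Inf R \<le> Inf Q"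
    using assms(3) by (auto intro!: cSup_subset_mono cInf_superset_mono)
  then show ?thesis by (simp add: interval_length_def)
qed

text \<open>The cells that contribute all contain \<open>x\<close>, so they sit at distinct levels,
  and their lengths are at least \<open>max \<bar>x - y\<bar> t\<close>. The sum of their weights is
  therefore geometric and governed by the smallest of them.\<close>

lemma dyadic_kernel_le_model:
  assumes lam: "0 < lam" and pos: "0 < x" "0 < y" "0 < t" and D: "D \<subseteq> grid j m"
  shows "dyadic_kernel lam D (x, t) y \<le> 36 * 3 powr lam * model_kernel lam t x y"
proof -
  define d where "d = max \<bar>x - y\<bar> t"
  define s where "s = x\<^sup>2 + y\<^sup>2 + t\<^sup>2"
  have d: "0 < d" "t \<le> d" "\<bar>x - y\<bar> \<le> d" using pos by (auto simp: d_def)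
  have s: "0 < s" using pos by (simp add: s_def add_pos_pos)
  define Z where "Z = {Q\<in>D. (x, t) \<in> carleson_box Q \<and> y \<in> Q}"
  have finD: "finite D" using D finite_grid finite_subset by blast
  then have finZ: "finite Z" by (simp add: Z_def)
  have "\<exists>n. Q = cell j n (grid_index j n x)" if "Q \<in> Z" for Q
  proof -
    have "Q \<in> grid j m" "x \<in> Q" using that D by (auto simp: Z_def carleson_box_def)
    then show ?thesis by (auto simp: grid_def cell_def)
  qed
  then obtain n where n: "\<And>Q. Q \<in> Z \<Longrightarrow> Q = cell j (n Q) (grid_index j (n Q) x)"
    by metis
  have inj: "inj_on (\<lambda>Q. - n Q) Z" using n by (intro inj_onI) (metis neg_equal_iff_equal)
  have len: "d \<le> interval_length Q" "interval_length Q \<le> 2 powr n Q" "2 powr n Q / 3 \<le> interval_length Q"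
      "s \<le> 3 * (Sup Q)\<^sup>2"
    if "Q \<in> Z" for Q
  proof -
    have mem: "x \<in> Q" "y \<in> Q" "t \<le> interval_length Q" and g: "Q \<in> grid j m"
      using that D by (auto simp: Z_def carleson_box_def)
    have ne: "Q \<noteq> {}" using mem by auto
    show "interval_length Q \<le> 2 powr n Q" "2 powr n Q / 3 \<le> interval_length Q"
      using cell_geometry[of j "n Q" "grid_index j (n Q) x"] n[OF that] ne by auto
    have *: "Inf Q \<le> x" "x \<le> Sup Q" "Inf Q \<le> y" "y \<le> Sup Q" "0 \<le> Inf Q"
      using pos_interval_between[OF grid_memD(1)[OF g]] mem by auto
    then have "\<bar>x - y\<bar> \<le> interval_length Q" unfolding interval_length_def by (auto simp: abs_if)
    then show "d \<le> interval_length Q" using mem by (simp add: d_def)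
    have "t \<le> Sup Q" using mem(3) *(5) unfolding interval_length_def by linarith
    then have "x\<^sup>2 \<le> (Sup Q)\<^sup>2" "y\<^sup>2 \<le> (Sup Q)\<^sup>2" "t\<^sup>2 \<le> (Sup Q)\<^sup>2"
      using * pos by (auto intro!: power_mono)
    then show "s \<le> 3 * (Sup Q)\<^sup>2" by (simp add: s_def)
  qed
  have w: "cell_weight lam Q \<le> 9 * 3 powr lam / (d * s powr lam) * 2 powr (- n Q)" if "Q \<in> Z" for Q
  proof -
    note l = len[OF that]
    have "s powr lam \<le> (3 * (Sup Q)\<^sup>2) powr lam" using l(4) s lam by (intro powr_mono2) auto
    also have "\<dots> = 3 powr lam * ((Sup Q)\<^sup>2) powr lam" by (simp add: powr_mult)
    finally have a: "s powr lam / 3 powr lam \<le> ((Sup Q)\<^sup>2) powr lam" by (simp add: field_simps)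
    \<comment> \<open>Of the two factors of length only one is replaced by \<open>d\<close>; the
      other stays and makes the sum over the levels geometric.\<close>
    have "(d * 2 powr n Q) / 9 \<le> (2 powr n Q / 3)\<^sup>2"
      using l(1,2) by (simp add: power2_eq_square)
    also have "\<dots> \<le> (interval_length Q)\<^sup>2" using l(3) by (intro power_mono) auto
    finally have b: "(d * 2 powr n Q) / 9 \<le> (interval_length Q)\<^sup>2" .
    have "cell_weight lam Q \<le> 1 / ((d * 2 powr n Q) / 9 * (s powr lam / 3 powr lam))"
    proof -
      have "0 < (d * 2 powr n Q) / 9" "0 < s powr lam / 3 powr lam" using d s by auto
      then show ?thesis unfolding cell_weight_def using a b
        by (intro divide_left_mono mult_mono mult_pos_pos) (linarith | simp)+
    qed
    also have "\<dots> = 9 * 3 powr lam / (d * s powr lam) * 2 powr (- n Q)"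
      by (simp add: powr_minus field_simps)
    finally show ?thesis .
  qed
  have "dyadic_kernel lam D (x, t) y = (\<Sum>Q\<in>Z. cell_weight lam Q)"
    unfolding dyadic_kernel_def Z_def
    by (subst sum.inter_filter[OF finD], intro sum.cong) (auto simp: indicator_def)
  also have "\<dots> \<le> (\<Sum>Q\<in>Z. 9 * 3 powr lam / (d * s powr lam) * 2 powr (- n Q))"
    using w by (intro sum_mono) auto
  also have "\<dots> = 9 * 3 powr lam / (d * s powr lam) * (\<Sum>z\<in>(\<lambda>Q. - n Q) ` Z. 2 powr z)"
    by (simp add: sum.reindex[OF inj] sum_distrib_left)
  also have "\<dots> \<le> 9 * 3 powr lam / (d * s powr lam) * (2 / d)"
  proof (intro mult_left_mono)
    show "(\<Sum>z\<in>(\<lambda>Q. - n Q) ` Z. 2 powr z) \<le> 2 / d"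
    proof (cases "Z = {}")
      case False
      define M where "M = Max ((\<lambda>Q. - n Q) ` Z)"
      have "M \<in> (\<lambda>Q. - n Q) ` Z" unfolding M_def using False finZ by (intro Max_in) auto
      then obtain Q where Q: "Q \<in> Z" "M = - n Q" by auto
      have "(\<Sum>z\<in>(\<lambda>Q. - n Q) ` Z. 2 powr z) \<le> 2 * 2 powr M"
        using finZ by (intro sum_distinct_powers_of_two_le) (auto simp: M_def)
      also have "2 powr M = 1 / 2 powr n Q" by (simp add: Q powr_minus field_simps)
      also have "1 / 2 powr n Q \<le> 1 / d" using len[OF Q(1)] d by (intro divide_left_mono) auto
      finally show ?thesis by simp
    qed (use d in simp)
  qed (use d in auto)
  also have "\<dots> = 18 * 3 powr lam / (d\<^sup>2 * s powr lam)" by (simp add: power2_eq_square)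
  also have "\<dots> \<le> 18 * 3 powr lam / (((x - y)\<^sup>2 + t\<^sup>2) / 2 * s powr lam)"
  proof -
    have "(x - y)\<^sup>2 \<le> d\<^sup>2" "t\<^sup>2 \<le> d\<^sup>2" using d pos by (auto simp: abs_le_square_iff[symmetric])
    then have "((x - y)\<^sup>2 + t\<^sup>2) / 2 \<le> d\<^sup>2" by simp
    moreover have "0 < (x - y)\<^sup>2 + t\<^sup>2" using pos by (intro add_nonneg_pos) auto
    ultimately show ?thesis using s d by (intro divide_left_mono mult_right_mono mult_pos_pos) auto
  qed
  also have "\<dots> = 36 * 3 powr lam * model_kernel lam t x y"
    by (simp add: model_kernel_def s_def)
  finally show ?thesis .
qed

text \<open>One-third trick. After division by \<open>2 powr n\<close>, if both grids separated the
  points, then an integer and an integer shifted by 1/3 or -1/3 would both lie in an interval of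
  length less than 1/3. Such numbers are at least 1/3 apart.\<close>

lemma adjacent_points_share_cell:
  assumes "\<bar>x - y\<bar> < 2 powr n / 3"
  shows "grid_index False n x = grid_index False n y \<or> grid_index True n x = grid_index True n y"
proof -
  have *: "grid_index False n x = grid_index False n y \<or> grid_index True n x = grid_index True n y"
    if "x \<le> y" "y - x < 2 powr n / 3" for x y
  proof (rule ccontr)
    assume c: "\<not> ?thesis"
    define u where "u = x / 2 powr n"
    define v where "v = y / 2 powr n"
    define s where "s = grid_shift True n"
    have uv: "u \<le> v" "v - u < 1/3" using that by (auto simp: u_def v_def field_simps)
    have "\<lfloor>u\<rfloor> \<le> \<lfloor>v\<rfloor>" "\<lfloor>u\<rfloor> \<noteq> \<lfloor>v\<rfloor>" using c uv by (auto simp: grid_index_def grid_shift_def u_def v_def intro: floor_mono)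
    then have 1: "u < \<lfloor>v\<rfloor>" "\<lfloor>v\<rfloor> \<le> v" by linarith+
    have "\<lfloor>u - s\<rfloor> \<le> \<lfloor>v - s\<rfloor>" "\<lfloor>u - s\<rfloor> \<noteq> \<lfloor>v - s\<rfloor>" using c uv by (auto simp: grid_index_def s_def u_def v_def intro: floor_mono)
    then have 2: "u < \<lfloor>v - s\<rfloor> + s" "\<lfloor>v - s\<rfloor> + s \<le> v" by linarith+
    define q where "q = \<lfloor>v\<rfloor> - \<lfloor>v - s\<rfloor>"
    have "real_of_int q - s < 1/3" "- (real_of_int q - s) < 1/3"
      unfolding q_def of_int_diff using 1 2 uv by linarith+
    then have "\<bar>real_of_int q - s\<bar> < 1/3" by linarith
    have "s = 1/3 \<or> s = -1/3" by (simp add: s_def grid_shift_def)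
    then show False
    proof (elim disjE)
      assume "s = 1/3"
      then have "0 < q" "q < 1" using \<open>\<bar>real_of_int q - s\<bar> < 1/3\<close> by (auto simp: abs_if split: if_splits)
      then show False by simp
    next
      assume "s = -1/3"
      then have "-1 < q" "q < 0" using \<open>\<bar>real_of_int q - s\<bar> < 1/3\<close> by (auto simp: abs_if split: if_splits)
      then show False by simp
    qed
  qed
  show ?thesis using *[of x y] *[of y x] assms by (cases "x \<le> y") auto
qed

text \<open>A single cell suffices: at a level comparable to \<open>max \<bar>x - y\<bar> t\<close>,
  one of the two grids has a cell containing both \<open>x\<close> and \<open>y\<close>. Which grid
  it is depends on the points, hence the sum of both kernels.\<close>

lemma model_le_dyadic_kernel:
  assumes lam: "0 < lam" and pos: "0 < x" "0 < y" "0 < t"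
  shows "\<exists>m0. \<forall>m\<ge>m0. model_kernel lam t x y
    \<le> 36 * 74 powr lam * (dyadic_kernel lam (grid False m) (x, t) y + dyadic_kernel lam (grid True m) (x, t) y)"
proof -
  define d where "d = max \<bar>x - y\<bar> t"
  define s where "s = x\<^sup>2 + y\<^sup>2 + t\<^sup>2"
  define e where "e = (x - y)\<^sup>2 + t\<^sup>2"
  have d: "0 < d" "t \<le> d" "\<bar>x - y\<bar> \<le> d" using pos by (auto simp: d_def)
  have s: "0 < s" using pos by (simp add: s_def add_pos_pos)
  have e: "0 < e" using pos unfolding e_def by (intro add_nonneg_pos) auto
  have de: "d\<^sup>2 \<le> e" unfolding d_def e_def by (simp add: max_def)
  have es: "e \<le> s" using pos by (simp add: e_def s_def power2_eq_square algebra_simps)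
  \<comment> \<open>The level satisfies \<open>3 * d < 2 powr n\<close> and
    \<open>2 powr n \<le> 6 * d\<close>. The first bound makes the one-third trick applicable and,
    as a cell is at least \<open>2 powr n / 3\<close> long, puts \<open>t\<close> below the top of
    the box. The second gives length at most \<open>6 * d\<close> and
    \<open>Sup Q \<le> x + 6 * d\<close>, whence the constants 36 and 74.\<close>
  define n where "n = \<lfloor>log 2 (3 * d)\<rfloor> + 1"
  have "3 * d = 2 powr (log 2 (3 * d))" using d by simp
  also have "\<dots> < 2 powr n" unfolding n_def by (intro powr_less_mono) linarith+
  finally have n1: "3 * d < 2 powr n" .
  have "(2::real) powr n = 2 * 2 powr \<lfloor>log 2 (3 * d)\<rfloor>" by (simp add: n_def powr_add)
  also have "2 powr \<lfloor>log 2 (3 * d)\<rfloor> \<le> 2 powr (log 2 (3 * d))" by (intro powr_mono) linarith+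
  also have "2 powr (log 2 (3 * d)) = 3 * d" using d by simp
  finally have n2: "2 powr n \<le> 6 * d" by simp
  obtain j where j: "grid_index j n x = grid_index j n y"
    using adjacent_points_share_cell[of x y n] n1 d by force
  define k where "k = grid_index j n x"
  define Q where "Q = cell j n k"
  have xy: "x \<in> Q" "y \<in> Q" using pos j by (auto simp: Q_def cell_def k_def)
  then have ne: "Q \<noteq> {}" by auto
  have len: "2 powr n / 3 \<le> interval_length Q" "interval_length Q \<le> 2 powr n" and pI: "pos_interval Q"
    using cell_geometry[of j n k] ne by (auto simp: Q_def)
  have tb: "(x, t) \<in> carleson_box Q" using xy pos len n1 d by (auto simp: carleson_box_def)
  have R: "0 < Sup Q" "Sup Q \<le> x + 6 * d"
    using pos_interval_between[OF pI] xy pos len n2 unfolding interval_length_def by force+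
  have "(Sup Q)\<^sup>2 \<le> (x + 6 * d)\<^sup>2" using R by (intro power_mono) auto
  also have "\<dots> \<le> 2 * x\<^sup>2 + 72 * d\<^sup>2"
    using zero_le_power2[of "x - 6 * d"] by (simp add: power2_eq_square algebra_simps)
  also have "\<dots> \<le> 74 * s"
  proof -
    have "x\<^sup>2 \<le> s" by (simp add: s_def)
    then show ?thesis using de es by linarith
  qed
  finally have "((Sup Q)\<^sup>2) powr lam \<le> (74 * s) powr lam" using lam by (intro powr_mono2) auto
  then have Rp: "((Sup Q)\<^sup>2) powr lam \<le> 74 powr lam * s powr lam" by (simp add: powr_mult)
  have "(interval_length Q)\<^sup>2 \<le> (6 * d)\<^sup>2" using len n2 n1 d by (intro power_mono) linarith+
  also have "\<dots> \<le> 36 * e" using de by (simp add: power_mult_distrib)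
  finally have lp: "(interval_length Q)\<^sup>2 \<le> 36 * e" .
  have lpos: "0 < interval_length Q" using len n1 d by linarith
  have "1 / (36 * e * (74 powr lam * s powr lam)) \<le> cell_weight lam Q"
    unfolding cell_weight_def using Rp lp R lpos e s
    by (intro divide_left_mono mult_mono mult_pos_pos) auto
  then have main: "model_kernel lam t x y \<le> 36 * 74 powr lam * cell_weight lam Q"
    using e s unfolding model_kernel_def e_def[symmetric] s_def[symmetric] by (simp add: field_simps)
  have "model_kernel lam t x y
    \<le> 36 * 74 powr lam * (dyadic_kernel lam (grid False m) (x, t) y + dyadic_kernel lam (grid True m) (x, t) y)"
    if m: "nat (max \<bar>n\<bar> \<bar>k\<bar>) \<le> m" for m
  proof -
    have "\<bar>n\<bar> \<le> int m" "\<bar>k\<bar> \<le> int m" using m by linarith+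
    then have "Q \<in> grid j m" using ne unfolding grid_def Q_def by blast
    then have "cell_weight lam Q * (indicator (carleson_box Q) (x, t) * indicator Q y) \<le> dyadic_kernel lam (grid j m) (x, t) y"
      unfolding dyadic_kernel_def using finite_grid cell_weight_nonneg
      by (intro member_le_sum) auto
    then have "cell_weight lam Q \<le> dyadic_kernel lam (grid j m) (x, t) y" using tb xy by simp
    moreover have "0 \<le> dyadic_kernel lam (grid i m) (x, t) y" for i
      unfolding dyadic_kernel_def using cell_weight_nonneg by (intro sum_nonneg) auto
    ultimately have "cell_weight lam Q \<le> dyadic_kernel lam (grid False m) (x, t) y + dyadic_kernel lam (grid True m) (x, t) y"
      by (cases j) (smt (verit))+
    then show ?thesis using main by (smt (verit) mult_left_mono powr_ge_zero)
  qed
  then show ?thesis by blast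
qed

section \<open>From testing to the two-weight inequality\<close>

lemma borel_measure_on_space: "borel_measure_on S M \<Longrightarrow> space M = S"
  unfolding borel_measure_on_def by (drule sets_eq_imp_space_eq) (simp add: space_restrict_space)

lemma borel_measure_on_measurable:
  assumes "borel_measure_on S M" "f \<in> measurable borel N"
  shows "f \<in> measurable M N"
  using measurable_restrict_space1[OF assms(2), of S] assms(1)
  unfolding borel_measure_on_def by (simp cong: measurable_cong_sets)

lemma borel_measure_on_sets:
  assumes "borel_measure_on S M" "S \<in> sets borel" "E \<in> sets borel" "E \<subseteq> S"
  shows "E \<in> sets M"
  using assms unfolding borel_measure_on_def by (auto simp: sets_restrict_space_iff)

lemma ennreal_SUP_square_le:
  fixes h :: "nat \<Rightarrow> ennreal"
  assumes "incseq h"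
  shows "(SUP m. h m)\<^sup>2 \<le> (SUP m. (h m)\<^sup>2)"
proof -
  have "(SUP m. h m)\<^sup>2 = (SUP i. SUP j. h i * h j)"
    by (subst SUP_commute) (simp add: power2_eq_square SUP_mult_left_ennreal SUP_mult_right_ennreal)
  also have "\<dots> \<le> (SUP m. (h m)\<^sup>2)"
  proof (intro SUP_least)
    fix i j
    have "h i * h j \<le> h (max i j) * h (max i j)"
      using assms by (intro mult_mono) (auto simp: incseq_def)
    also have "\<dots> \<le> (SUP m. (h m)\<^sup>2)" unfolding power2_eq_square[symmetric] by (intro SUP_upper) auto
    finally show "h i * h j \<le> (SUP m. (h m)\<^sup>2)" .
  qed
  finally show ?thesis .
qed

lemma half_line_exhaustion: "(\<Union>n. {1 / real (Suc n)..real (Suc n)}) = pos_half_line"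
proof (intro equalityI subsetI)
  fix x :: real assume "x \<in> pos_half_line"
  then have x: "0 < x" by simp
  obtain n1 where n1: "1 / real (Suc n1) < x" using x by (metis nat_approx_posE)
  obtain n2 where n2: "x \<le> real n2" using real_arch_simple by blast
  let ?n = "max n1 n2"
  have "1 / real (Suc ?n) \<le> 1 / real (Suc n1)" by (intro divide_left_mono) auto
  then have "x \<in> {1 / real (Suc ?n)..real (Suc ?n)}" using n1 n2 by auto
  then show "x \<in> (\<Union>n. {1 / real (Suc n)..real (Suc n)})" by blast
qed (auto intro: less_le_trans[rotated])

text \<open>The comparison constants are parameters, chosen from \<open>lam\<close> before the
  measures are fixed; this keeps every constant built from them independent of
  \<open>\<sigma>\<close> and \<open>\<mu>\<close>.\<close>

locale weight_pair =
  fixes lam :: real and \<sigma> :: "real measure" and \<mu> :: "(real \<times> real) measure"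
    and c0 c1 :: real
  assumes lam: "0 < lam"
    and c0: "0 < c0" and c1: "0 < c1"
    and kernel_lower: "\<And>t x y. 0 < t \<Longrightarrow> 0 \<le> x \<Longrightarrow> 0 \<le> y \<Longrightarrow>
      c0 * t * model_kernel lam t x y \<le> bessel_poisson_kernel lam t x y"
    and kernel_upper: "\<And>t x y. 0 < t \<Longrightarrow> 0 \<le> x \<Longrightarrow> 0 \<le> y \<Longrightarrow>
      bessel_poisson_kernel lam t x y \<le> c1 * t * model_kernel lam t x y"
    and sigma_borel: "borel_measure_on pos_half_line \<sigma>"
    and sigma_fin: "finite_on_compacts \<sigma>"
    and mu_borel: "borel_measure_on pos_quadrant \<mu>"
begin

abbreviation "ker \<equiv> bessel_poisson_kernel lam"

lemmas space_sigma = borel_measure_on_space[OF sigma_borel]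
lemmas space_mu = borel_measure_on_space[OF mu_borel]
lemmas measurable_sigma = borel_measure_on_measurable[OF sigma_borel]
lemmas measurable_mu = borel_measure_on_measurable[OF mu_borel]

lemma sets_sigma: "E \<in> sets borel \<Longrightarrow> E \<subseteq> pos_half_line \<Longrightarrow> E \<in> sets \<sigma>"
  by (rule borel_measure_on_sets[OF sigma_borel]) auto

lemma sets_mu: "E \<in> sets borel \<Longrightarrow> E \<subseteq> pos_quadrant \<Longrightarrow> E \<in> sets \<mu>"
proof (rule borel_measure_on_sets[OF mu_borel])
  have "open (pos_quadrant :: (real \<times> real) set)" by (intro open_Times) auto
  then show "pos_quadrant \<in> sets (borel :: (real \<times> real) measure)" by (rule borel_open)
qed

lemma emeasure_compact_interval:
  assumes "0 < a"
  shows "emeasure \<sigma> {a..b} < \<infinity>"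
proof -
  have "{a..b} \<subseteq> pos_half_line" using assms by auto
  then show ?thesis using sigma_fin unfolding finite_on_compacts_def space_sigma by blast
qed

lemma coordinates_measurable [measurable]:
  "fst \<in> borel_measurable \<mu>" "snd \<in> borel_measurable \<mu>" "(\<lambda>y. y) \<in> borel_measurable \<sigma>"
  by (auto intro!: measurable_mu measurable_sigma simp: borel_prod[symmetric])

sublocale sigma: sigma_finite_measure \<sigma>
proof
  let ?A = "range (\<lambda>n::nat. {1 / real (Suc n)..real (Suc n)})"
  have "?A \<subseteq> sets \<sigma>" by (auto intro!: sets_sigma intro: less_le_trans[rotated])
  moreover have "\<forall>a\<in>?A. emeasure \<sigma> a \<noteq> \<infinity>"
    using emeasure_compact_interval by (auto simp: less_top[symmetric])
  ultimately show "\<exists>A. countable A \<and> A \<subseteq> sets \<sigma> \<and> \<Union>A = space \<sigma> \<and> (\<forall>a\<in>A. emeasure \<sigma> a \<noteq> \<infinity>)"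
    using half_line_exhaustion by (intro exI[of _ ?A]) (auto simp: space_sigma)
qed

definition nu :: "(real \<times> real) measure" where
  "nu = density \<mu> (\<lambda>p. ennreal ((snd p)\<^sup>2))"

lemma sets_nu [measurable_cong]: "sets nu = sets \<mu>" and space_nu: "space nu = pos_quadrant"
  by (simp_all add: nu_def space_mu)

lemma nn_integral_nu:
  "h \<in> borel_measurable \<mu> \<Longrightarrow> (\<integral>\<^sup>+ p. h p \<partial>nu) = (\<integral>\<^sup>+ p. ennreal ((snd p)\<^sup>2) * h p \<partial>\<mu>)"
  unfolding nu_def by (subst nn_integral_density) auto

lemma kernel_pair_measurable [measurable]:
  "(\<lambda>z. ker (snd (fst z)) (fst (fst z)) (snd z)) \<in> borel_measurable (\<mu> \<Otimes>\<^sub>M \<sigma>)"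
proof -
  have "(\<lambda>z. snd z) \<in> borel_measurable (\<mu> \<Otimes>\<^sub>M \<sigma>)"
    using measurable_compose[OF measurable_snd coordinates_measurable(3)] by simp
  then show ?thesis by measurable
qed

lemma nn_poisson_op_eq:
  "nn_poisson_op lam \<sigma> f p = (\<integral>\<^sup>+ y. ennreal (ker (snd p) (fst p) y) * f y \<partial>\<sigma>)"
  by (simp add: nn_poisson_op_def split: prod.split)

lemma nn_poisson_op_measurable [measurable]:
  assumes [measurable]: "f \<in> borel_measurable \<sigma>"
  shows "nn_poisson_op lam \<sigma> f \<in> borel_measurable \<mu>"
proof -
  have "(\<lambda>p. \<integral>\<^sup>+ y. ennreal (ker (snd p) (fst p) y) * f y \<partial>\<sigma>) \<in> borel_measurable \<mu>"
    using kernel_pair_measurable by (intro sigma.borel_measurable_nn_integral) (simp add: case_prod_beta', measurable)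
  then show ?thesis unfolding nn_poisson_op_eq[abs_def] .
qed

definition square_box :: "real \<Rightarrow> (real \<times> real) set" where
  "square_box b = {0<..b} \<times> {0<..b}"

lemma square_box_sets [measurable]: "square_box b \<in> sets \<mu>" "square_box b \<in> sets nu"
proof -
  have "square_box b \<in> sets (borel :: (real \<times> real) measure)"
    unfolding square_box_def borel_prod[symmetric] by (intro pair_measureI) auto
  then show "square_box b \<in> sets \<mu>" by (rule sets_mu) (auto simp: square_box_def)
  then show "square_box b \<in> sets nu" by (simp add: sets_nu)
qed

end

section \<open>Finiteness of the measures forced by testing\<close>

lemma triple_geometry:
  assumes "pos_interval I" "0 < interval_length I"
  shows "I \<subseteq> triple I" and "interval_length I \<le> interval_length (triple I)"
proof -
  define l where "l = Inf I"
  define r where "r = Sup I"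
  have lr: "0 \<le> l" "l < r" "I \<subseteq> {l..r}"
    using pos_interval_between[OF assms(1)] assms(2) by (auto simp: l_def r_def interval_length_def)
  have tr: "triple I = {2 * l - r<..<2 * r - l} \<inter> {0<..}"
  proof -
    have "(l + r) / 2 - 3 * (r - l) / 2 = 2 * l - r" "(l + r) / 2 + 3 * (r - l) / 2 = 2 * r - l"
      by (simp_all add: field_simps)
    then show ?thesis
      unfolding triple_def interval_center_def interval_length_def l_def[symmetric] r_def[symmetric] by simp
  qed
  also have "\<dots> = {max 0 (2 * l - r)<..<2 * r - l}" by auto
  finally have tr': "triple I = {max 0 (2 * l - r)<..<2 * r - l}" .
  have "max 0 (2 * l - r) < 2 * r - l" using lr by auto
  then have len: "interval_length (triple I) = 2 * r - l - max 0 (2 * l - r)"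
    unfolding interval_length_def tr' by simp
  show "interval_length I \<le> interval_length (triple I)"
    unfolding len using lr by (auto simp: interval_length_def l_def r_def max_def)
  show "I \<subseteq> triple I" unfolding tr
  proof
    fix x assume x: "x \<in> I"
    then have "l \<le> x" "x \<le> r" using lr by auto
    moreover have "0 < x" using x assms(1) by (auto simp: pos_interval_def)
    ultimately show "x \<in> {2 * l - r<..<2 * r - l} \<inter> {0<..}" using lr by auto
  qed
qed

lemma carleson_box_subset_tent_triple:
  assumes "pos_interval I" "0 < interval_length I"
  shows "carleson_box I \<subseteq> tent (triple I)"
  using triple_geometry[OF assms] by (auto simp: carleson_box_def tent_def)

context weight_pair
begin

text \<open>Testing on \<open>[a, b]\<close> with \<open>a\<close> small: the tent over its triple contains the square
  \<open>(0, b]\<^sup>2\<close>, where the kernel is bounded below by a multiple of \<open>t\<close>.\<close>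

lemma forward_testing_mass_bound:
  assumes fwd: "forward_testing lam \<sigma> \<mu> F" and a: "0 < a" "2 * a < b"
  shows "ennreal ((c0 / (2 * b\<^sup>2 * (3 * b\<^sup>2) powr lam))\<^sup>2) * (emeasure \<sigma> {a..b} * emeasure nu (square_box b)) \<le> ennreal (F\<^sup>2)
        \<or> emeasure \<sigma> {a..b} = 0"
proof (rule disjCI)
  assume pos: "emeasure \<sigma> {a..b} \<noteq> 0"
  define k where "k = c0 / (2 * b\<^sup>2 * (3 * b\<^sup>2) powr lam)"
  define s where "s = emeasure \<sigma> {a..b}"
  have b: "0 < b" using a by simp
  have k: "0 < k" using b c0 by (simp add: k_def)
  have I: "pos_interval {a..b}" using a by (auto simp: pos_interval_def is_interval_1)
  have SI: "Sup {a..b} = b" "Inf {a..b} = a" using a by auto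
  \<comment> \<open>As \<open>2 * a < b\<close>, the left end \<open>2 * a - b\<close> of the
    untruncated triple is negative, so the truncated triple starts at 0. It has length
    \<open>2 * b - a\<close>, which exceeds \<open>b\<close>.\<close>
  have tr: "triple {a..b} = {0<..<2 * b - a}"
    unfolding triple_def interval_center_def interval_length_def SI using a by (auto simp: field_simps)
  have len: "interval_length (triple {a..b}) = 2 * b - a"
    unfolding tr interval_length_def using a by simp
  have sub: "square_box b \<subseteq> tent (triple {a..b})"
    unfolding tent_def len unfolding tr square_box_def using a by auto
  have low: "ennreal (k * t) * s \<le> nn_poisson_op lam \<sigma> (indicator {a..b}) (x, t)"
    if xt: "(x, t) \<in> square_box b" for x t
  proof -
    have x: "0 < x" "x \<le> b" and t: "0 < t" "t \<le> b" using xt by (auto simp: square_box_def)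
    have Ks: "k * t \<le> ker t x y" if y: "y \<in> {a..b}" for y
    proof -
      have y0: "0 < y" "y \<le> b" using y a by auto
      have sq: "x\<^sup>2 \<le> b\<^sup>2" "y\<^sup>2 \<le> b\<^sup>2" "t\<^sup>2 \<le> b\<^sup>2" using x t y0 by (auto intro!: power_mono)
      have "(x - y)\<^sup>2 \<le> b\<^sup>2" using x y0 by (auto simp: abs_le_square_iff[symmetric])
      then have d: "(x - y)\<^sup>2 + t\<^sup>2 \<le> 2 * b\<^sup>2" using sq by simp
      have d0: "0 < (x - y)\<^sup>2 + t\<^sup>2" using t by (intro add_nonneg_pos) auto
      have s0: "0 < x\<^sup>2 + y\<^sup>2 + t\<^sup>2" using t by (intro add_nonneg_pos) auto
      have "(x\<^sup>2 + y\<^sup>2 + t\<^sup>2) powr lam \<le> (3 * b\<^sup>2) powr lam"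
        using sq lam s0 by (intro powr_mono2) auto
      then have "1 / (2 * b\<^sup>2 * (3 * b\<^sup>2) powr lam) \<le> model_kernel lam t x y"
        unfolding model_kernel_def using d d0 s0 b
        by (intro divide_left_mono mult_mono mult_pos_pos) auto
      then have "c0 * t * (1 / (2 * b\<^sup>2 * (3 * b\<^sup>2) powr lam)) \<le> c0 * t * model_kernel lam t x y"
        using c0 t by (intro mult_left_mono) auto
      also have "\<dots> \<le> ker t x y" using kernel_lower x t y0 by auto
      finally show ?thesis by (simp add: k_def mult_ac)
    qed
    have "ennreal (k * t) * s = (\<integral>\<^sup>+ y. ennreal (k * t) * indicator {a..b} y \<partial>\<sigma>)"
      unfolding s_def using a by (subst nn_integral_cmult_indicator) (auto intro!: sets_sigma)
    also have "\<dots> \<le> (\<integral>\<^sup>+ y. ennreal (ker t x y) * indicator {a..b} y \<partial>\<sigma>)"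
      using Ks by (intro nn_integral_mono) (auto simp: indicator_def intro!: ennreal_leI)
    finally show ?thesis by (simp add: nn_poisson_op_def)
  qed
  have "ennreal (k\<^sup>2) * (s * emeasure nu (square_box b)) * s
      = ennreal (k\<^sup>2) * s\<^sup>2 * (\<integral>\<^sup>+ p. ennreal ((snd p)\<^sup>2) * indicator (square_box b) p \<partial>\<mu>)"
    unfolding nu_def using square_box_sets(1) by (subst emeasure_density) (auto simp: power2_eq_square mult_ac)
  also have "\<dots> = (\<integral>\<^sup>+ p. ennreal (k\<^sup>2) * s\<^sup>2 * (ennreal ((snd p)\<^sup>2) * indicator (square_box b) p) \<partial>\<mu>)"
    by (subst nn_integral_cmult) auto
  also have "\<dots> \<le> (\<integral>\<^sup>+ p. (nn_poisson_op lam \<sigma> (indicator {a..b}) p)\<^sup>2 * indicator (tent (triple {a..b})) p \<partial>\<mu>)"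
  proof (intro nn_integral_mono)
    fix p :: "real \<times> real"
    obtain x t where p: "p = (x, t)" by force
    show "ennreal (k\<^sup>2) * s\<^sup>2 * (ennreal ((snd p)\<^sup>2) * indicator (square_box b) p)
      \<le> (nn_poisson_op lam \<sigma> (indicator {a..b}) p)\<^sup>2 * indicator (tent (triple {a..b})) p"
    proof (cases "p \<in> square_box b")
      case True
      then have t: "0 < t" by (auto simp: p square_box_def)
      have "ennreal (k\<^sup>2) * s\<^sup>2 * ennreal (t\<^sup>2) = (ennreal (k * t) * s)\<^sup>2"
        using k t by (simp add: power_mult_distrib ennreal_mult' ennreal_power[symmetric] mult_ac)
      also have "\<dots> \<le> (nn_poisson_op lam \<sigma> (indicator {a..b}) p)\<^sup>2"
        using low True unfolding p by (intro power_mono) auto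
      finally show ?thesis using True sub by (auto simp: p)
    qed simp
  qed
  also have "\<dots> \<le> ennreal (F\<^sup>2) * s"
    using fwd I unfolding forward_testing_def s_def by blast
  finally have "ennreal (k\<^sup>2) * (s * emeasure nu (square_box b)) * s \<le> ennreal (F\<^sup>2) * s" .
  \<comment> \<open>The factor \<open>s\<close> occurs twice on the left and once on the right. It
    is nonzero, and finite because \<open>{a..b}\<close> is compact in the open half line, so one
    copy cancels.\<close>
  moreover have "s \<noteq> 0" "s < \<infinity>" using pos emeasure_compact_interval a by (auto simp: s_def)
  ultimately show "ennreal ((c0 / (2 * b\<^sup>2 * (3 * b\<^sup>2) powr lam))\<^sup>2) * (emeasure \<sigma> {a..b} * emeasure nu (square_box b)) \<le> ennreal (F\<^sup>2)"
    unfolding k_def[symmetric] s_def[symmetric]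
    by (subst (asm) (1 2) mult.commute) (auto simp: ennreal_mult_le_mult_iff)
qed

lemma quadrant_exhaustion: "(\<Union>n. square_box (real n)) = pos_quadrant"
proof (intro equalityI subsetI)
  fix p :: "real \<times> real" assume "p \<in> pos_quadrant"
  moreover obtain n where "max (fst p) (snd p) \<le> real n" using real_arch_simple by blast
  ultimately show "p \<in> (\<Union>n. square_box (real n))" by (auto simp: square_box_def)
qed (auto simp: square_box_def)

lemma square_box_mono: "b \<le> b' \<Longrightarrow> square_box b \<subseteq> square_box b'"
  by (auto simp: square_box_def)

text \<open>Some compact interval is charged by \<open>\<sigma>\<close>. After enlarging it to the
  right, \<open>forward_testing_mass_bound\<close> bounds a product with a nonzero factor, so the
  other factor, the mass of a larger square, is finite.\<close>

lemma nu_finite: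
  assumes fwd: "forward_testing lam \<sigma> \<mu> F" and nz: "emeasure \<sigma> (space \<sigma>) \<noteq> 0"
  shows "emeasure nu (square_box b) < \<infinity>"
proof -
  have "\<exists>n. emeasure \<sigma> {1 / real (Suc n)..real (Suc n)} \<noteq> 0"
  proof (rule ccontr)
    assume "\<not> ?thesis"
    then have "(\<Union>n. {1 / real (Suc n)..real (Suc n)}) \<in> null_sets \<sigma>"
      by (intro null_sets_UN) (auto simp: null_sets_def intro!: sets_sigma intro: less_le_trans[rotated])
    then show False using nz unfolding half_line_exhaustion space_sigma by auto
  qed
  then obtain n where n: "emeasure \<sigma> {1 / real (Suc n)..real (Suc n)} \<noteq> 0" by blast
  define a where "a = 1 / real (Suc n)"
  define c where "c = max b (max (real (Suc n)) (3 * a))"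
  have a: "0 < a" "2 * a < c" by (auto simp: a_def c_def)
  define k where "k = (c0 / (2 * c\<^sup>2 * (3 * c\<^sup>2) powr lam))\<^sup>2"
  have k: "0 < k" using a c0 by (simp add: k_def)
  have "emeasure \<sigma> {1 / real (Suc n)..real (Suc n)} \<le> emeasure \<sigma> {a..c}"
  proof (intro emeasure_mono sets_sigma)
    show "{a..c} \<subseteq> pos_half_line" using a by auto
  qed (auto simp: a_def c_def)
  then have nz': "emeasure \<sigma> {a..c} \<noteq> 0" using n by auto
  then have "ennreal k * (emeasure \<sigma> {a..c} * emeasure nu (square_box c)) \<le> ennreal (F\<^sup>2)"
    using forward_testing_mass_bound[OF fwd a] by (auto simp: k_def)
  then have "ennreal k * (emeasure \<sigma> {a..c} * emeasure nu (square_box c)) < \<infinity>"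
    by (rule le_less_trans) simp
  then have "emeasure nu (square_box c) < \<infinity>"
    using k nz' by (auto simp: ennreal_mult_less_top ennreal_mult_eq_top_iff less_top[symmetric])
  moreover have "emeasure nu (square_box b) \<le> emeasure nu (square_box c)"
    by (intro emeasure_mono square_box_mono) (auto simp: c_def)
  ultimately show ?thesis by (rule le_less_trans[rotated])
qed

text \<open>The constant in \<open>forward_testing_mass_bound\<close> depends on \<open>b\<close>
  but not on \<open>a\<close>, so the resulting bound for the mass of \<open>{a..b}\<close> persists
  as \<open>a\<close> tends to 0. Dividing requires positive mass of a square under
  \<open>nu\<close>; it exists because the density \<open>t^2\<close> is positive on the
  quadrant.\<close>

lemma sigma_finite_near_zero:
  assumes fwd: "forward_testing lam \<sigma> \<mu> F" and nz: "emeasure \<mu> (space \<mu>) \<noteq> 0"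
  shows "emeasure \<sigma> {0<..b} < \<infinity>"
proof -
  have "\<exists>n. emeasure nu (square_box (real n)) \<noteq> 0"
  proof (rule ccontr)
    assume "\<not> ?thesis"
    then have "(\<Union>n. square_box (real n)) \<in> null_sets nu"
      by (intro null_sets_UN) (auto simp: null_sets_def)
    then have "AE p in nu. p \<notin> pos_quadrant" unfolding quadrant_exhaustion by (rule AE_not_in)
    then have "AE p in \<mu>. 0 < ennreal ((snd p)\<^sup>2) \<longrightarrow> p \<notin> pos_quadrant"
      unfolding nu_def by (subst (asm) AE_density) auto
    then have "AE p in \<mu>. False"
      by (rule AE_mp) (intro AE_I2, auto simp: space_mu)
    then show False using nz by (simp add: eventually_False ae_filter_eq_bot_iff)
  qed
  then obtain n where n: "emeasure nu (square_box (real n)) \<noteq> 0" by blast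
  define c where "c = max b (max (real n) 1)"
  have c: "0 < c" by (auto simp: c_def)
  define k where "k = (c0 / (2 * c\<^sup>2 * (3 * c\<^sup>2) powr lam))\<^sup>2"
  have k: "0 < k" using c c0 by (simp add: k_def)
  have "emeasure nu (square_box (real n)) \<le> emeasure nu (square_box c)"
    by (intro emeasure_mono square_box_mono) (auto simp: c_def)
  then have nz': "emeasure nu (square_box c) \<noteq> 0" using n by auto
  \<comment> \<open>The mass of the square may still be infinite, so it is cut at 1 before being
    divided by.\<close>
  define e where "e = min 1 (emeasure nu (square_box c))"
  have "e \<le> 1" by (simp add: e_def)
  then have "e < \<infinity>" by (rule le_less_trans) simp
  moreover have "e \<noteq> 0" using nz' by (simp add: e_def min_def)
  ultimately have e: "e \<noteq> 0" "e < \<infinity>" by auto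
  \<comment> \<open>The summand 3 ensures \<open>2 * (c / real (i + 3)) < c\<close> already for
    \<open>i = 0\<close>.\<close>
  have bound: "emeasure \<sigma> {c / real (i + 3)..c} \<le> ennreal (F\<^sup>2) / (ennreal k * e)" for i :: nat
  proof (cases "emeasure \<sigma> {c / real (i + 3)..c} = 0")
    case False
    have a: "0 < c / real (i + 3)" "2 * (c / real (i + 3)) < c"
      using c by (auto simp: field_simps intro: add_pos_nonneg)
    have "emeasure \<sigma> {c / real (i + 3)..c} * (ennreal k * e)
        = ennreal k * (emeasure \<sigma> {c / real (i + 3)..c} * e)" by (simp add: mult_ac)
    also have "\<dots> \<le> ennreal k * (emeasure \<sigma> {c / real (i + 3)..c} * emeasure nu (square_box c))"
      by (intro mult_left_mono) (auto simp: e_def)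
    also have "\<dots> \<le> ennreal (F\<^sup>2)" using forward_testing_mass_bound[OF fwd a] False by (auto simp: k_def)
    finally have "emeasure \<sigma> {c / real (i + 3)..c} * (ennreal k * e) / (ennreal k * e)
        \<le> ennreal (F\<^sup>2) / (ennreal k * e)" by (rule divide_right_mono_ennreal)
    moreover have nz: "ennreal k * e \<noteq> 0" "ennreal k * e \<noteq> top"
      using e k by (auto simp: ennreal_mult_eq_top_iff)
    ultimately show ?thesis by (metis mult_divide_eq_ennreal)
  qed simp
  have "emeasure \<sigma> {0<..c} = (SUP i. emeasure \<sigma> {c / real (i + 3)..c})"
  proof -
    have lo: "0 < c / real (i + 3)" for i using c by simp
    have U: "(\<Union>i. {c / real (i + 3)..c}) = {0<..c}"
    proof (intro equalityI subsetI)
      fix x assume "x \<in> {0<..c}"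
      then have x: "0 < x" "x \<le> c" by auto
      obtain i where "c / x \<le> real i" using real_arch_simple by blast
      then have "c / x \<le> real (i + 3)" by simp
      then have "c / real (i + 3) \<le> x" using x c by (simp add: field_simps)
      then show "x \<in> (\<Union>i. {c / real (i + 3)..c})" using x by (intro UN_I[of i]) auto
    next
      fix x assume "x \<in> (\<Union>i. {c / real (i + 3)..c})"
      then obtain i where "c / real (i + 3) \<le> x" "x \<le> c" by auto
      then show "x \<in> {0<..c}" using lo[of i] by simp
    qed
    have "incseq (\<lambda>i. {c / real (i + 3)..c})"
    proof (rule incseq_SucI)
      fix i
      have "c / real (Suc i + 3) \<le> c / real (i + 3)" using c by (intro divide_left_mono) auto
      then show "{c / real (i + 3)..c} \<subseteq> {c / real (Suc i + 3)..c}" by simp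
    qed
    moreover have "{c / real (i + 3)..c} \<in> sets \<sigma>" for i
    proof (rule sets_sigma)
      show "{c / real (i + 3)..c} \<subseteq> pos_half_line" using lo[of i] by auto
    qed simp
    then have "range (\<lambda>i. {c / real (i + 3)..c}) \<subseteq> sets \<sigma>" by blast
    ultimately show ?thesis using SUP_emeasure_incseq[of "\<lambda>i. {c / real (i + 3)..c}" \<sigma>] U by simp
  qed
  also have "\<dots> \<le> ennreal (F\<^sup>2) / (ennreal k * e)" by (intro SUP_least bound)
  also have "\<dots> < \<infinity>" using e k by (auto simp: ennreal_divide_eq_top_iff less_top[symmetric])
  finally have "emeasure \<sigma> {0<..c} < \<infinity>" .
  moreover have "emeasure \<sigma> {0<..b} \<le> emeasure \<sigma> {0<..c}"
    by (intro emeasure_mono sets_sigma) (auto simp: c_def)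
  ultimately show ?thesis by (rule le_less_trans[rotated])
qed

end

section \<open>Transfer of the testing conditions to the dyadic forms\<close>

lemma ennreal_sum_indicator_eq_nn_integral:
  assumes "finite D" "\<And>q. q \<in> D \<Longrightarrow> E q \<in> sets M" "\<And>q. q \<in> D \<Longrightarrow> emeasure M (E q) < \<infinity>"
    and "\<And>q. q \<in> D \<Longrightarrow> 0 \<le> v q"
  shows "ennreal (\<Sum>q\<in>D. v q * measure M (E q)) = (\<integral>\<^sup>+ z. ennreal (\<Sum>q\<in>D. v q * indicator (E q) z) \<partial>M)"
proof -
  have "(\<integral>\<^sup>+ z. ennreal (\<Sum>q\<in>D. v q * indicator (E q) z) \<partial>M)
      = (\<integral>\<^sup>+ z. (\<Sum>q\<in>D. ennreal (v q) * indicator (E q) z) \<partial>M)"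
    using assms(4) by (intro nn_integral_cong, subst sum_ennreal[symmetric])
      (auto intro!: sum.cong simp: ennreal_mult' indicator_def)
  also have "\<dots> = (\<Sum>q\<in>D. ennreal (v q) * emeasure M (E q))"
    using assms by (subst nn_integral_sum) (auto intro!: sum.cong nn_integral_cmult_indicator)
  also have "\<dots> = (\<Sum>q\<in>D. ennreal (v q * measure M (E q)))"
    using assms by (intro sum.cong refl) (simp add: emeasure_eq_ennreal_measure ennreal_mult' less_top)
  also have "\<dots> = ennreal (\<Sum>q\<in>D. v q * measure M (E q))"
    using assms by (intro sum_ennreal) auto
  finally show ?thesis by simp
qed

lemma ennreal_square_add_le: "(u + v)\<^sup>2 \<le> 2 * u\<^sup>2 + 2 * (v::ennreal)\<^sup>2"
proof (cases u; cases v)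
  fix a b assume u: "u = ennreal a" "0 \<le> a" and v: "v = ennreal b" "0 \<le> b"
  have "(u + v)\<^sup>2 = ennreal ((a + b)\<^sup>2)" using u v by (simp add: ennreal_plus[symmetric] ennreal_power del: ennreal_plus)
  also have "\<dots> \<le> ennreal (2 * a\<^sup>2 + 2 * b\<^sup>2)"
    using zero_le_power2[of "a - b"] by (intro ennreal_leI) (simp add: power2_eq_square algebra_simps)
  also have "\<dots> = 2 * u\<^sup>2 + 2 * v\<^sup>2" using u v by (simp add: ennreal_power ennreal_mult')
  finally show ?thesis .
qed (auto simp: power2_eq_square ennreal_mult_top)

context weight_pair
begin

definition C_test :: real where "C_test = 36 * 3 powr lam / c0"

lemma C_test_pos: "0 < C_test"
  using c0 by (simp add: C_test_def)

text \<open>Subcells of \<open>R\<close> contribute only over the box of \<open>R\<close> and at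
  points \<open>y\<close> of \<open>R\<close>, and there the comparison with the model kernel
  applies. The cut-off on the right is what turns testing of the Poisson operator on
  \<open>R\<close> into testing of the dyadic form on the subcells of \<open>R\<close>.\<close>

lemma dyadic_kernel_le_kernel:
  assumes "0 < x" "0 < y" "0 < t" and R: "R \<in> grid j m" and D: "D \<subseteq> {Q\<in>grid j m. Q \<subseteq> R}"
  shows "t * dyadic_kernel lam D (x, t) y
    \<le> C_test * (ker t x y * (indicator (carleson_box R) (x, t) * indicator R y))"
proof (cases "(x, t) \<in> carleson_box R \<and> y \<in> R")
  case True
  have "t * dyadic_kernel lam D (x, t) y \<le> t * (36 * 3 powr lam * model_kernel lam t x y)"
    using assms dyadic_kernel_le_model[OF lam, of x y t D j m] by (intro mult_left_mono) auto
  also have "\<dots> = C_test * (c0 * t * model_kernel lam t x y)" using c0 by (simp add: C_test_def)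
  also have "\<dots> \<le> C_test * ker t x y"
    using kernel_lower[of t x y] assms C_test_pos by (intro mult_left_mono) auto
  finally show ?thesis using True by simp
next
  case False
  have "cell_weight lam Q * (indicator (carleson_box Q) (x, t) * indicator Q y) = 0" if "Q \<in> D" for Q
  proof -
    have "Q \<in> grid j m" "Q \<subseteq> R" using that D by auto
    then have "interval_length Q \<le> interval_length R"
      using R by (intro interval_length_mono grid_memD) auto
    then have "carleson_box Q \<subseteq> carleson_box R" using \<open>Q \<subseteq> R\<close> by (auto simp: carleson_box_def)
    then show ?thesis using False \<open>Q \<subseteq> R\<close> by (auto simp: indicator_def)
  qed
  then have "dyadic_kernel lam D (x, t) y = 0" unfolding dyadic_kernel_def by (intro sum.neutral) auto
  moreover have "indicator (carleson_box R) (x, t) * indicator R y = (0::real)"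
    using False by (auto simp: indicator_def)
  ultimately show ?thesis by (metis mult_zero_right order_refl)
qed

lemma carleson_box_sets: "Q \<in> grid j m \<Longrightarrow> carleson_box Q \<in> sets \<mu>"
proof (rule sets_mu)
  assume Q: "Q \<in> grid j m"
  show "carleson_box Q \<in> sets borel"
    unfolding carleson_box_def borel_prod[symmetric] using grid_memD(3)[OF Q] by (intro pair_measureI) auto
  show "carleson_box Q \<subseteq> pos_quadrant"
    using grid_memD(1)[OF Q] by (auto simp: carleson_box_def pos_interval_def)
qed

lemma grid_sets_sigma: "Q \<in> grid j m \<Longrightarrow> Q \<in> sets \<sigma>"
  using grid_memD[of Q j m] by (intro sets_sigma) (auto simp: pos_interval_def)

text \<open>Cells touching the origin and all boxes lie in no compact subset of the open half line
  or quadrant, so their finite mass has to come from the two assumptions.\<close>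

lemma grid_laminar_pair:
  assumes sfin: "\<And>b. emeasure \<sigma> {0<..b} < \<infinity>" and nfin: "\<And>b. emeasure nu (square_box b) < \<infinity>"
  shows "laminar_pair \<sigma> nu (\<lambda>Q. Q) carleson_box (grid j m) (cell_weight lam)"
proof
  show "finite (grid j m)" by (rule finite_grid)
  fix Q assume Q: "Q \<in> grid j m"
  note pI = grid_memD(1)[OF Q]
  note btw = pos_interval_between[OF pI]
  show "Q \<in> sets \<sigma>" "0 \<le> cell_weight lam Q" using Q grid_sets_sigma cell_weight_nonneg by auto
  show box: "carleson_box Q \<in> sets nu" using carleson_box_sets[OF Q] by (simp add: sets_nu)
  have "Q \<subseteq> {0<..Sup Q}"
  proof
    fix x assume x: "x \<in> Q"
    then have "0 < x" using pI by (auto simp: pos_interval_def)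
    moreover have "x \<le> Sup Q" using x btw(2) by auto
    ultimately show "x \<in> {0<..Sup Q}" by simp
  qed
  then have "emeasure \<sigma> Q \<le> emeasure \<sigma> {0<..Sup Q}" by (intro emeasure_mono sets_sigma) auto
  then show "emeasure \<sigma> Q < \<infinity>" using sfin by (rule le_less_trans)
  have "interval_length Q \<le> Sup Q" using btw by (simp add: interval_length_def)
  then have "carleson_box Q \<subseteq> square_box (Sup Q)"
    using \<open>Q \<subseteq> {0<..Sup Q}\<close> unfolding carleson_box_def square_box_def by (intro Sigma_mono) auto
  then have "emeasure nu (carleson_box Q) \<le> emeasure nu (square_box (Sup Q))" by (intro emeasure_mono) auto
  then show "emeasure nu (carleson_box Q) < \<infinity>" using nfin by (rule le_less_trans)
  fix R assume R: "R \<in> grid j m"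
  show "carleson_box Q \<subseteq> carleson_box R" if "Q \<subseteq> R"
    using interval_length_mono[OF pI grid_memD(1)[OF R] that] that by (auto simp: carleson_box_def)
  show disj: "Q \<inter> R = {}" if "\<not> Q \<subseteq> R" "\<not> R \<subseteq> Q"
    using grid_laminar[OF Q R] that by auto
  then show "carleson_box Q \<inter> carleson_box R = {}" if "\<not> Q \<subseteq> R" "\<not> R \<subseteq> Q"
    using that by (auto simp: carleson_box_def)
  fix T assume T: "T \<in> grid j m"
  show "R \<subseteq> T \<or> T \<subseteq> R" if "Q \<subseteq> R" "Q \<subseteq> T"
    using grid_laminar[OF R T] that Q by (auto simp: grid_def)
qed

text \<open>Pointwise, \<open>t\<close> times the localised dyadic operator is at most
  \<open>C_test\<close> times the Poisson integral of the indicator of \<open>R\<close>, cut off to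
  the box. The density \<open>t^2\<close> of \<open>nu\<close> supplies this factor \<open>t\<close>
  under the square.\<close>

lemma dyadic_forward_testing:
  assumes sfin: "\<And>b. emeasure \<sigma> {0<..b} < \<infinity>" and nfin: "\<And>b. emeasure nu (square_box b) < \<infinity>"
    and fwd: "forward_testing lam \<sigma> \<mu> F" and R: "R \<in> grid j m"
  shows "(\<integral>p. (\<Sum>Q\<in>{Q\<in>grid j m. Q \<subseteq> R}. cell_weight lam Q * measure \<sigma> Q * indicator (carleson_box Q) p)\<^sup>2 \<partial>nu)
    \<le> (C_test * F)\<^sup>2 * measure \<sigma> R"
proof -
  interpret laminar_pair \<sigma> nu "\<lambda>Q. Q" carleson_box "grid j m" "cell_weight lam"
    by (rule grid_laminar_pair[OF sfin nfin])
  define D where "D = {Q\<in>grid j m. Q \<subseteq> R}"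
  define h where "h p = (\<Sum>Q\<in>D. cell_weight lam Q * measure \<sigma> Q * indicator (carleson_box Q) p)" for p
  have DG: "D \<subseteq> grid j m" by (auto simp: D_def)
  have finD: "finite D" using DG finite_grid finite_subset by blast
  have h0: "0 \<le> h p" for p unfolding h_def using cell_weight_nonneg by (intro sum_nonneg) auto
  have h_int: "integrable nu (\<lambda>p. (h p)\<^sup>2)"
    unfolding h_def using DG by (intro integrable_square_sum_indicator_B)
  have box [measurable]: "carleson_box R \<in> sets \<mu>" by (rule carleson_box_sets[OF R])
  have R_meas [measurable]: "(indicator R :: real \<Rightarrow> ennreal) \<in> borel_measurable \<sigma>"
    using grid_sets_sigma[OF R] by simp
  have h_meas: "(\<lambda>p. ennreal ((h p)\<^sup>2)) \<in> borel_measurable \<mu>"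
    unfolding h_def using carleson_box_sets DG
    by (intro measurable_compose[OF _ measurable_ennreal] borel_measurable_power borel_measurable_sum
        borel_measurable_times borel_measurable_indicator borel_measurable_const) blast
  have pw: "ennreal (t * h (x, t)) \<le> ennreal C_test * nn_poisson_op lam \<sigma> (indicator R) (x, t) * indicator (carleson_box R) (x, t)"
    if xt: "0 < x" "0 < t" for x t
  proof -
    have "t * h (x, t) = (\<Sum>Q\<in>D. (t * (cell_weight lam Q * indicator (carleson_box Q) (x, t))) * measure \<sigma> Q)"
      unfolding h_def by (simp add: sum_distrib_left mult_ac)
    also have "ennreal \<dots> = (\<integral>\<^sup>+ y. ennreal (\<Sum>Q\<in>D. (t * (cell_weight lam Q * indicator (carleson_box Q) (x, t))) * indicator Q y) \<partial>\<sigma>)"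
      using DG finD A_fin A_sets xt cell_weight_nonneg
      by (intro ennreal_sum_indicator_eq_nn_integral) auto
    also have "\<dots> = (\<integral>\<^sup>+ y. ennreal (t * dyadic_kernel lam D (x, t) y) \<partial>\<sigma>)"
      unfolding dyadic_kernel_def by (simp add: sum_distrib_left mult_ac)
    also have "\<dots> \<le> (\<integral>\<^sup>+ y. (ennreal C_test * indicator (carleson_box R) (x, t)) * (ennreal (ker t x y) * indicator R y) \<partial>\<sigma>)"
    proof (rule nn_integral_mono)
      fix y assume "y \<in> space \<sigma>"
      then have "0 < y" by (simp add: space_sigma)
      from dyadic_kernel_le_kernel[OF xt(1) this xt(2) R, of D]
      have "ennreal (t * dyadic_kernel lam D (x, t) y)
        \<le> ennreal (C_test * (ker t x y * (indicator (carleson_box R) (x, t) * indicator R y)))"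
        by (intro ennreal_leI) (auto simp: D_def)
      also have "\<dots> = (ennreal C_test * indicator (carleson_box R) (x, t)) * (ennreal (ker t x y) * indicator R y)"
        using C_test_pos by (auto simp: indicator_def ennreal_mult')
      finally show "ennreal (t * dyadic_kernel lam D (x, t) y)
        \<le> (ennreal C_test * indicator (carleson_box R) (x, t)) * (ennreal (ker t x y) * indicator R y)" .
    qed
    also have "\<dots> = (ennreal C_test * indicator (carleson_box R) (x, t)) * nn_poisson_op lam \<sigma> (indicator R) (x, t)"
      unfolding nn_poisson_op_def by (simp, subst nn_integral_cmult) (auto intro!: borel_measurable_times_ennreal measurable_compose[OF _ measurable_ennreal])
    finally show ?thesis by (simp add: mult_ac)
  qed
  have "ennreal (\<integral>p. (h p)\<^sup>2 \<partial>nu) = (\<integral>\<^sup>+ p. ennreal ((h p)\<^sup>2) \<partial>nu)"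
    using h_int by (subst nn_integral_eq_integral) auto
  also have "\<dots> = (\<integral>\<^sup>+ p. ennreal ((snd p)\<^sup>2) * ennreal ((h p)\<^sup>2) \<partial>\<mu>)"
    by (rule nn_integral_nu[OF h_meas])
  also have "\<dots> \<le> (\<integral>\<^sup>+ p. ennreal (C_test\<^sup>2) * ((nn_poisson_op lam \<sigma> (indicator R) p)\<^sup>2 * indicator (carleson_box R) p) \<partial>\<mu>)"
  proof (rule nn_integral_mono)
    fix p assume "p \<in> space \<mu>"
    then obtain x t where p: "p = (x, t)" "0 < x" "0 < t" by (auto simp: space_mu)
    have "ennreal ((snd p)\<^sup>2) * ennreal ((h p)\<^sup>2) = (ennreal (t * h (x, t)))\<^sup>2"
      using p h0[of "(x, t)"] by (simp add: ennreal_power ennreal_mult'[symmetric] power_mult_distrib)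
    also have "\<dots> \<le> (ennreal C_test * nn_poisson_op lam \<sigma> (indicator R) (x, t) * indicator (carleson_box R) (x, t))\<^sup>2"
      using pw[OF p(2,3)] by (intro power_mono) auto
    also have "\<dots> = ennreal (C_test\<^sup>2) * ((nn_poisson_op lam \<sigma> (indicator R) p)\<^sup>2 * indicator (carleson_box R) p)"
      using C_test_pos p by (auto simp: power_mult_distrib ennreal_power indicator_def)
    finally show "ennreal ((snd p)\<^sup>2) * ennreal ((h p)\<^sup>2)
        \<le> ennreal (C_test\<^sup>2) * ((nn_poisson_op lam \<sigma> (indicator R) p)\<^sup>2 * indicator (carleson_box R) p)" .
  qed
  also have "\<dots> = ennreal (C_test\<^sup>2) * (\<integral>\<^sup>+ p. (nn_poisson_op lam \<sigma> (indicator R) p)\<^sup>2 * indicator (carleson_box R) p \<partial>\<mu>)"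
    by (rule nn_integral_cmult) measurable
  also have "\<dots> \<le> ennreal (C_test\<^sup>2) * (\<integral>\<^sup>+ p. (nn_poisson_op lam \<sigma> (indicator R) p)\<^sup>2 * indicator (tent (triple R)) p \<partial>\<mu>)"
    using carleson_box_subset_tent_triple[OF grid_memD(1,2)[OF R]]
    by (intro mult_left_mono nn_integral_mono) (auto simp: indicator_def)
  also have "\<dots> \<le> ennreal (C_test\<^sup>2) * (ennreal (F\<^sup>2) * emeasure \<sigma> R)"
    using fwd grid_memD(1)[OF R] unfolding forward_testing_def by (intro mult_left_mono) auto
  also have "\<dots> = ennreal ((C_test * F)\<^sup>2 * measure \<sigma> R)"
    using A_fin[OF R] by (simp add: emeasure_eq_ennreal_measure less_top ennreal_mult' power_mult_distrib mult_ac)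
  finally show ?thesis unfolding h_def D_def by (subst (asm) ennreal_le_iff) auto
qed

text \<open>The density of \<open>nu\<close> provides two factors \<open>t\<close>: one turns the
  dyadic kernel into the Poisson kernel, the other is the \<open>t\<close> in the function to which
  the adjoint is applied.\<close>

lemma dyadic_backward_testing:
  assumes sfin: "\<And>b. emeasure \<sigma> {0<..b} < \<infinity>" and nfin: "\<And>b. emeasure nu (square_box b) < \<infinity>"
    and bwd: "backward_testing lam \<sigma> \<mu> B" and R: "R \<in> grid j m"
  shows "(\<integral>y. (\<Sum>Q\<in>{Q\<in>grid j m. Q \<subseteq> R}. cell_weight lam Q * measure nu (carleson_box Q) * indicator Q y)\<^sup>2 \<partial>\<sigma>)
    \<le> (C_test * B)\<^sup>2 * measure nu (carleson_box R)"
proof -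
  interpret lp: laminar_pair \<sigma> nu "\<lambda>Q. Q" carleson_box "grid j m" "cell_weight lam"
    by (rule grid_laminar_pair[OF sfin nfin])
  interpret sw: laminar_pair nu \<sigma> carleson_box "\<lambda>Q. Q" "grid j m" "cell_weight lam"
    by (rule lp.swap)
  define D where "D = {Q\<in>grid j m. Q \<subseteq> R}"
  define h where "h y = (\<Sum>Q\<in>D. cell_weight lam Q * measure nu (carleson_box Q) * indicator Q y)" for y
  define a where "a y = nn_poisson_adj lam \<mu> (\<lambda>(x, t). ennreal t * indicator (tent R) (x, t)) y" for y
  have DG: "D \<subseteq> grid j m" by (auto simp: D_def)
  have finD: "finite D" using DG finite_grid finite_subset by blast
  have h0: "0 \<le> h y" for y unfolding h_def using cell_weight_nonneg by (intro sum_nonneg) auto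
  have h_int: "integrable \<sigma> (\<lambda>y. (h y)\<^sup>2)"
    unfolding h_def using DG by (intro sw.integrable_square_sum_indicator_B)
  have box [measurable]: "carleson_box R \<in> sets \<mu>" by (rule carleson_box_sets[OF R])
  have box_tent: "indicator (tent R) p = (indicator (carleson_box R) p :: ennreal)" if "p \<in> space \<mu>" for p
    using that by (auto simp: space_mu tent_def carleson_box_def indicator_def)
  have dk_meas: "(\<lambda>p. ennreal (dyadic_kernel lam D p y)) \<in> borel_measurable \<mu>" for y
    unfolding dyadic_kernel_def using carleson_box_sets DG
    by (intro measurable_compose[OF _ measurable_ennreal] borel_measurable_sum
        borel_measurable_times borel_measurable_indicator borel_measurable_const) blast
  have pw: "ennreal (h y) \<le> ennreal C_test * a y * indicator R y" if y: "0 < y" for y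
  proof -
    have "h y = (\<Sum>Q\<in>D. (cell_weight lam Q * indicator Q y) * measure nu (carleson_box Q))"
      unfolding h_def by (simp add: mult_ac)
    also have "ennreal \<dots> = (\<integral>\<^sup>+ p. ennreal (\<Sum>Q\<in>D. (cell_weight lam Q * indicator Q y) * indicator (carleson_box Q) p) \<partial>nu)"
      using DG finD lp.B_fin lp.B_sets cell_weight_nonneg
      by (intro ennreal_sum_indicator_eq_nn_integral) auto
    also have "\<dots> = (\<integral>\<^sup>+ p. ennreal (dyadic_kernel lam D p y) \<partial>nu)"
      unfolding dyadic_kernel_def by (simp add: mult_ac)
    also have "\<dots> = (\<integral>\<^sup>+ p. ennreal ((snd p)\<^sup>2) * ennreal (dyadic_kernel lam D p y) \<partial>\<mu>)"
      by (rule nn_integral_nu[OF dk_meas])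
    also have "\<dots> \<le> (\<integral>\<^sup>+ p. (ennreal C_test * indicator R y) *
        (ennreal (ker (snd p) (fst p) y) * (ennreal (snd p) * indicator (carleson_box R) p)) \<partial>\<mu>)"
    proof (rule nn_integral_mono)
      fix p assume "p \<in> space \<mu>"
      then obtain x t where p: "p = (x, t)" "0 < x" "0 < t" by (auto simp: space_mu)
      have dk0: "0 \<le> dyadic_kernel lam D p y"
        unfolding dyadic_kernel_def using cell_weight_nonneg by (intro sum_nonneg) auto
      have "ennreal ((snd p)\<^sup>2) * ennreal (dyadic_kernel lam D p y) = ennreal (t * (t * dyadic_kernel lam D (x, t) y))"
        using p dk0 by (simp add: ennreal_mult'[symmetric] power2_eq_square mult_ac)
      also have "\<dots> \<le> ennreal (t * (C_test * (ker t x y * (indicator (carleson_box R) (x, t) * indicator R y))))"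
        using dyadic_kernel_le_kernel[OF p(2) y p(3) R, of D] p
        by (intro ennreal_leI mult_left_mono) (auto simp: D_def)
      also have "\<dots> = (ennreal C_test * indicator R y) *
          (ennreal (ker (snd p) (fst p) y) * (ennreal (snd p) * indicator (carleson_box R) p))"
        using C_test_pos p kernel_nonneg[OF lam, of t x y]
        by (auto simp: indicator_def ennreal_mult'[symmetric] mult_ac)
      finally show "ennreal ((snd p)\<^sup>2) * ennreal (dyadic_kernel lam D p y) \<le> (ennreal C_test * indicator R y) *
          (ennreal (ker (snd p) (fst p) y) * (ennreal (snd p) * indicator (carleson_box R) p))" .
    qed
    also have "\<dots> = (ennreal C_test * indicator R y) * (\<integral>\<^sup>+ p. ennreal (ker (snd p) (fst p) y)
        * (ennreal (snd p) * indicator (carleson_box R) p) \<partial>\<mu>)"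
      by (rule nn_integral_cmult) measurable
    also have "(\<integral>\<^sup>+ p. ennreal (ker (snd p) (fst p) y) * (ennreal (snd p) * indicator (carleson_box R) p) \<partial>\<mu>) = a y"
      unfolding a_def nn_poisson_adj_def by (intro nn_integral_cong) (auto simp: box_tent)
    finally show ?thesis by (simp add: mult_ac)
  qed
  \<comment> \<open>Moving the constant to the side of \<open>h\<close> lets the square of
    \<open>a\<close> enter through monotonicity of the integral alone, without pulling a factor out
    of an integral of \<open>a\<close>.\<close>
  have pw': "ennreal (h y / C_test) \<le> a y * indicator R y" if y: "0 < y" for y
  proof -
    have "ennreal C_test * ennreal (h y / C_test) = ennreal (h y)"
      using C_test_pos h0 by (simp add: ennreal_mult'[symmetric])
    then have "ennreal C_test * ennreal (h y / C_test) \<le> ennreal C_test * (a y * indicator R y)"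
      using pw[OF y] by (simp add: mult.assoc)
    then show ?thesis using C_test_pos by (subst (asm) ennreal_mult_le_mult_iff) auto
  qed
  have "ennreal (\<integral>y. (h y / C_test)\<^sup>2 \<partial>\<sigma>) = (\<integral>\<^sup>+ y. ennreal ((h y / C_test)\<^sup>2) \<partial>\<sigma>)"
    using h_int by (subst nn_integral_eq_integral) (auto simp: power_divide)
  also have "\<dots> \<le> (\<integral>\<^sup>+ y. (a y)\<^sup>2 * indicator (triple R) y \<partial>\<sigma>)"
  proof (rule nn_integral_mono)
    fix y assume "y \<in> space \<sigma>"
    then have y: "0 < y" by (simp add: space_sigma)
    have "ennreal ((h y / C_test)\<^sup>2) = (ennreal (h y / C_test))\<^sup>2"
      using h0 C_test_pos by (simp add: ennreal_power)
    also have "\<dots> \<le> (a y * indicator R y)\<^sup>2"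
      using pw'[OF y] by (intro power_mono) auto
    also have "\<dots> \<le> (a y)\<^sup>2 * indicator (triple R) y"
      using triple_geometry(1)[OF grid_memD(1,2)[OF R]]
      by (auto simp: power_mult_distrib indicator_def)
    finally show "ennreal ((h y / C_test)\<^sup>2) \<le> (a y)\<^sup>2 * indicator (triple R) y" .
  qed
  also have "\<dots> \<le> ennreal (B\<^sup>2) * (\<integral>\<^sup>+ p. ennreal ((snd p)\<^sup>2) * indicator (tent R) p \<partial>\<mu>)"
    using bwd grid_memD(1)[OF R] unfolding backward_testing_def a_def by auto
  also have "(\<integral>\<^sup>+ p. ennreal ((snd p)\<^sup>2) * indicator (tent R) p \<partial>\<mu>) = (\<integral>\<^sup>+ p. ennreal ((snd p)\<^sup>2) * indicator (carleson_box R) p \<partial>\<mu>)"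
    by (intro nn_integral_cong) (simp add: box_tent)
  also have "\<dots> = emeasure nu (carleson_box R)"
    unfolding nu_def by (subst emeasure_density) auto
  also have "ennreal (B\<^sup>2) * \<dots> = ennreal (B\<^sup>2 * measure nu (carleson_box R))"
    using lp.B_fin[OF R] by (simp add: emeasure_eq_ennreal_measure less_top ennreal_mult')
  finally have "(\<integral>y. (h y / C_test)\<^sup>2 \<partial>\<sigma>) \<le> B\<^sup>2 * measure nu (carleson_box R)"
    by (subst (asm) ennreal_le_iff) auto
  moreover have "(\<integral>y. (h y / C_test)\<^sup>2 \<partial>\<sigma>) = (\<integral>y. (h y)\<^sup>2 \<partial>\<sigma>) / C_test\<^sup>2"
    by (simp add: power_divide)
  ultimately show ?thesis
    using C_test_pos unfolding h_def[symmetric] D_def[symmetric]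
    by (simp add: power_mult_distrib divide_simps mult_ac)
qed

text \<open>The factor 2 comes from adding two grids, \<open>c1 * (36 * 74 powr lam)\<close> from
  the pointwise upper bound for the kernel, and \<open>64 * C_test\<close> from
  \<open>operator_bound\<close> combined with the loss in the dyadic testing conditions.\<close>

definition C_suff :: real where
  "C_suff = 2 * (c1 * (36 * 74 powr lam)) * (64 * C_test)"

lemma C_suff_pos: "0 < C_suff"
  using c1 C_test_pos by (simp add: C_suff_def)

lemma dyadic_operator_bound:
  assumes sfin: "\<And>b. emeasure \<sigma> {0<..b} < \<infinity>" and nfin: "\<And>b. emeasure nu (square_box b) < \<infinity>"
    and fwd: "forward_testing lam \<sigma> \<mu> F" and bwd: "backward_testing lam \<sigma> \<mu> B"
    and F: "0 < F" and B: "0 < B"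
    and f [measurable]: "f \<in> borel_measurable \<sigma>" and f0: "\<And>y. 0 \<le> f y"
    and f2: "integrable \<sigma> (\<lambda>y. (f y)\<^sup>2)"
  shows "(\<integral>\<^sup>+ p. (\<integral>\<^sup>+ y. ennreal (dyadic_kernel lam (grid j m) p y) * ennreal (f y) \<partial>\<sigma>)\<^sup>2 \<partial>nu)
    \<le> ennreal ((64 * C_test * (F + B))\<^sup>2) * (\<integral>\<^sup>+ y. ennreal ((f y)\<^sup>2) \<partial>\<sigma>)"
proof -
  interpret laminar_pair \<sigma> nu "\<lambda>Q. Q" carleson_box "grid j m" "cell_weight lam"
    by (rule grid_laminar_pair[OF sfin nfin])
  define T where "T p = (\<Sum>Q\<in>grid j m. cell_weight lam Q * (\<integral>y. indicator Q y * f y \<partial>\<sigma>) * indicator (carleson_box Q) p)" for p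
  have Qf: "integrable \<sigma> (\<lambda>y. indicator Q y * f y)" if "Q \<in> grid j m" for Q
    using that A_sets A_fin f f2 by (intro integrable_indicator_mult_square_integrable) auto
  have T_eq: "(\<integral>\<^sup>+ y. ennreal (dyadic_kernel lam (grid j m) p y) * ennreal (f y) \<partial>\<sigma>) = ennreal (T p)" for p
  proof -
    have "(\<integral>\<^sup>+ y. ennreal (dyadic_kernel lam (grid j m) p y) * ennreal (f y) \<partial>\<sigma>)
      = (\<integral>\<^sup>+ y. ennreal (\<Sum>Q\<in>grid j m. cell_weight lam Q * indicator (carleson_box Q) p * (indicator Q y * f y)) \<partial>\<sigma>)"
      unfolding dyadic_kernel_def using f0 cell_weight_nonneg
      by (intro nn_integral_cong) (subst ennreal_mult''[symmetric], auto simp: sum_distrib_left mult_ac)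
    also have "\<dots> = ennreal (\<integral>y. (\<Sum>Q\<in>grid j m. cell_weight lam Q * indicator (carleson_box Q) p * (indicator Q y * f y)) \<partial>\<sigma>)"
      using Qf f0 cell_weight_nonneg
      by (intro nn_integral_eq_integral Bochner_Integration.integrable_sum integrable_mult_right AE_I2 sum_nonneg) auto
    also have "(\<integral>y. (\<Sum>Q\<in>grid j m. cell_weight lam Q * indicator (carleson_box Q) p * (indicator Q y * f y)) \<partial>\<sigma>) = T p"
      unfolding T_def using Qf by (subst Bochner_Integration.integral_sum) (auto intro!: sum.cong)
    finally show ?thesis .
  qed
  have T0: "0 \<le> T p" for p
    unfolding T_def using cell_weight_nonneg f0 by (intro sum_nonneg mult_nonneg_nonneg integral_nonneg) auto
  have "(\<integral>\<^sup>+ p. (ennreal (T p))\<^sup>2 \<partial>nu) = (\<integral>\<^sup>+ p. ennreal ((T p)\<^sup>2) \<partial>nu)"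
    using T0 by (simp add: ennreal_power)
  also have "\<dots> = ennreal (\<integral>p. (T p)\<^sup>2 \<partial>nu)"
    unfolding T_def by (intro nn_integral_eq_integral integrable_square_sum_indicator_B) auto
  also have "\<dots> \<le> ennreal ((64 * (C_test * F + C_test * B))\<^sup>2 * (\<integral>y. (f y)\<^sup>2 \<partial>\<sigma>))"
    unfolding T_def using F B C_test_pos
    by (intro ennreal_leI operator_bound f f0 f2 dyadic_forward_testing[OF sfin nfin fwd]
        dyadic_backward_testing[OF sfin nfin bwd]) auto
  also have "\<dots> = ennreal ((64 * C_test * (F + B))\<^sup>2) * (\<integral>\<^sup>+ y. ennreal ((f y)\<^sup>2) \<partial>\<sigma>)"
    using f2 by (subst nn_integral_eq_integral) (auto simp: ennreal_mult' algebra_simps)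
  finally show ?thesis unfolding T_eq .
qed

section \<open>Passage from truncated grids to the Poisson operator\<close>

lemma dyadic_kernel_nonneg: "0 \<le> dyadic_kernel lam D p y"
  unfolding dyadic_kernel_def using cell_weight_nonneg by (intro sum_nonneg) auto

lemma dyadic_kernel_mono:
  "D \<subseteq> D' \<Longrightarrow> finite D' \<Longrightarrow> dyadic_kernel lam D p y \<le> dyadic_kernel lam D' p y"
  unfolding dyadic_kernel_def using cell_weight_nonneg by (intro sum_mono2) auto

lemma nn_poisson_op_bound:
  assumes fwd: "forward_testing lam \<sigma> \<mu> F" and bwd: "backward_testing lam \<sigma> \<mu> B"
    and F: "0 < F" and B: "0 < B"
    and f [measurable]: "f \<in> borel_measurable \<sigma>" and f0: "\<And>y. 0 \<le> f y"
    and f2: "integrable \<sigma> (\<lambda>y. (f y)\<^sup>2)"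
  shows "(\<integral>\<^sup>+ p. (nn_poisson_op lam \<sigma> (\<lambda>y. ennreal (f y)) p)\<^sup>2 \<partial>\<mu>)
    \<le> ennreal ((C_suff * (F + B))\<^sup>2) * (\<integral>\<^sup>+ y. ennreal ((f y)\<^sup>2) \<partial>\<sigma>)"
proof -
  \<comment> \<open>Finiteness of each measure is deduced from the other one being nonzero. If one
    of them vanishes, the left side is 0.\<close>
  consider "emeasure \<sigma> (space \<sigma>) = 0" | "emeasure \<mu> (space \<mu>) = 0"
    | "emeasure \<sigma> (space \<sigma>) \<noteq> 0" "emeasure \<mu> (space \<mu>) \<noteq> 0" by blast
  then show ?thesis
  proof cases
    case 1
    then have "AE y in \<sigma>. False" by (simp add: eventually_False ae_filter_eq_bot_iff)
    then have ae: "AE y in \<sigma>. P y" for P by (auto elim: eventually_mono)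
    have "nn_poisson_op lam \<sigma> (\<lambda>y. ennreal (f y)) p = 0" for p
      unfolding nn_poisson_op_eq by (subst nn_integral_cong_AE[where v="\<lambda>_. 0"]) (auto intro: ae)
    then show ?thesis by simp
  next
    case 2
    then have "AE p in \<mu>. False" by (simp add: eventually_False ae_filter_eq_bot_iff)
    then have "(\<integral>\<^sup>+ p. (nn_poisson_op lam \<sigma> (\<lambda>y. ennreal (f y)) p)\<^sup>2 \<partial>\<mu>) = (\<integral>\<^sup>+ p. 0 \<partial>\<mu>)"
      by (intro nn_integral_cong_AE) (auto elim: eventually_mono)
    then show ?thesis by simp
  next
    case 3
    note sfin = sigma_finite_near_zero[OF fwd 3(2)] and nfin = nu_finite[OF fwd 3(1)]
    define C where "C = c1 * (36 * 74 powr lam)"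
    have C: "0 < C" using c1 by (simp add: C_def)
    define d where "d j m p y = ennreal (dyadic_kernel lam (grid j m) p y) * ennreal (f y)" for j m p y
    define g where "g j m p = (\<integral>\<^sup>+ y. d j m p y \<partial>\<sigma>)" for j m p
    define h where "h m p = g False m p + g True m p" for m p
    define M where "M = ennreal ((64 * C_test * (F + B))\<^sup>2) * (\<integral>\<^sup>+ y. ennreal ((f y)\<^sup>2) \<partial>\<sigma>)"
    have g_bound: "(\<integral>\<^sup>+ p. (g j m p)\<^sup>2 \<partial>nu) \<le> M" for j m
      unfolding g_def d_def M_def by (rule dyadic_operator_bound[OF sfin nfin fwd bwd F B f f0 f2])
    have d_meas [measurable]: "(\<lambda>y. d j m p y) \<in> borel_measurable \<sigma>" for j m p
      unfolding d_def dyadic_kernel_def using grid_sets_sigma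
      by (intro borel_measurable_times_ennreal measurable_compose[OF _ measurable_ennreal] borel_measurable_sum
        borel_measurable_times borel_measurable_indicator borel_measurable_const f) blast+
    have d_mono: "incseq (\<lambda>m. d j m p)" for j p
      unfolding incseq_def le_fun_def d_def
      by (intro allI impI mult_right_mono ennreal_leI dyadic_kernel_mono grid_mono finite_grid) auto
    have d_pair: "(\<lambda>z. d j m (fst z) (snd z)) \<in> borel_measurable (\<mu> \<Otimes>\<^sub>M \<sigma>)" for j m
    proof -
      have "(\<lambda>z. f (snd z)) \<in> borel_measurable (\<mu> \<Otimes>\<^sub>M \<sigma>)"
        using measurable_compose[OF measurable_snd f] by simp
      moreover have "(\<lambda>z. indicator Q (snd z) :: real) \<in> borel_measurable (\<mu> \<Otimes>\<^sub>M \<sigma>)" if "Q \<in> grid j m" for Q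
        by (rule measurable_compose[OF measurable_snd borel_measurable_indicator[OF grid_sets_sigma[OF that]]])
      moreover have "(\<lambda>z. indicator (carleson_box Q) (fst z) :: real) \<in> borel_measurable (\<mu> \<Otimes>\<^sub>M \<sigma>)" if "Q \<in> grid j m" for Q
        by (rule measurable_compose[OF measurable_fst borel_measurable_indicator[OF carleson_box_sets[OF that]]])
      ultimately show ?thesis
        unfolding d_def dyadic_kernel_def
        by (intro borel_measurable_times_ennreal measurable_compose[OF _ measurable_ennreal] borel_measurable_sum
          borel_measurable_times borel_measurable_const) auto
    qed
    have g_meas [measurable]: "g j m \<in> borel_measurable \<mu>" for j m
      unfolding g_def using d_pair by (intro sigma.borel_measurable_nn_integral) (simp add: case_prod_beta')
    have h_meas [measurable]: "h m \<in> borel_measurable \<mu>" for m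
      unfolding h_def by measurable
    have h_inc: "incseq (\<lambda>m. h m p)" for p
      unfolding incseq_def h_def g_def
      by (intro allI impI add_mono nn_integral_mono) (use d_mono in \<open>auto simp: incseq_def le_fun_def\<close>)
    \<comment> \<open>How large \<open>m\<close> must be depends on \<open>y\<close>. The kernel is
      therefore bounded by a supremum over all truncations, which monotone convergence takes out of
      the integral.\<close>
    have op_le: "nn_poisson_op lam \<sigma> (\<lambda>y. ennreal (f y)) (x, t) \<le> ennreal (C * t) * (SUP m. h m (x, t))"
      if xt: "0 < x" "0 < t" for x t
    proof -
      have "nn_poisson_op lam \<sigma> (\<lambda>y. ennreal (f y)) (x, t)
          \<le> (\<integral>\<^sup>+ y. ennreal (C * t) * (SUP m. d False m (x, t) y + d True m (x, t) y) \<partial>\<sigma>)"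
        unfolding nn_poisson_op_eq
      proof (rule nn_integral_mono)
        fix y assume "y \<in> space \<sigma>"
        then have y: "0 < y" by (simp add: space_sigma)
        obtain m where m: "model_kernel lam t x y \<le> 36 * 74 powr lam *
            (dyadic_kernel lam (grid False m) (x, t) y + dyadic_kernel lam (grid True m) (x, t) y)"
          using model_le_dyadic_kernel[OF lam xt(1) y xt(2)] by blast
        have "ker t x y \<le> c1 * t * model_kernel lam t x y"
          using kernel_upper xt y by auto
        also have "\<dots> \<le> c1 * t * (36 * 74 powr lam *
            (dyadic_kernel lam (grid False m) (x, t) y + dyadic_kernel lam (grid True m) (x, t) y))"
          using m c1 xt by (intro mult_left_mono) auto
        also have "\<dots> = C * t * (dyadic_kernel lam (grid False m) (x, t) y + dyadic_kernel lam (grid True m) (x, t) y)"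
          by (simp add: C_def)
        finally have "ennreal (ker t x y) \<le> ennreal (C * t *
            (dyadic_kernel lam (grid False m) (x, t) y + dyadic_kernel lam (grid True m) (x, t) y))"
          by (rule ennreal_leI)
        also have "\<dots> = ennreal (C * t) *
            (ennreal (dyadic_kernel lam (grid False m) (x, t) y) + ennreal (dyadic_kernel lam (grid True m) (x, t) y))"
          using C xt by (subst ennreal_mult') (auto simp: dyadic_kernel_nonneg)
        finally have "ennreal (ker t x y) \<le> ennreal (C * t) *
            (ennreal (dyadic_kernel lam (grid False m) (x, t) y) + ennreal (dyadic_kernel lam (grid True m) (x, t) y))" .
        then have "ennreal (ker t x y) * ennreal (f y) \<le> ennreal (C * t) *
            (ennreal (dyadic_kernel lam (grid False m) (x, t) y) + ennreal (dyadic_kernel lam (grid True m) (x, t) y)) * ennreal (f y)"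
          by (rule mult_right_mono) simp
        also have "\<dots> = ennreal (C * t) * (d False m (x, t) y + d True m (x, t) y)"
          by (simp add: d_def distrib_right mult.assoc)
        also have "\<dots> \<le> ennreal (C * t) * (SUP m. d False m (x, t) y + d True m (x, t) y)"
          by (intro mult_left_mono SUP_upper) auto
        finally show "ennreal (ker (snd (x, t)) (fst (x, t)) y) * ennreal (f y)
            \<le> ennreal (C * t) * (SUP m. d False m (x, t) y + d True m (x, t) y)" by simp
      qed
      also have "\<dots> = ennreal (C * t) * (\<integral>\<^sup>+ y. (SUP m. d False m (x, t) y + d True m (x, t) y) \<partial>\<sigma>)"
        by (intro nn_integral_cmult borel_measurable_SUP) auto
      also have "(\<integral>\<^sup>+ y. (SUP m. d False m (x, t) y + d True m (x, t) y) \<partial>\<sigma>)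
          = (SUP m. (\<integral>\<^sup>+ y. d False m (x, t) y + d True m (x, t) y \<partial>\<sigma>))"
        using d_mono by (intro nn_integral_monotone_convergence_SUP) (auto simp: incseq_def le_fun_def intro: add_mono)
      also have "\<dots> = (SUP m. h m (x, t))"
        unfolding h_def g_def by (subst nn_integral_add) auto
      finally show ?thesis .
    qed
    \<comment> \<open>The constant 4 comes from squaring a sum of two terms; the bound is uniform in
      \<open>m\<close> because \<open>M\<close> is.\<close>
    have h_bound: "(\<integral>\<^sup>+ p. (h m p)\<^sup>2 \<partial>nu) \<le> 4 * M" for m
    proof -
      have "(\<integral>\<^sup>+ p. (h m p)\<^sup>2 \<partial>nu) \<le> (\<integral>\<^sup>+ p. 2 * (g False m p)\<^sup>2 + 2 * (g True m p)\<^sup>2 \<partial>nu)"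
        unfolding h_def by (intro nn_integral_mono ennreal_square_add_le)
      also have "\<dots> = 2 * (\<integral>\<^sup>+ p. (g False m p)\<^sup>2 \<partial>nu) + 2 * (\<integral>\<^sup>+ p. (g True m p)\<^sup>2 \<partial>nu)"
        by (simp add: nn_integral_add nn_integral_cmult)
      also have "\<dots> \<le> 2 * M + 2 * M" by (intro add_mono mult_left_mono g_bound) auto
      also have "\<dots> = 4 * M" by (simp add: distrib_right[symmetric])
      finally show ?thesis .
    qed
    have "(\<integral>\<^sup>+ p. (nn_poisson_op lam \<sigma> (\<lambda>y. ennreal (f y)) p)\<^sup>2 \<partial>\<mu>)
        \<le> (\<integral>\<^sup>+ p. ennreal ((snd p)\<^sup>2) * (ennreal (C\<^sup>2) * (SUP m. (h m p)\<^sup>2)) \<partial>\<mu>)"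
    proof (rule nn_integral_mono)
      fix p assume "p \<in> space \<mu>"
      then obtain x t where p: "p = (x, t)" "0 < x" "0 < t" by (auto simp: space_mu)
      have "(nn_poisson_op lam \<sigma> (\<lambda>y. ennreal (f y)) p)\<^sup>2 \<le> (ennreal (C * t) * (SUP m. h m p))\<^sup>2"
        unfolding p using op_le[OF p(2,3)] by (intro power_mono) auto
      also have "\<dots> = ennreal (t\<^sup>2) * (ennreal (C\<^sup>2) * (SUP m. h m p)\<^sup>2)"
        using C p by (simp add: power_mult_distrib ennreal_power ennreal_mult' mult_ac)
      also have "\<dots> \<le> ennreal (t\<^sup>2) * (ennreal (C\<^sup>2) * (SUP m. (h m p)\<^sup>2))"
        using ennreal_SUP_square_le[OF h_inc] by (intro mult_left_mono) auto
      finally show "(nn_poisson_op lam \<sigma> (\<lambda>y. ennreal (f y)) p)\<^sup>2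
          \<le> ennreal ((snd p)\<^sup>2) * (ennreal (C\<^sup>2) * (SUP m. (h m p)\<^sup>2))" by (simp add: p)
    qed
    also have "\<dots> = (\<integral>\<^sup>+ p. ennreal (C\<^sup>2) * (SUP m. (h m p)\<^sup>2) \<partial>nu)"
      by (rule nn_integral_nu[symmetric]) measurable
    also have "\<dots> = ennreal (C\<^sup>2) * (SUP m. \<integral>\<^sup>+ p. (h m p)\<^sup>2 \<partial>nu)"
      using h_inc
      by (subst nn_integral_cmult, measurable, subst nn_integral_monotone_convergence_SUP)
        (auto simp: incseq_def le_fun_def intro: power_mono)
    also have "\<dots> \<le> ennreal (C\<^sup>2) * (4 * M)"
      by (intro mult_left_mono SUP_least h_bound) auto
    also have "\<dots> = ennreal ((C_suff * (F + B))\<^sup>2) * (\<integral>\<^sup>+ y. ennreal ((f y)\<^sup>2) \<partial>\<sigma>)"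
    proof -
      have "ennreal (C\<^sup>2) * (4 * ennreal ((64 * C_test * (F + B))\<^sup>2)) = ennreal (C\<^sup>2 * (4 * (64 * C_test * (F + B))\<^sup>2))"
        by (simp add: ennreal_mult')
      also have "C\<^sup>2 * (4 * (64 * C_test * (F + B))\<^sup>2) = (C_suff * (F + B))\<^sup>2"
        by (simp add: C_suff_def C_def[symmetric] power_mult_distrib)
      finally show ?thesis unfolding M_def by (simp add: mult.assoc[symmetric])
    qed
    finally show ?thesis .
  qed
qed

end

section \<open>From the two-weight inequality to testing\<close>

text \<open>This weighted Young inequality stands in for Cauchy-Schwarz in the duality argument.
  There \<open>b\<close> is a Poisson integral, and the two-weight inequality cancels the factor
  \<open>1 / N^2\<close>, so the second term can be absorbed.\<close>

lemma two_mult_le_weighted_squares: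
  fixes a b :: ennreal and N :: real
  assumes "0 < N"
  shows "2 * (a * b) \<le> ennreal (N\<^sup>2) * a\<^sup>2 + ennreal (1 / N\<^sup>2) * b\<^sup>2"
proof (cases a; cases b)
  fix r s assume a: "a = ennreal r" "0 \<le> r" and b: "b = ennreal s" "0 \<le> s"
  have "0 \<le> (N * r - s / N)\<^sup>2" by simp
  also have "\<dots> = N\<^sup>2 * r\<^sup>2 + 1 / N\<^sup>2 * s\<^sup>2 - 2 * (r * s)"
    using assms by (simp add: power2_eq_square field_simps)
  finally have "2 * (r * s) \<le> N\<^sup>2 * r\<^sup>2 + 1 / N\<^sup>2 * s\<^sup>2" by simp
  then have "ennreal (2 * (r * s)) \<le> ennreal (N\<^sup>2 * r\<^sup>2 + 1 / N\<^sup>2 * s\<^sup>2)" by (rule ennreal_leI)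
  also have "\<dots> = ennreal (N\<^sup>2) * a\<^sup>2 + ennreal (1 / N\<^sup>2) * b\<^sup>2"
    unfolding a(1) b(1) using a b by (subst ennreal_plus) (auto simp: ennreal_power ennreal_mult'[symmetric] simp del: ennreal_plus)
  finally show ?thesis using a b by (simp add: ennreal_mult')
qed (use assms in \<open>auto simp: power2_eq_square ennreal_mult_top\<close>)

section \<open>Best constants and monotonicity of the conditions\<close>

lemma best_constant_le: "0 \<le> K \<Longrightarrow> P K \<Longrightarrow> best_constant P \<le> ennreal K"
  unfolding best_constant_def by (intro Inf_lower) auto

lemma best_constant_approx:
  assumes "best_constant P < top" "0 < e"
  shows "\<exists>K\<ge>0. P K \<and> ennreal K < best_constant P + ennreal e"
proof -
  have "best_constant P < best_constant P + ennreal e"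
    using assms by (cases "best_constant P") (auto simp: ennreal_plus[symmetric] ennreal_less_iff simp del: ennreal_plus)
  then show ?thesis
    unfolding best_constant_def by (subst (asm) (1) Inf_less_iff) auto
qed

lemma forward_testing_mono: "forward_testing lam \<sigma> \<mu> F \<Longrightarrow> 0 \<le> F \<Longrightarrow> F \<le> F' \<Longrightarrow> forward_testing lam \<sigma> \<mu> F'"
  unfolding forward_testing_def
  by (meson ennreal_leI mult_right_mono order_trans power_mono zero_le)

lemma backward_testing_mono: "backward_testing lam \<sigma> \<mu> B \<Longrightarrow> 0 \<le> B \<Longrightarrow> B \<le> B' \<Longrightarrow> backward_testing lam \<sigma> \<mu> B'"
  unfolding backward_testing_def
  by (meson ennreal_leI mult_right_mono order_trans power_mono zero_le)

lemma two_weight_ineq_mono: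
  assumes "two_weight_ineq lam \<sigma> \<mu> N" "N \<le> N'"
  shows "two_weight_ineq lam \<sigma> \<mu> N'"
proof -
  have "N * L2_norm \<sigma> f \<le> N' * L2_norm \<sigma> f" for f
    using assms(2) by (intro mult_right_mono) (auto simp: L2_norm_def)
  then show ?thesis using assms(1) unfolding two_weight_ineq_def by (meson order_trans)
qed

section \<open>Nonnegative and signed functions; necessity of the testing conditions\<close>

context weight_pair
begin

lemma poisson_op_eq:
  "poisson_op lam \<sigma> f p = (LINT y|\<sigma>. ker (snd p) (fst p) y * f y)"
  by (simp add: poisson_op_def split: prod.split)

text \<open>By the convergence clause of \<open>two_weight_ineq\<close>, the Bochner integral agrees
  almost everywhere with the \<open>[0, \<infinity>]\<close>-valued one when \<open>h\<close> is
  nonnegative, so the inequality carries over with the same constant.\<close>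

lemma two_weight_nn:
  assumes tw: "two_weight_ineq lam \<sigma> \<mu> N" and N: "0 \<le> N"
    and h [measurable]: "h \<in> borel_measurable \<sigma>" and h0: "\<And>y. 0 \<le> h y"
    and h2: "integrable \<sigma> (\<lambda>y. (h y)\<^sup>2)"
  shows "(\<integral>\<^sup>+ p. (nn_poisson_op lam \<sigma> (\<lambda>y. ennreal (h y)) p)\<^sup>2 \<partial>\<mu>)
    \<le> ennreal (N\<^sup>2) * (\<integral>\<^sup>+ y. ennreal ((h y)\<^sup>2) \<partial>\<sigma>)"
proof -
  have "h \<in> L2 \<sigma>" using h h2 by (simp add: L2_def)
  then have ae: "AE p in \<mu>. integrable \<sigma> (\<lambda>y. ker (snd p) (fst p) y * h y)"
    and int: "integrable \<mu> (\<lambda>p. (poisson_op lam \<sigma> h p)\<^sup>2)"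
    and le: "L2_norm \<mu> (poisson_op lam \<sigma> h) \<le> N * L2_norm \<sigma> h"
    using tw unfolding two_weight_ineq_def L2_def by (auto simp: case_prod_beta')
  have "(L2_norm \<mu> (poisson_op lam \<sigma> h))\<^sup>2 \<le> (N * L2_norm \<sigma> h)\<^sup>2"
    using le by (intro power_mono) (auto simp: L2_norm_def)
  then have sq: "(\<integral>p. (poisson_op lam \<sigma> h p)\<^sup>2 \<partial>\<mu>) \<le> N\<^sup>2 * (\<integral>y. (h y)\<^sup>2 \<partial>\<sigma>)"
    by (simp add: L2_norm_def power_mult_distrib)
  have "(\<integral>\<^sup>+ p. (nn_poisson_op lam \<sigma> (\<lambda>y. ennreal (h y)) p)\<^sup>2 \<partial>\<mu>) = (\<integral>\<^sup>+ p. ennreal ((poisson_op lam \<sigma> h p)\<^sup>2) \<partial>\<mu>)"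
  proof (rule nn_integral_cong_AE)
    show "AE p in \<mu>. (nn_poisson_op lam \<sigma> (\<lambda>y. ennreal (h y)) p)\<^sup>2 = ennreal ((poisson_op lam \<sigma> h p)\<^sup>2)"
      using ae AE_space
    proof eventually_elim
      case (elim p)
      then have t: "0 < snd p" by (auto simp: space_mu)
      have nn: "0 \<le> ker (snd p) (fst p) y * h y" for y
        using kernel_nonneg[OF lam, of "snd p"] t h0 by simp
      have "nn_poisson_op lam \<sigma> (\<lambda>y. ennreal (h y)) p = (\<integral>\<^sup>+ y. ennreal (ker (snd p) (fst p) y * h y) \<partial>\<sigma>)"
        unfolding nn_poisson_op_eq using h0 by (simp add: ennreal_mult'')
      also have "\<dots> = ennreal (poisson_op lam \<sigma> h p)"
        unfolding poisson_op_eq using elim nn by (intro nn_integral_eq_integral) auto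
      finally show ?case
        using nn by (simp add: ennreal_power poisson_op_eq)
    qed
  qed
  also have "\<dots> = ennreal (\<integral>p. (poisson_op lam \<sigma> h p)\<^sup>2 \<partial>\<mu>)"
    using int by (intro nn_integral_eq_integral) auto
  also have "\<dots> \<le> ennreal (N\<^sup>2 * (\<integral>y. (h y)\<^sup>2 \<partial>\<sigma>))" using sq by (rule ennreal_leI)
  also have "\<dots> = ennreal (N\<^sup>2) * (\<integral>\<^sup>+ y. ennreal ((h y)\<^sup>2) \<partial>\<sigma>)"
    using h2 by (subst nn_integral_eq_integral) (auto simp: ennreal_mult')
  finally show ?thesis .
qed

lemma pos_interval_sets: "pos_interval I \<Longrightarrow> I \<in> sets borel" "pos_interval I \<Longrightarrow> I \<in> sets \<sigma>"
proof -
  show *: "I \<in> sets borel" if "pos_interval I"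
    using that by (intro real_interval_borel_measurable) (simp add: pos_interval_def)
  show "I \<in> sets \<sigma>" if "pos_interval I"
    using *[OF that] that by (intro sets_sigma) (auto simp: pos_interval_def)
qed

lemma two_weight_imp_forward:
  assumes tw: "two_weight_ineq lam \<sigma> \<mu> N" and N: "0 < N"
  shows "forward_testing lam \<sigma> \<mu> N"
  unfolding forward_testing_def
proof (intro allI impI)
  fix I assume I: "pos_interval I"
  note Is [measurable] = pos_interval_sets(2)[OF I]
  show "(\<integral>\<^sup>+ p. (nn_poisson_op lam \<sigma> (indicator I) p)\<^sup>2 * indicator (tent (triple I)) p \<partial>\<mu>) \<le> ennreal (N\<^sup>2) * emeasure \<sigma> I"
  \<comment> \<open>An interval touching the origin may have infinite mass. Its indicator is then
    not in \<open>L2 \<sigma>\<close>, but the right side is infinite because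
    \<open>0 < N\<close>.\<close>
  proof (cases "emeasure \<sigma> I < \<infinity>")
    case False
    then have "ennreal (N\<^sup>2) * emeasure \<sigma> I = top" using N by (auto simp: less_top[symmetric] ennreal_mult_top)
    then show ?thesis by simp
  next
    case True
    have "(\<integral>\<^sup>+ p. (nn_poisson_op lam \<sigma> (indicator I) p)\<^sup>2 * indicator (tent (triple I)) p \<partial>\<mu>)
        \<le> (\<integral>\<^sup>+ p. (nn_poisson_op lam \<sigma> (\<lambda>y. ennreal (indicator I y)) p)\<^sup>2 \<partial>\<mu>)"
      unfolding ennreal_indicator by (intro nn_integral_mono) (auto split: split_indicator)
    also have "\<dots> \<le> ennreal (N\<^sup>2) * (\<integral>\<^sup>+ y. ennreal ((indicator I y)\<^sup>2) \<partial>\<sigma>)"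
    proof (rule two_weight_nn[OF tw])
      have "(\<lambda>y. (indicator I y)\<^sup>2 :: real) = indicator I" by (auto simp: fun_eq_iff indicator_def)
      then show "integrable \<sigma> (\<lambda>y. (indicator I y)\<^sup>2 :: real)"
        using Is True by (simp add: integrable_real_indicator)
    qed (use N Is in auto)
    also have "(\<integral>\<^sup>+ y. ennreal ((indicator I y)\<^sup>2) \<partial>\<sigma>) = (\<integral>\<^sup>+ y. indicator I y \<partial>\<sigma>)"
      by (intro nn_integral_cong) (auto simp: indicator_def)
    finally show ?thesis using Is by simp
  qed
qed

text \<open>Applied to the absolute value of \<open>f\<close>, the bound makes the dominating
  integral finite almost everywhere. This gives convergence of the Bochner integral and, by
  domination, the estimate with the same \<open>N\<close>.\<close>

lemma nn_two_weight_imp: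
  assumes N: "0 \<le> N"
    and nn: "\<And>f. f \<in> borel_measurable \<sigma> \<Longrightarrow> (\<And>y. 0 \<le> f y) \<Longrightarrow> integrable \<sigma> (\<lambda>y. (f y)\<^sup>2) \<Longrightarrow>
      (\<integral>\<^sup>+ p. (nn_poisson_op lam \<sigma> (\<lambda>y. ennreal (f y)) p)\<^sup>2 \<partial>\<mu>) \<le> ennreal (N\<^sup>2) * (\<integral>\<^sup>+ y. ennreal ((f y)\<^sup>2) \<partial>\<sigma>)"
  shows "two_weight_ineq lam \<sigma> \<mu> N"
  unfolding two_weight_ineq_def
proof (intro ballI)
  fix f assume "f \<in> L2 \<sigma>"
  then have f [measurable]: "f \<in> borel_measurable \<sigma>" and f2: "integrable \<sigma> (\<lambda>y. (f y)\<^sup>2)"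
    by (auto simp: L2_def)
  let ?P = "nn_poisson_op lam \<sigma> (\<lambda>y. ennreal \<bar>f y\<bar>)"
  have P_meas [measurable]: "?P \<in> borel_measurable \<mu>" by measurable
  have "(\<integral>\<^sup>+ p. (?P p)\<^sup>2 \<partial>\<mu>) \<le> ennreal (N\<^sup>2) * (\<integral>\<^sup>+ y. ennreal (\<bar>f y\<bar>\<^sup>2) \<partial>\<sigma>)"
    using f2 by (intro nn) auto
  also have "\<dots> = ennreal (N\<^sup>2 * (\<integral>y. (f y)\<^sup>2 \<partial>\<sigma>))"
    using f2 by (subst nn_integral_eq_integral) (auto simp: ennreal_mult')
  finally have bound: "(\<integral>\<^sup>+ p. (?P p)\<^sup>2 \<partial>\<mu>) \<le> ennreal (N\<^sup>2 * (\<integral>y. (f y)\<^sup>2 \<partial>\<sigma>))" .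
  then have "(\<integral>\<^sup>+ p. (?P p)\<^sup>2 \<partial>\<mu>) \<noteq> \<infinity>" by (auto simp: top_unique)
  then have "AE p in \<mu>. (?P p)\<^sup>2 \<noteq> \<infinity>" by (intro nn_integral_PInf_AE) auto
  then have fin: "AE p in \<mu>. ?P p < \<infinity>"
    by eventually_elim (auto simp: power2_eq_square ennreal_mult_eq_top_iff less_top[symmetric])
  have P_norm: "(\<integral>\<^sup>+ y. ennreal (norm (ker (snd p) (fst p) y * f y)) \<partial>\<sigma>) = ?P p"
    if "p \<in> space \<mu>" for p
  proof -
    have "0 < snd p" using that by (auto simp: space_mu)
    then have "norm (ker (snd p) (fst p) y * f y) = ker (snd p) (fst p) y * \<bar>f y\<bar>" for y
      using kernel_nonneg[OF lam, of "snd p"] by (simp add: abs_mult)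
    then show ?thesis unfolding nn_poisson_op_eq by (simp add: ennreal_mult'')
  qed
  have ae_int: "AE p in \<mu>. integrable \<sigma> (\<lambda>y. ker (snd p) (fst p) y * f y)"
    using fin AE_space
  proof eventually_elim
    case (elim p)
    then show ?case using P_norm[of p] by (intro integrableI_bounded) auto
  qed
  have op_meas: "poisson_op lam \<sigma> f \<in> borel_measurable \<mu>"
  proof -
    have "(\<lambda>z. f (snd z)) \<in> borel_measurable (\<mu> \<Otimes>\<^sub>M \<sigma>)"
      using measurable_compose[OF measurable_snd f] by simp
    then have "(\<lambda>z. ker (snd (fst z)) (fst (fst z)) (snd z) * f (snd z)) \<in> borel_measurable (\<mu> \<Otimes>\<^sub>M \<sigma>)"
      by (intro borel_measurable_times kernel_pair_measurable)
    then have "(\<lambda>p. LINT y|\<sigma>. ker (snd p) (fst p) y * f y) \<in> borel_measurable \<mu>"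
      by (intro sigma.borel_measurable_lebesgue_integral) (simp add: case_prod_beta')
    then show ?thesis unfolding poisson_op_eq[abs_def] .
  qed
  have sq: "(\<integral>\<^sup>+ p. ennreal ((poisson_op lam \<sigma> f p)\<^sup>2) \<partial>\<mu>) \<le> ennreal (N\<^sup>2 * (\<integral>y. (f y)\<^sup>2 \<partial>\<sigma>))"
  proof (rule order_trans[OF nn_integral_mono_AE bound])
    show "AE p in \<mu>. ennreal ((poisson_op lam \<sigma> f p)\<^sup>2) \<le> (?P p)\<^sup>2"
      using ae_int AE_space
    proof eventually_elim
      case (elim p)
      have "ennreal \<bar>poisson_op lam \<sigma> f p\<bar> \<le> ?P p"
        using integral_norm_bound_ennreal[OF elim(1)] P_norm[OF elim(2)] by (simp add: poisson_op_eq)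
      then have "(ennreal \<bar>poisson_op lam \<sigma> f p\<bar>)\<^sup>2 \<le> (?P p)\<^sup>2" by (intro power_mono) auto
      then show ?case by (simp add: ennreal_power)
    qed
  qed
  have op_int: "integrable \<mu> (\<lambda>p. (poisson_op lam \<sigma> f p)\<^sup>2)"
    using op_meas sq by (intro integrableI_bounded) (auto intro: le_less_trans)
  have "ennreal (\<integral>p. (poisson_op lam \<sigma> f p)\<^sup>2 \<partial>\<mu>) \<le> ennreal (N\<^sup>2 * (\<integral>y. (f y)\<^sup>2 \<partial>\<sigma>))"
    using sq op_int by (subst (asm) nn_integral_eq_integral) auto
  then have "(\<integral>p. (poisson_op lam \<sigma> f p)\<^sup>2 \<partial>\<mu>) \<le> N\<^sup>2 * (\<integral>y. (f y)\<^sup>2 \<partial>\<sigma>)"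
    by (subst (asm) ennreal_le_iff) auto
  then have "sqrt (\<integral>p. (poisson_op lam \<sigma> f p)\<^sup>2 \<partial>\<mu>) \<le> sqrt (N\<^sup>2 * (\<integral>y. (f y)\<^sup>2 \<partial>\<sigma>))" by simp
  then have "L2_norm \<mu> (poisson_op lam \<sigma> f) \<le> N * L2_norm \<sigma> f"
    using N by (simp add: L2_norm_def real_sqrt_mult)
  then show "(AE (x, t) in \<mu>. integrable \<sigma> (\<lambda>y. ker t x y * f y)) \<and>
        poisson_op lam \<sigma> f \<in> L2 \<mu> \<and> L2_norm \<mu> (poisson_op lam \<sigma> f) \<le> N * L2_norm \<sigma> f"
    using ae_int op_meas op_int by (auto simp: L2_def case_prod_beta')
qed

lemma testing_imp_two_weight:
  assumes "forward_testing lam \<sigma> \<mu> F" "backward_testing lam \<sigma> \<mu> B" "0 < F" "0 < B"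
  shows "two_weight_ineq lam \<sigma> \<mu> (C_suff * (F + B))"
  using assms C_suff_pos by (intro nn_two_weight_imp nn_poisson_op_bound) auto


text \<open>Let \<open>u\<close> be the adjoint of the testing function and \<open>h\<close> a
  truncation of \<open>u\<close>. The square integral \<open>X\<close> of \<open>h\<close> is at
  most the pairing of \<open>u\<close> with \<open>h\<close>, which by Fubini is the pairing of
  \<open>t\<close> on the box with the Poisson integral of \<open>h\<close>. Young's inequality and
  the two-weight inequality give \<open>X + X \<le> X + N^2 * G\<close>, and the truncation makes
  \<open>X\<close> finite.\<close>

lemma two_weight_imp_backward:
  assumes tw: "two_weight_ineq lam \<sigma> \<mu> N" and N: "0 < N"
  shows "backward_testing lam \<sigma> \<mu> N"
  unfolding backward_testing_def
proof (intro allI impI)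
  fix I assume I: "pos_interval I"
  define u where "u y = nn_poisson_adj lam \<mu> (\<lambda>(x, t). ennreal t * indicator (tent I) (x, t)) y" for y
  define G where "G = (\<integral>\<^sup>+ p. ennreal ((snd p)\<^sup>2) * indicator (tent I) p \<partial>\<mu>)"
  have box [measurable]: "carleson_box I \<in> sets \<mu>"
  proof (rule sets_mu)
    show "carleson_box I \<in> sets borel"
      unfolding carleson_box_def borel_prod[symmetric] using pos_interval_sets(1)[OF I] by (intro pair_measureI) auto
    show "carleson_box I \<subseteq> pos_quadrant" using I by (auto simp: carleson_box_def pos_interval_def)
  qed
  have box_tent: "indicator (tent I) p = (indicator (carleson_box I) p :: ennreal)" if "p \<in> space \<mu>" for p
    using that by (auto simp: space_mu tent_def carleson_box_def indicator_def)
  have G: "G = (\<integral>\<^sup>+ p. ennreal ((snd p)\<^sup>2) * indicator (carleson_box I) p \<partial>\<mu>)"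
    unfolding G_def by (intro nn_integral_cong) (simp add: box_tent)
  have "(\<integral>\<^sup>+ y. (u y)\<^sup>2 * indicator (triple I) y \<partial>\<sigma>) \<le> ennreal (N\<^sup>2) * G"
  proof (cases "G = top")
    case True
    then show ?thesis using N by (simp add: ennreal_mult_top)
  next
    case False
    \<comment> \<open>Since \<open>G\<close> is finite, weighting \<open>\<mu>\<close> by
      \<open>t^2\<close> on the box gives a finite measure, to which Fubini applies. The kernel is
      divided by \<open>t\<close> to compensate for the extra factor.\<close>
    define W where "W = density \<mu> (\<lambda>p. ennreal ((snd p)\<^sup>2) * indicator (carleson_box I) p)"
    have W_int: "(\<integral>\<^sup>+ p. k p \<partial>W) = (\<integral>\<^sup>+ p. ennreal ((snd p)\<^sup>2) * indicator (carleson_box I) p * k p \<partial>\<mu>)"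
      if "k \<in> borel_measurable \<mu>" for k
      unfolding W_def using that by (subst nn_integral_density) auto
    have sets_W [measurable_cong]: "sets W = sets \<mu>" by (simp add: W_def)
    have "emeasure W (space W) = G"
      unfolding W_def G by (subst emeasure_density) (auto intro!: nn_integral_cong split: split_indicator)
    then interpret W: finite_measure W using False by (intro finite_measureI) simp
    interpret pair_sigma_finite W \<sigma> ..
    have kt_meas [measurable]: "(\<lambda>z. ennreal (ker (snd (fst z)) (fst (fst z)) (snd z) / snd (fst z)))
        \<in> borel_measurable (W \<Otimes>\<^sub>M \<sigma>)"
    proof -
      have "(\<lambda>z. ennreal (ker (snd (fst z)) (fst (fst z)) (snd z) / snd (fst z)))
        \<in> borel_measurable (\<mu> \<Otimes>\<^sub>M \<sigma>)"
        using kernel_pair_measurable by (intro measurable_compose[OF _ measurable_ennreal] borel_measurable_divide) auto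
      moreover have "sets (W \<Otimes>\<^sub>M \<sigma>) = sets (\<mu> \<Otimes>\<^sub>M \<sigma>)" by (intro sets_pair_measure_cong sets_W refl)
      ultimately show ?thesis by (simp cong: measurable_cong_sets)
    qed
    have u_eq: "u y = (\<integral>\<^sup>+ p. ennreal (ker (snd p) (fst p) y / snd p) \<partial>W)" for y
    proof -
      have "(\<integral>\<^sup>+ p. ennreal (ker (snd p) (fst p) y / snd p) \<partial>W)
        = (\<integral>\<^sup>+ p. ennreal ((snd p)\<^sup>2) * indicator (carleson_box I) p * ennreal (ker (snd p) (fst p) y / snd p) \<partial>\<mu>)"
        by (intro W_int) measurable
      also have "\<dots> = u y"
        unfolding u_def nn_poisson_adj_def
      proof (rule nn_integral_cong)
        fix p assume p: "p \<in> space \<mu>"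
        obtain x t where xt: "p = (x, t)" "0 < t" using p by (auto simp: space_mu)
        have "ennreal (t\<^sup>2) * ennreal (ker t x y / t) = ennreal (ker t x y) * ennreal t"
          using xt kernel_nonneg[OF lam, of t x y] by (simp add: ennreal_mult'[symmetric] power2_eq_square)
        then show "ennreal ((snd p)\<^sup>2) * indicator (carleson_box I) p * ennreal (ker (snd p) (fst p) y / snd p)
            = (case p of (x, t) \<Rightarrow> ennreal (ker t x y) * (case (x, t) of (x, t) \<Rightarrow> ennreal t * indicator (tent I) (x, t)))"
          using box_tent[OF p] by (simp add: xt split: split_indicator)
      qed
      finally show ?thesis by simp
    qed
    have u_meas [measurable]: "u \<in> borel_measurable \<sigma>"
    proof -
      have "(\<lambda>y. \<integral>\<^sup>+ p. ennreal (ker (snd p) (fst p) y / snd p) \<partial>W) \<in> borel_measurable \<sigma>"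
        using measurable_compose[OF measurable_pair_swap' kt_meas]
        by (intro W.borel_measurable_nn_integral) (simp add: case_prod_beta')
      then show ?thesis unfolding u_eq[abs_def] .
    qed
    define J where "J n = {1 / real (Suc n)..real (Suc n)}" for n :: nat
    have J_sets [measurable]: "J n \<in> sets \<sigma>" for n
      unfolding J_def by (intro sets_sigma) (auto intro: less_le_trans[rotated])
    have J_fin: "emeasure \<sigma> (J n) < \<infinity>" for n unfolding J_def by (intro emeasure_compact_interval) simp
    \<comment> \<open>\<open>u\<close> may take the value infinity and is not known to be square
      integrable. Cutting it at height \<open>n\<close> and restricting it to a compact interval
      gives functions in \<open>L2 \<sigma>\<close> that increase to \<open>u\<close> on the half
      line.\<close>
    define h where "h n y = enn2real (min (u y) (of_nat n)) * indicator (J n) y" for n y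
    have h_enn: "ennreal (h n y) = min (u y) (of_nat n) * indicator (J n) y" for n y
    proof -
      have "min (u y) (of_nat n) < top" by (auto simp: min_less_iff_disj of_nat_less_top)
      then show ?thesis by (simp add: h_def split: split_indicator)
    qed
    have h0: "0 \<le> h n y" for n y by (simp add: h_def)
    have h_meas [measurable]: "h n \<in> borel_measurable \<sigma>" for n unfolding h_def by measurable
    have h_le: "h n y \<le> real n * indicator (J n) y" for n y
    proof -
      have "ennreal (h n y) \<le> ennreal (real n * indicator (J n) y)"
        unfolding h_enn by (auto simp: ennreal_of_nat_eq_real_of_nat split: split_indicator)
      then show ?thesis by (subst (asm) ennreal_le_iff) auto
    qed
    have h2: "integrable \<sigma> (\<lambda>y. (h n y)\<^sup>2)" for n
    proof (rule Bochner_Integration.integrable_bound)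
      show "integrable \<sigma> (\<lambda>y. (real n)\<^sup>2 * indicator (J n) y)"
        using J_fin by (intro integrable_mult_right integrable_real_indicator) auto
      have "(h n y)\<^sup>2 \<le> (real n)\<^sup>2 * indicator (J n) y" for y
        using power_mono[OF h_le[of n y] h0, of 2] by (simp split: split_indicator_asm split_indicator)
      then show "AE y in \<sigma>. norm ((h n y)\<^sup>2) \<le> norm ((real n)\<^sup>2 * indicator (J n) y)" by simp
    qed measurable
    have X_le: "(\<integral>\<^sup>+ y. ennreal ((h n y)\<^sup>2) \<partial>\<sigma>) \<le> ennreal (N\<^sup>2) * G" for n
    proof -
      define X where "X = (\<integral>\<^sup>+ y. ennreal ((h n y)\<^sup>2) \<partial>\<sigma>)"
      have X_fin: "X \<noteq> top" unfolding X_def using h2 by (subst nn_integral_eq_integral) auto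
      let ?P = "nn_poisson_op lam \<sigma> (\<lambda>y. ennreal (h n y))"
      have P_meas [measurable]: "?P \<in> borel_measurable \<mu>" by measurable
      have "X \<le> (\<integral>\<^sup>+ y. u y * ennreal (h n y) \<partial>\<sigma>)"
        unfolding X_def
      proof (rule nn_integral_mono)
        fix y
        have "ennreal (h n y) \<le> u y" unfolding h_enn by (auto split: split_indicator)
        then have "ennreal (h n y) * ennreal (h n y) \<le> u y * ennreal (h n y)" by (rule mult_right_mono) simp
        then show "ennreal ((h n y)\<^sup>2) \<le> u y * ennreal (h n y)"
          using h0 by (simp add: power2_eq_square ennreal_mult')
      qed
      also have "\<dots> = (\<integral>\<^sup>+ y. \<integral>\<^sup>+ p. ennreal (ker (snd p) (fst p) y / snd p) * ennreal (h n y) \<partial>W \<partial>\<sigma>)"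
        unfolding u_eq by (intro nn_integral_cong nn_integral_multc[symmetric]) measurable
      also have "\<dots> = (\<integral>\<^sup>+ p. \<integral>\<^sup>+ y. ennreal (ker (snd p) (fst p) y / snd p) * ennreal (h n y) \<partial>\<sigma> \<partial>W)"
      proof -
        have "(\<lambda>z. ennreal (h n (snd z))) \<in> borel_measurable (W \<Otimes>\<^sub>M \<sigma>)"
          by (rule measurable_compose[OF measurable_snd]) measurable
        then have "(\<lambda>(p, y). ennreal (ker (snd p) (fst p) y / snd p) * ennreal (h n y)) \<in> borel_measurable (W \<Otimes>\<^sub>M \<sigma>)"
          using kt_meas by (simp add: case_prod_beta')
        then show ?thesis by (rule Fubini')
      qed
      also have "\<dots> = (\<integral>\<^sup>+ p. ennreal (1 / snd p) * ?P p \<partial>W)"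
      proof (rule nn_integral_cong)
        fix p assume "p \<in> space W"
        then have t: "0 < snd p" by (auto simp: W_def space_mu)
        have "(\<integral>\<^sup>+ y. ennreal (ker (snd p) (fst p) y / snd p) * ennreal (h n y) \<partial>\<sigma>)
            = (\<integral>\<^sup>+ y. ennreal (1 / snd p) * (ennreal (ker (snd p) (fst p) y) * ennreal (h n y)) \<partial>\<sigma>)"
          using t by (intro nn_integral_cong) (simp add: mult.assoc[symmetric] ennreal_mult'[symmetric])
        also have "\<dots> = ennreal (1 / snd p) * ?P p"
          unfolding nn_poisson_op_eq by (rule nn_integral_cmult) measurable
        finally show "(\<integral>\<^sup>+ y. ennreal (ker (snd p) (fst p) y / snd p) * ennreal (h n y) \<partial>\<sigma>)
            = ennreal (1 / snd p) * ?P p" .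
      qed
      also have "\<dots> = (\<integral>\<^sup>+ p. ennreal ((snd p)\<^sup>2) * indicator (carleson_box I) p * (ennreal (1 / snd p) * ?P p) \<partial>\<mu>)"
        by (intro W_int) measurable
      also have "\<dots> = (\<integral>\<^sup>+ p. (ennreal (snd p) * indicator (carleson_box I) p) * ?P p \<partial>\<mu>)"
      proof (rule nn_integral_cong)
        fix p assume "p \<in> space \<mu>"
        then have t: "0 < snd p" by (auto simp: space_mu)
        then have "ennreal ((snd p)\<^sup>2) * ennreal (1 / snd p) = ennreal (snd p)"
          by (simp add: ennreal_mult'[symmetric] power2_eq_square)
        then show "ennreal ((snd p)\<^sup>2) * indicator (carleson_box I) p * (ennreal (1 / snd p) * ?P p)
            = (ennreal (snd p) * indicator (carleson_box I) p) * ?P p"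
          by (auto simp: mult.assoc[symmetric] split: split_indicator)
      qed
      finally have X1: "X \<le> (\<integral>\<^sup>+ p. (ennreal (snd p) * indicator (carleson_box I) p) * ?P p \<partial>\<mu>)" .
      have "X + X = 2 * X" by (simp add: mult_2)
      also have "\<dots> \<le> 2 * (\<integral>\<^sup>+ p. (ennreal (snd p) * indicator (carleson_box I) p) * ?P p \<partial>\<mu>)"
        using X1 by (rule mult_left_mono) simp
      also have "\<dots> = (\<integral>\<^sup>+ p. 2 * ((ennreal (snd p) * indicator (carleson_box I) p) * ?P p) \<partial>\<mu>)"
        by (rule nn_integral_cmult[symmetric]) measurable
      also have "\<dots> \<le> (\<integral>\<^sup>+ p. ennreal (N\<^sup>2) * (ennreal ((snd p)\<^sup>2) * indicator (carleson_box I) p) + ennreal (1 / N\<^sup>2) * (?P p)\<^sup>2 \<partial>\<mu>)"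
      proof (rule nn_integral_mono)
        fix p assume "p \<in> space \<mu>"
        then have t: "0 < snd p" by (auto simp: space_mu)
        have "(ennreal (snd p) * indicator (carleson_box I) p)\<^sup>2 = ennreal ((snd p)\<^sup>2) * indicator (carleson_box I) p"
          using t by (auto simp: ennreal_power split: split_indicator)
        then show "2 * ((ennreal (snd p) * indicator (carleson_box I) p) * ?P p)
            \<le> ennreal (N\<^sup>2) * (ennreal ((snd p)\<^sup>2) * indicator (carleson_box I) p) + ennreal (1 / N\<^sup>2) * (?P p)\<^sup>2"
          using two_mult_le_weighted_squares[OF N, of "ennreal (snd p) * indicator (carleson_box I) p" "?P p"] by simp
      qed
      also have "\<dots> = ennreal (N\<^sup>2) * G + ennreal (1 / N\<^sup>2) * (\<integral>\<^sup>+ p. (?P p)\<^sup>2 \<partial>\<mu>)"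
        unfolding G by (simp add: nn_integral_add nn_integral_cmult)
      also have "ennreal (1 / N\<^sup>2) * (\<integral>\<^sup>+ p. (?P p)\<^sup>2 \<partial>\<mu>) \<le> ennreal (1 / N\<^sup>2) * (ennreal (N\<^sup>2) * X)"
        unfolding X_def using N h0 h2 by (intro mult_left_mono two_weight_nn[OF tw]) auto
      also have "\<dots> = X" using N by (simp add: mult.assoc[symmetric] ennreal_mult'[symmetric])
      finally have "X + X \<le> X + ennreal (N\<^sup>2) * G" by (simp add: add.commute)
      then have "X \<le> ennreal (N\<^sup>2) * G" using X_fin by (simp add: ennreal_add_left_cancel_le)
      then show ?thesis by (simp add: X_def)
    qed
    have hs_inc: "incseq (\<lambda>n. ennreal (h n y))" for y
    proof (rule incseq_SucI)
      fix n
      have "J n \<subseteq> J (Suc n)" unfolding J_def by (auto intro: order_trans[rotated] simp: field_simps)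
      then have "(indicator (J n) y :: ennreal) \<le> indicator (J (Suc n)) y" by (auto split: split_indicator)
      moreover have "(of_nat n :: ennreal) \<le> of_nat (Suc n)" by simp
      ultimately show "ennreal (h n y) \<le> ennreal (h (Suc n) y)"
        unfolding h_enn by (intro mult_mono min.mono) auto
    qed
    have u_sup: "u y \<le> (SUP n. ennreal (h n y))" if y: "y \<in> space \<sigma>" for y
    proof -
      obtain m where m: "y \<in> J m" using y half_line_exhaustion unfolding space_sigma J_def by blast
      have J_mono: "J m \<subseteq> J n" if "m \<le> n" for n
        using that unfolding J_def by (auto intro: order_trans[rotated] simp: frac_le)
      have "min (u y) (of_nat n) \<le> (SUP n. ennreal (h n y))" for n
      proof -
        have "(of_nat n :: ennreal) \<le> of_nat (max m n)" by (intro of_nat_mono) simp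
        then have "min (u y) (of_nat n) \<le> min (u y) (of_nat (max m n))" by (intro min.mono) auto
        also have "\<dots> = ennreal (h (max m n) y)"
          unfolding h_enn using m J_mono[of "max m n"] by auto
        finally have "min (u y) (of_nat n) \<le> ennreal (h (max m n) y)" .
        then show ?thesis by (rule order_trans) (intro SUP_upper, simp)
      qed
      then have "(SUP n. min (u y) (of_nat n)) \<le> (SUP n. ennreal (h n y))" by (intro SUP_least)
      moreover have "(SUP n. min (u y) (of_nat n)) = u y"
      proof -
        have "(SUP n. inf (u y) (of_nat n :: ennreal)) = inf (u y) (SUP n. of_nat n)"
          by (rule inf_SUP[symmetric])
        then show ?thesis by (simp add: ennreal_SUP_of_nat_eq_top inf_min)
      qed
      ultimately show ?thesis by simp
    qed
    have "(\<integral>\<^sup>+ y. (u y)\<^sup>2 * indicator (triple I) y \<partial>\<sigma>) \<le> (\<integral>\<^sup>+ y. (SUP n. ennreal ((h n y)\<^sup>2)) \<partial>\<sigma>)"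
    proof (rule nn_integral_mono)
      fix y assume y: "y \<in> space \<sigma>"
      have "(u y)\<^sup>2 * indicator (triple I) y \<le> (u y)\<^sup>2" by (auto split: split_indicator)
      also have "\<dots> \<le> (SUP n. ennreal (h n y))\<^sup>2" using u_sup[OF y] by (intro power_mono) auto
      also have "\<dots> \<le> (SUP n. (ennreal (h n y))\<^sup>2)" by (rule ennreal_SUP_square_le[OF hs_inc])
      also have "\<dots> = (SUP n. ennreal ((h n y)\<^sup>2))" using h0 by (simp add: ennreal_power)
      finally show "(u y)\<^sup>2 * indicator (triple I) y \<le> (SUP n. ennreal ((h n y)\<^sup>2))" .
    qed
    also have "\<dots> = (SUP n. \<integral>\<^sup>+ y. ennreal ((h n y)\<^sup>2) \<partial>\<sigma>)"
    proof (rule nn_integral_monotone_convergence_SUP)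
      show "incseq (\<lambda>n y. ennreal ((h n y)\<^sup>2))"
        using hs_inc h0 by (auto simp: incseq_def le_fun_def ennreal_le_iff intro!: ennreal_leI power_mono)
    qed measurable
    also have "\<dots> \<le> ennreal (N\<^sup>2) * G" by (intro SUP_least X_le)
    finally show ?thesis .
  qed
  then show "(\<integral>\<^sup>+ y. (nn_poisson_adj lam \<mu> (\<lambda>(x, t). ennreal t * indicator (tent I) (x, t)) y)\<^sup>2 * indicator (triple I) y \<partial>\<sigma>)
          \<le> ennreal (N\<^sup>2) * (\<integral>\<^sup>+ p. ennreal ((snd p)\<^sup>2) * indicator (tent I) p \<partial>\<mu>)"
    unfolding u_def G_def .
qed

section \<open>Comparison of the best constants\<close>

lemma best_two_weight_le:
  "best_constant (two_weight_ineq lam \<sigma> \<mu>) \<le> ennreal C_suff *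
    (best_constant (forward_testing lam \<sigma> \<mu>) + best_constant (backward_testing lam \<sigma> \<mu>))"
  (is "?N \<le> _ * (?F + ?B)")
proof (rule ennreal_le_epsilon)
  fix e :: real assume "ennreal C_suff * (?F + ?B) < top" and e: "0 < e"
  then have fin: "?F < top" "?B < top" using C_suff_pos by (auto simp: ennreal_mult_less_top)
  \<comment> \<open>Four copies of \<open>d\<close> are spent: one each on choosing \<open>F\<close>
    and \<open>B\<close> nearly optimal, and one each on making them strictly positive.\<close>
  define d where "d = e / (4 * C_suff)"
  have d: "0 < d" using e C_suff_pos by (simp add: d_def)
  obtain F where F: "0 \<le> F" "forward_testing lam \<sigma> \<mu> F" "ennreal F < ?F + ennreal d"
    using best_constant_approx[OF fin(1) d] by blast
  obtain B where B: "0 \<le> B" "backward_testing lam \<sigma> \<mu> B" "ennreal B < ?B + ennreal d"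
    using best_constant_approx[OF fin(2) d] by blast
  have "two_weight_ineq lam \<sigma> \<mu> (C_suff * ((F + d) + (B + d)))"
    using F B d by (intro testing_imp_two_weight forward_testing_mono[OF F(2)] backward_testing_mono[OF B(2)]) auto
  then have "?N \<le> ennreal (C_suff * ((F + d) + (B + d)))"
    using C_suff_pos F B d by (intro best_constant_le) auto
  also have "\<dots> = ennreal C_suff * ((ennreal F + ennreal d) + (ennreal B + ennreal d))"
    using C_suff_pos F B d by (simp add: ennreal_mult'[symmetric] ennreal_plus[symmetric] del: ennreal_plus)
  also have "\<dots> \<le> ennreal C_suff * ((?F + ennreal d + ennreal d) + (?B + ennreal d + ennreal d))"
    using F B by (intro mult_left_mono add_mono) auto
  also have "\<dots> = ennreal C_suff * (?F + ?B) + ennreal C_suff * (ennreal d + ennreal d + ennreal d + ennreal d)"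
    by (simp add: distrib_left add_ac)
  also have "ennreal C_suff * (ennreal d + ennreal d + ennreal d + ennreal d) = ennreal (C_suff * (d + d + d + d))"
    using C_suff_pos d by (simp add: ennreal_mult'[symmetric] ennreal_plus[symmetric] del: ennreal_plus)
  also have "C_suff * (d + d + d + d) = e" using C_suff_pos by (simp add: d_def)
  finally show "?N \<le> ennreal C_suff * (?F + ?B) + ennreal e" .
qed

lemma best_testing_le:
  "best_constant (forward_testing lam \<sigma> \<mu>) + best_constant (backward_testing lam \<sigma> \<mu>)
    \<le> 2 * best_constant (two_weight_ineq lam \<sigma> \<mu>)"
  (is "?F + ?B \<le> 2 * ?N")
proof (rule ennreal_le_epsilon)
  fix e :: real assume "2 * ?N < top" and e: "0 < e"
  then have fin: "?N < top" by (auto simp: ennreal_mult_less_top)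
  \<comment> \<open>\<open>N + d\<close> enters twice, and each time one \<open>d\<close> pays for
    near-optimality and one for strict positivity.\<close>
  define d where "d = e / 4"
  have d: "0 < d" using e by (simp add: d_def)
  obtain N where N: "0 \<le> N" "two_weight_ineq lam \<sigma> \<mu> N" "ennreal N < ?N + ennreal d"
    using best_constant_approx[OF fin d] by blast
  have tw: "two_weight_ineq lam \<sigma> \<mu> (N + d)" using N d by (intro two_weight_ineq_mono[OF N(2)]) auto
  have pos: "0 < N + d" using N d by simp
  have "?F \<le> ennreal (N + d)" "?B \<le> ennreal (N + d)"
    using two_weight_imp_forward[OF tw pos] two_weight_imp_backward[OF tw pos] pos by (auto intro!: best_constant_le)
  then have "?F + ?B \<le> ennreal (N + d) + ennreal (N + d)" by (rule add_mono)
  also have "\<dots> = (ennreal N + ennreal d) + (ennreal N + ennreal d)" using N d by simp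
  also have "\<dots> \<le> (?N + ennreal d + ennreal d) + (?N + ennreal d + ennreal d)"
    using N by (intro add_mono) auto
  also have "\<dots> = 2 * ?N + (ennreal d + ennreal d + ennreal d + ennreal d)"
    by (simp add: mult_2 add_ac)
  also have "ennreal d + ennreal d + ennreal d + ennreal d = ennreal (d + d + d + d)"
    using d by (simp add: ennreal_plus[symmetric] del: ennreal_plus)
  also have "d + d + d + d = e" by (simp add: d_def)
  finally show "?F + ?B \<le> 2 * ?N + ennreal e" .
qed

lemma two_weight_iff_testing:
  "(\<exists>N\<ge>0. two_weight_ineq lam \<sigma> \<mu> N) \<longleftrightarrow>
   (\<exists>F\<ge>0. \<exists>B\<ge>0. forward_testing lam \<sigma> \<mu> F \<and> backward_testing lam \<sigma> \<mu> B)"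
proof
  assume "\<exists>N\<ge>0. two_weight_ineq lam \<sigma> \<mu> N"
  then obtain N where N: "0 \<le> N" "two_weight_ineq lam \<sigma> \<mu> N" by blast
  have tw: "two_weight_ineq lam \<sigma> \<mu> (N + 1)" by (rule two_weight_ineq_mono[OF N(2)]) simp
  have pos: "0 < N + 1" using N by simp
  show "\<exists>F\<ge>0. \<exists>B\<ge>0. forward_testing lam \<sigma> \<mu> F \<and> backward_testing lam \<sigma> \<mu> B"
    using two_weight_imp_forward[OF tw pos] two_weight_imp_backward[OF tw pos] pos by (meson less_imp_le)
next
  assume "\<exists>F\<ge>0. \<exists>B\<ge>0. forward_testing lam \<sigma> \<mu> F \<and> backward_testing lam \<sigma> \<mu> B"
  then obtain F B where FB: "0 \<le> F" "0 \<le> B" "forward_testing lam \<sigma> \<mu> F" "backward_testing lam \<sigma> \<mu> B" by blast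
  have "two_weight_ineq lam \<sigma> \<mu> (C_suff * ((F + 1) + (B + 1)))"
    using FB by (intro testing_imp_two_weight forward_testing_mono[OF FB(3)] backward_testing_mono[OF FB(4)]) auto
  moreover have "0 \<le> C_suff * ((F + 1) + (B + 1))" using C_suff_pos FB by simp
  ultimately show "\<exists>N\<ge>0. two_weight_ineq lam \<sigma> \<mu> N" by blast
qed

end

theorem theorem1p1:
  fixes lam :: real
  assumes "lam > 0"
  shows "(\<forall>\<sigma> \<mu>. borel_measure_on pos_half_line \<sigma> \<and> finite_on_compacts \<sigma> \<and>
                borel_measure_on pos_quadrant \<mu> \<longrightarrow>
            ((\<exists>N\<ge>0. two_weight_ineq lam \<sigma> \<mu> N) \<longleftrightarrow>
             (\<exists>F\<ge>0. \<exists>B\<ge>0. forward_testing lam \<sigma> \<mu> F \<and> backward_testing lam \<sigma> \<mu> B))) \<and>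
         (\<exists>C>0. \<forall>\<sigma> \<mu>. borel_measure_on pos_half_line \<sigma> \<and> finite_on_compacts \<sigma> \<and>
                borel_measure_on pos_quadrant \<mu> \<longrightarrow>
            best_constant (two_weight_ineq lam \<sigma> \<mu>)
              \<le> ennreal C * (best_constant (forward_testing lam \<sigma> \<mu>)
                              + best_constant (backward_testing lam \<sigma> \<mu>)) \<and>
            best_constant (forward_testing lam \<sigma> \<mu>) + best_constant (backward_testing lam \<sigma> \<mu>)
              \<le> ennreal C * best_constant (two_weight_ineq lam \<sigma> \<mu>))"
proof -
  obtain c0 c1 where pos: "0 < c0" "0 < c1" and c: "\<forall>t>0. \<forall>x\<ge>0. \<forall>y\<ge>0.
      c0 * t * model_kernel lam t x y \<le> bessel_poisson_kernel lam t x y \<and>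
      bessel_poisson_kernel lam t x y \<le> c1 * t * model_kernel lam t x y"
    using kernel_comparable_model[OF assms] by (elim exE conjE)
  have wp: "weight_pair lam \<sigma> \<mu> c0 c1"
    if "borel_measure_on pos_half_line \<sigma> \<and> finite_on_compacts \<sigma> \<and> borel_measure_on pos_quadrant \<mu>" for \<sigma> \<mu>
    using that pos c assms by unfold_locales auto
  \<comment> \<open>\<open>c0\<close> and \<open>c1\<close> were obtained from \<open>lam\<close>
    before any measure was fixed, so \<open>C\<close> depends on \<open>lam\<close> only.
    \<open>C_suff\<close> serves the first inequality and 2 the second.\<close>
  define C where "C = max 2 (weight_pair.C_suff lam c0 c1)"
  show ?thesis
  proof (intro conjI exI[of _ C] allI impI)
    show "0 < C" by (simp add: C_def)
  next
    fix \<sigma> \<mu> assume "borel_measure_on pos_half_line \<sigma> \<and> finite_on_compacts \<sigma> \<and> borel_measure_on pos_quadrant \<mu>"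
    from wp[OF this] interpret weight_pair lam \<sigma> \<mu> c0 c1 .
    show "(\<exists>N\<ge>0. two_weight_ineq lam \<sigma> \<mu> N) \<longleftrightarrow>
       (\<exists>F\<ge>0. \<exists>B\<ge>0. forward_testing lam \<sigma> \<mu> F \<and> backward_testing lam \<sigma> \<mu> B)"
      by (rule two_weight_iff_testing)
    show "best_constant (two_weight_ineq lam \<sigma> \<mu>)
        \<le> ennreal C * (best_constant (forward_testing lam \<sigma> \<mu>) + best_constant (backward_testing lam \<sigma> \<mu>))"
      by (rule order_trans[OF best_two_weight_le]) (auto simp: C_def intro!: mult_right_mono ennreal_leI)
    have "ennreal 2 \<le> ennreal C" by (auto simp: C_def intro!: ennreal_leI)
    then show "best_constant (forward_testing lam \<sigma> \<mu>) + best_constant (backward_testing lam \<sigma> \<mu>)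
        \<le> ennreal C * best_constant (two_weight_ineq lam \<sigma> \<mu>)"
      by (intro order_trans[OF best_testing_le] mult_right_mono) auto
  qed
qed

end
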